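(* Let $R$ be a finite commutative ring in which $2$ is a unit, let $\mathbb{K}$ be a Noetherian ring, and let $\mathcal{A}=\mathbf{OrI}(R)$. For a positive integer $N$ let $\mathcal{A}_{\le N}$ denote the full subcategory of $\mathcal{A}$ spanned by (1) the objects of $R$-rank at most $N-1$, and (2) the objects isometric to the rank-$N$ orthogonal $R$-module $R^N$ equipped with the bilinear form whose matrix in the standard basis is the identity. Let $M$ be a finitely generated $\mathcal{A}$-module over $\mathbb{K}$. Then for all $N$ sufficiently large, $M$ is the left Kan extension of the restriction $M|_{\mathcal{A}_{\le N}}$ along the inclusion functor $p:\mathcal{A}_{\le N}\to\mathcal{A}$.
   Context: An orthogonal $R$-module is a pair $(V,B)$ with $V$ a free $R$-module of finite rank and $B:V\times V\to R$ a symmetric bilinear form that is non-degenerate, i.e. induces an isomorphism $V\to \mathrm{Hom}_R(V,R)$. An isometry $(V,B_V)\to(W,B_W)$ is an $R$-linear map $\phi$ with $B_V(v,w)=B_W(\phi(v),\phi(w))$ for all $v,w$ (not necessarily bijective). $\mathbf{OrI}(R)$ is the category of orthogonal $R$-modules and isometries. An $\mathcal{A}$-module over $\mathbb{K}$ is a functor $M:\mathcal{A}\to\mathbf{Mod}_{\mathbb{K}}$; submodules are defined pointwise. $M$ is finitely generated if there are finitely many objects $V_1,\dots,V_m$ and elements $x_i\in M(V_i)$ such that any submodule $N\subseteq M$ with $x_i\in N(V_i)$ for all $i$ equals $M$. Saying that $M$ is the left Kan extension means that the canonical natural transformation $\mathrm{Lan}_p(M|_{\mathcal{A}_{\le N}})\to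 M$, given by the universal property, is an isomorphism. *)

theory Defs
  imports "HOL-Algebra.Module" "HOL-Algebra.AbelCoset"
begin

section \<open>Modules over a possibly noncommutative ring\<close>

text \<open>The library locale \<open>module\<close> requires a commutative ring of scalars; for the coefficient
  ring we only ask for a ring, and modules are left modules.\<close>

locale left_module = R?: ring R + M?: abelian_group M
    for R :: "('a, 'b) ring_scheme" (structure) and M :: "('a, 'c, 'd) module_scheme" (structure) +
  assumes smult_closed [simp, intro]:
      "\<lbrakk>a \<in> carrier R; x \<in> carrier M\<rbrakk> \<Longrightarrow> a \<odot>\<^bsub>M\<^esub> x \<in> carrier M"
    and smult_l_distr:
      "\<lbrakk>a \<in> carrier R; b \<in> carrier R; x \<in> carrier M\<rbrakk> \<Longrightarrow>
      (a \<oplus> b) \<odot>\<^bsub>M\<^esub> x = a \<odot>\<^bsub>M\<^esub> x \<oplus>\<^bsub>M\<^esub> b \<odot>\<^bsub>M\<^esub> x"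
    and smult_r_distr:
      "\<lbrakk>a \<in> carrier R; x \<in> carrier M; y \<in> carrier M\<rbrakk> \<Longrightarrow>
      a \<odot>\<^bsub>M\<^esub> (x \<oplus>\<^bsub>M\<^esub> y) = a \<odot>\<^bsub>M\<^esub> x \<oplus>\<^bsub>M\<^esub> a \<odot>\<^bsub>M\<^esub> y"
    and smult_assoc1:
      "\<lbrakk>a \<in> carrier R; b \<in> carrier R; x \<in> carrier M\<rbrakk> \<Longrightarrow>
      (a \<otimes> b) \<odot>\<^bsub>M\<^esub> x = a \<odot>\<^bsub>M\<^esub> (b \<odot>\<^bsub>M\<^esub> x)"
    and smult_one [simp]:
      "x \<in> carrier M \<Longrightarrow> \<one> \<odot>\<^bsub>M\<^esub> x = x"

lemma module_iff_left_module: "module R M \<longleftrightarrow> cring R \<and> left_module R M"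
  by (auto simp: module_def left_module_def module_axioms_def left_module_axioms_def cring_def)

text \<open>Linear maps are extensional functions, so that two of them are equal as soon as they agree
  on the source module.\<close>

definition linear_maps ::
  "('k, 'p) ring_scheme \<Rightarrow> ('k, 'a, 'c) module_scheme \<Rightarrow> ('k, 'b, 'd) module_scheme \<Rightarrow> ('a \<Rightarrow> 'b) set"
  where "linear_maps K E F = {f \<in> carrier E \<rightarrow>\<^sub>E carrier F.
    (\<forall>x\<in>carrier E. \<forall>y\<in>carrier E. f (x \<oplus>\<^bsub>E\<^esub> y) = f x \<oplus>\<^bsub>F\<^esub> f y) \<and>
    (\<forall>a\<in>carrier K. \<forall>x\<in>carrier E. f (a \<odot>\<^bsub>E\<^esub> x) = a \<odot>\<^bsub>F\<^esub> f x)}"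

definition submodule_generated ::
  "('k, 'p) ring_scheme \<Rightarrow> ('k, 'a, 'c) module_scheme \<Rightarrow> 'a set \<Rightarrow> 'a set"
  where "submodule_generated K E A = \<Inter> {H. submodule H K E \<and> A \<subseteq> H}"

definition regular_module :: "('k, 'p) ring_scheme \<Rightarrow> ('k, 'k) module"
  where "regular_module K = \<lparr>carrier = carrier K, mult = mult K, one = \<one>\<^bsub>K\<^esub>,
    zero = \<zero>\<^bsub>K\<^esub>, add = add K, smult = mult K\<rparr>"

text \<open>Submodules of the regular left module are exactly the left ideals.  (The library's
  \<open>noetherian_ring\<close> only speaks about two-sided ideals.)\<close>

locale left_noetherian_ring = ring K for K (structure) +
  assumes left_ideal_fin_gen: "submodule I K (regular_module K) \<Longrightarrow>
    \<exists>A \<subseteq> carrier K. finite A \<and> I = submodule_generated K (regular_module K) A"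

text \<open>The record type \<open>module\<close> extends \<open>ring\<close>; its fields \<open>mult\<close> and \<open>one\<close> carry no
  information for modules.\<close>

definition direct_sum :: "'i set \<Rightarrow> ('i \<Rightarrow> ('k, 'm) module) \<Rightarrow> ('k, 'i \<Rightarrow> 'm) module"
  where "direct_sum I E = \<lparr>
    carrier = {f \<in> \<Pi>\<^sub>E i\<in>I. carrier (E i). finite {i\<in>I. f i \<noteq> \<zero>\<^bsub>E i\<^esub>}},
    mult = undefined, one = undefined,
    zero = (\<lambda>i\<in>I. \<zero>\<^bsub>E i\<^esub>),
    add = (\<lambda>f g. \<lambda>i\<in>I. f i \<oplus>\<^bsub>E i\<^esub> g i),
    smult = (\<lambda>a f. \<lambda>i\<in>I. a \<odot>\<^bsub>E i\<^esub> f i)\<rparr>"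

definition ds_incl :: "'i set \<Rightarrow> ('i \<Rightarrow> ('k, 'm) module) \<Rightarrow> 'i \<Rightarrow> 'm \<Rightarrow> 'i \<Rightarrow> 'm"
  where "ds_incl I E i x = (\<lambda>j\<in>I. if j = i then x else \<zero>\<^bsub>E j\<^esub>)"

definition ds_lift ::
  "'i set \<Rightarrow> ('i \<Rightarrow> ('k, 'm) module) \<Rightarrow> ('k, 'n) module \<Rightarrow> ('i \<Rightarrow> 'm \<Rightarrow> 'n) \<Rightarrow> ('i \<Rightarrow> 'm) \<Rightarrow> 'n"
  where "ds_lift I E F g f = (\<Oplus>\<^bsub>F\<^esub>i\<in>{i\<in>I. f i \<noteq> \<zero>\<^bsub>E i\<^esub>}. g i (f i))"

definition quotient_module :: "('k, 'm) module \<Rightarrow> 'm set \<Rightarrow> ('k, 'm set) module"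
  where "quotient_module E H = \<lparr>carrier = a_rcosets\<^bsub>E\<^esub> H,
    mult = undefined, one = undefined,
    zero = H, add = set_add E,
    smult = (\<lambda>a S. \<Union>x\<in>S. H +>\<^bsub>E\<^esub> (a \<odot>\<^bsub>E\<^esub> x))\<rparr>"

section \<open>Categories, functors, and modules over a category\<close>

text \<open>Hom-sets need not be disjoint, so composition and the action of functors on arrows take
  the source and target objects as arguments: \<open>Cmp C U V W g f\<close> is the composite of
  \<open>f : U \<rightarrow> V\<close> and \<open>g : V \<rightarrow> W\<close>.\<close>

record ('o, 'a) cat =
  Obj :: "'o set"
  Hom :: "'o \<Rightarrow> 'o \<Rightarrow> 'a set"
  Idn :: "'o \<Rightarrow> 'a"
  Cmp :: "'o \<Rightarrow> 'o \<Rightarrow> 'o \<Rightarrow> 'a \<Rightarrow> 'a \<Rightarrow> 'a"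

definition category :: "('o, 'a) cat \<Rightarrow> bool"
  where "category C \<longleftrightarrow>
    (\<forall>U\<in>Obj C. Idn C U \<in> Hom C U U) \<and>
    (\<forall>U\<in>Obj C. \<forall>V\<in>Obj C. \<forall>W\<in>Obj C. \<forall>f\<in>Hom C U V. \<forall>g\<in>Hom C V W.
      Cmp C U V W g f \<in> Hom C U W) \<and>
    (\<forall>U\<in>Obj C. \<forall>V\<in>Obj C. \<forall>f\<in>Hom C U V.
      Cmp C U V V (Idn C V) f = f \<and> Cmp C U U V f (Idn C U) = f) \<and>
    (\<forall>U\<in>Obj C. \<forall>V\<in>Obj C. \<forall>W\<in>Obj C. \<forall>Z\<in>Obj C.
      \<forall>f\<in>Hom C U V. \<forall>g\<in>Hom C V W. \<forall>h\<in>Hom C W Z.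
      Cmp C U V Z (Cmp C V W Z h g) f = Cmp C U W Z h (Cmp C U V W g f))"

record ('o, 'a, 'p, 'b) funct =
  fob :: "'o \<Rightarrow> 'p"
  far :: "'o \<Rightarrow> 'o \<Rightarrow> 'a \<Rightarrow> 'b"

definition is_functor :: "('o, 'a) cat \<Rightarrow> ('p, 'b) cat \<Rightarrow> ('o, 'a, 'p, 'b) funct \<Rightarrow> bool"
  where "is_functor D C p \<longleftrightarrow>
    (\<forall>U\<in>Obj D. fob p U \<in> Obj C) \<and>
    (\<forall>U\<in>Obj D. \<forall>V\<in>Obj D. \<forall>f\<in>Hom D U V. far p U V f \<in> Hom C (fob p U) (fob p V)) \<and>
    (\<forall>U\<in>Obj D. far p U U (Idn D U) = Idn C (fob p U)) \<and>
    (\<forall>U\<in>Obj D. \<forall>V\<in>Obj D. \<forall>W\<in>Obj D. \<forall>f\<in>Hom D U V. \<forall>g\<in>Hom D V W.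
      far p U W (Cmp D U V W g f) =
        Cmp C (fob p U) (fob p V) (fob p W) (far p V W g) (far p U V f))"

definition full_subcat :: "('o, 'a) cat \<Rightarrow> ('o \<Rightarrow> bool) \<Rightarrow> ('o, 'a) cat"
  where "full_subcat C P = C\<lparr>Obj := {U \<in> Obj C. P U}\<rparr>"

definition inclusion_functor :: "('o, 'a, 'o, 'a) funct"
  where "inclusion_functor = \<lparr>fob = (\<lambda>U. U), far = (\<lambda>U V f. f)\<rparr>"

text \<open>A \<open>C\<close>-module over \<open>K\<close> is a functor from \<open>C\<close> to left \<open>K\<close>-modules.\<close>

type_synonym ('o, 'a, 'k, 'm) catmod = "('o, 'a, ('k, 'm) module, 'm \<Rightarrow> 'm) funct"

definition cat_module ::
  "('o, 'a) cat \<Rightarrow> ('k, 'p) ring_scheme \<Rightarrow> ('o, 'a, 'k, 'm) catmod \<Rightarrow> bool"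
  where "cat_module C K M \<longleftrightarrow>
    (\<forall>U\<in>Obj C. left_module K (fob M U)) \<and>
    (\<forall>U\<in>Obj C. \<forall>V\<in>Obj C. \<forall>f\<in>Hom C U V. far M U V f \<in> linear_maps K (fob M U) (fob M V)) \<and>
    (\<forall>U\<in>Obj C. far M U U (Idn C U) = (\<lambda>x\<in>carrier (fob M U). x)) \<and>
    (\<forall>U\<in>Obj C. \<forall>V\<in>Obj C. \<forall>W\<in>Obj C. \<forall>f\<in>Hom C U V. \<forall>g\<in>Hom C V W.
      far M U W (Cmp C U V W g f) = compose (carrier (fob M U)) (far M V W g) (far M U V f))"

definition cat_submodule ::
  "('o, 'a) cat \<Rightarrow> ('k, 'p) ring_scheme \<Rightarrow> ('o, 'a, 'k, 'm) catmod \<Rightarrow> ('o \<Rightarrow> 'm set) \<Rightarrow> bool"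
  where "cat_submodule C K M L \<longleftrightarrow>
    (\<forall>U\<in>Obj C. submodule (L U) K (fob M U)) \<and>
    (\<forall>U\<in>Obj C. \<forall>V\<in>Obj C. \<forall>f\<in>Hom C U V. far M U V f ` L U \<subseteq> L V)"

definition cat_module_fin_gen ::
  "('o, 'a) cat \<Rightarrow> ('k, 'p) ring_scheme \<Rightarrow> ('o, 'a, 'k, 'm) catmod \<Rightarrow> bool"
  where "cat_module_fin_gen C K M \<longleftrightarrow>
    (\<exists>S. finite S \<and> S \<subseteq> (SIGMA U : Obj C. carrier (fob M U)) \<and>
      (\<forall>L. cat_submodule C K M L \<and> (\<forall>(U, x)\<in>S. x \<in> L U) \<longrightarrow>
        (\<forall>U\<in>Obj C. L U = carrier (fob M U))))"

definition nat_trans ::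
  "('o, 'a) cat \<Rightarrow> ('k, 'p) ring_scheme \<Rightarrow> ('o, 'a, 'k, 'm) catmod \<Rightarrow> ('o, 'a, 'k, 'n) catmod \<Rightarrow>
    ('o \<Rightarrow> 'm \<Rightarrow> 'n) \<Rightarrow> bool"
  where "nat_trans C K F G \<tau> \<longleftrightarrow>
    (\<forall>U\<in>Obj C. \<tau> U \<in> linear_maps K (fob F U) (fob G U)) \<and>
    (\<forall>U\<in>Obj C. \<forall>V\<in>Obj C. \<forall>f\<in>Hom C U V.
      compose (carrier (fob F U)) (\<tau> V) (far F U V f) =
      compose (carrier (fob F U)) (far G U V f) (\<tau> U))"

definition nat_iso ::
  "('o, 'a) cat \<Rightarrow> ('k, 'p) ring_scheme \<Rightarrow> ('o, 'a, 'k, 'm) catmod \<Rightarrow> ('o, 'a, 'k, 'n) catmod \<Rightarrow>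
    ('o \<Rightarrow> 'm \<Rightarrow> 'n) \<Rightarrow> bool"
  where "nat_iso C K F G \<tau> \<longleftrightarrow> nat_trans C K F G \<tau> \<and>
    (\<forall>U\<in>Obj C. bij_betw (\<tau> U) (carrier (fob F U)) (carrier (fob G U)))"

definition pullback ::
  "('o, 'a, 'p, 'b) funct \<Rightarrow> ('p, 'b, 'k, 'm) catmod \<Rightarrow> ('o, 'a, 'k, 'm) catmod"
  where "pullback p M = \<lparr>fob = (\<lambda>U. fob M (fob p U)),
    far = (\<lambda>U V f. far M (fob p U) (fob p V) (far p U V f))\<rparr>"

section \<open>Left Kan extension\<close>

text \<open>\<open>Lan_p P\<close> at \<open>V\<close> is the colimit of \<open>P(U)\<close> over the comma category of pairs
  \<open>(U, \<phi> : p(U) \<rightarrow> V)\<close>, realised as the quotient of the direct sum of the \<open>P(U)\<close> by the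
  relations \<open>[U, \<psi> \<circ> p(u), x] = [U', \<psi>, P(u) x]\<close> for \<open>u : U \<rightarrow> U'\<close> and \<open>\<psi> : p(U') \<rightarrow> V\<close>.
  Its universal property is theorem \<open>lan_universal\<close> below.\<close>

definition comma :: "('o, 'a) cat \<Rightarrow> ('p, 'b) cat \<Rightarrow> ('o, 'a, 'p, 'b) funct \<Rightarrow> 'p \<Rightarrow> ('o \<times> 'b) set"
  where "comma D C p V = (SIGMA U : Obj D. Hom C (fob p U) V)"

definition lan_sum ::
  "('o, 'a) cat \<Rightarrow> ('p, 'b) cat \<Rightarrow> ('o, 'a, 'p, 'b) funct \<Rightarrow> ('o, 'a, 'k, 'm) catmod \<Rightarrow> 'p \<Rightarrow>
    ('k, 'o \<times> 'b \<Rightarrow> 'm) module"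
  where "lan_sum D C p P V = direct_sum (comma D C p V) (\<lambda>i. fob P (fst i))"

definition lan_gen ::
  "('o, 'a) cat \<Rightarrow> ('p, 'b) cat \<Rightarrow> ('o, 'a, 'p, 'b) funct \<Rightarrow> ('o, 'a, 'k, 'm) catmod \<Rightarrow> 'p \<Rightarrow>
    'o \<times> 'b \<Rightarrow> 'm \<Rightarrow> ('o \<times> 'b \<Rightarrow> 'm)"
  where "lan_gen D C p P V = ds_incl (comma D C p V) (\<lambda>i. fob P (fst i))"

definition lan_relations ::
  "('o, 'a) cat \<Rightarrow> ('p, 'b) cat \<Rightarrow> ('o, 'a, 'p, 'b) funct \<Rightarrow> ('o, 'a, 'k, 'm) catmod \<Rightarrow> 'p \<Rightarrow>
    ('o \<times> 'b \<Rightarrow> 'm) set"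
  where "lan_relations D C p P V =
    {lan_gen D C p P V (U, Cmp C (fob p U) (fob p U') V \<psi> (far p U U' u)) x
       \<ominus>\<^bsub>lan_sum D C p P V\<^esub> lan_gen D C p P V (U', \<psi>) (far P U U' u x) |U U' u \<psi> x.
     U \<in> Obj D \<and> U' \<in> Obj D \<and> u \<in> Hom D U U' \<and> \<psi> \<in> Hom C (fob p U') V \<and>
     x \<in> carrier (fob P U)}"

definition lan_ob ::
  "('k, 'q) ring_scheme \<Rightarrow> ('o, 'a) cat \<Rightarrow> ('p, 'b) cat \<Rightarrow> ('o, 'a, 'p, 'b) funct \<Rightarrow>
    ('o, 'a, 'k, 'm) catmod \<Rightarrow> 'p \<Rightarrow> ('k, ('o \<times> 'b \<Rightarrow> 'm) set) module"
  where "lan_ob K D C p P V = quotient_module (lan_sum D C p P V)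
    (submodule_generated K (lan_sum D C p P V) (lan_relations D C p P V))"

definition lan_class ::
  "('k, 'q) ring_scheme \<Rightarrow> ('o, 'a) cat \<Rightarrow> ('p, 'b) cat \<Rightarrow> ('o, 'a, 'p, 'b) funct \<Rightarrow>
    ('o, 'a, 'k, 'm) catmod \<Rightarrow> 'p \<Rightarrow> 'o \<times> 'b \<Rightarrow> 'm \<Rightarrow> ('o \<times> 'b \<Rightarrow> 'm) set"
  where "lan_class K D C p P V i = (\<lambda>x\<in>carrier (fob P (fst i)).
    submodule_generated K (lan_sum D C p P V) (lan_relations D C p P V)
      +>\<^bsub>lan_sum D C p P V\<^esub> lan_gen D C p P V i x)"

text \<open>The map out of the colimit induced by a cocone \<open>g\<close> with vertex \<open>F\<close>: for such a \<open>g\<close>,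
  \<open>ds_lift\<close> is constant on every coset, and \<open>the_elem\<close> picks that constant value.\<close>

definition lan_desc ::
  "('k, 'q) ring_scheme \<Rightarrow> ('o, 'a) cat \<Rightarrow> ('p, 'b) cat \<Rightarrow> ('o, 'a, 'p, 'b) funct \<Rightarrow>
    ('o, 'a, 'k, 'm) catmod \<Rightarrow> 'p \<Rightarrow> ('k, 'n) module \<Rightarrow> ('o \<times> 'b \<Rightarrow> 'm \<Rightarrow> 'n) \<Rightarrow>
    ('o \<times> 'b \<Rightarrow> 'm) set \<Rightarrow> 'n"
  where "lan_desc K D C p P V F g = (\<lambda>S\<in>carrier (lan_ob K D C p P V).
    the_elem (ds_lift (comma D C p V) (\<lambda>i. fob P (fst i)) F g ` S))"

definition lan ::
  "('k, 'q) ring_scheme \<Rightarrow> ('o, 'a) cat \<Rightarrow> ('p, 'b) cat \<Rightarrow> ('o, 'a, 'p, 'b) funct \<Rightarrow>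
    ('o, 'a, 'k, 'm) catmod \<Rightarrow> ('p, 'b, 'k, ('o \<times> 'b \<Rightarrow> 'm) set) catmod"
  where "lan K D C p P = \<lparr>fob = lan_ob K D C p P,
    far = (\<lambda>V W \<theta>. lan_desc K D C p P V (lan_ob K D C p P W)
      (\<lambda>(U, \<phi>). lan_class K D C p P W (U, Cmp C (fob p U) V W \<theta> \<phi>)))\<rparr>"

definition lan_unit ::
  "('k, 'q) ring_scheme \<Rightarrow> ('o, 'a) cat \<Rightarrow> ('p, 'b) cat \<Rightarrow> ('o, 'a, 'p, 'b) funct \<Rightarrow>
    ('o, 'a, 'k, 'm) catmod \<Rightarrow> 'o \<Rightarrow> 'm \<Rightarrow> ('o \<times> 'b \<Rightarrow> 'm) set"
  where "lan_unit K D C p P U = lan_class K D C p P (fob p U) (U, Idn C (fob p U))"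

text \<open>The canonical transformation \<open>Lan_p (M \<circ> p) \<rightarrow> M\<close>, sending \<open>[U, \<phi>, x]\<close> to \<open>M(\<phi>) x\<close>;
  composed with the unit it
  is the identity (\<open>lan_canonical_unit\<close>), so by \<open>lan_universal\<close> it is the transformation given by
  the universal property.\<close>

definition lan_canonical ::
  "('k, 'q) ring_scheme \<Rightarrow> ('o, 'a) cat \<Rightarrow> ('p, 'b) cat \<Rightarrow> ('o, 'a, 'p, 'b) funct \<Rightarrow>
    ('p, 'b, 'k, 'm) catmod \<Rightarrow> 'p \<Rightarrow> ('o \<times> 'b \<Rightarrow> 'm) set \<Rightarrow> 'm"
  where "lan_canonical K D C p M V = lan_desc K D C p (pullback p M) V (fob M V)
    (\<lambda>(U, \<phi>). far M (fob p U) V \<phi>)"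

definition is_lan_of_restriction ::
  "('k, 'q) ring_scheme \<Rightarrow> ('o, 'a) cat \<Rightarrow> ('p, 'b) cat \<Rightarrow> ('o, 'a, 'p, 'b) funct \<Rightarrow>
    ('p, 'b, 'k, 'm) catmod \<Rightarrow> bool"
  where "is_lan_of_restriction K D C p M \<longleftrightarrow>
    nat_iso C K (lan K D C p (pullback p M)) M (lan_canonical K D C p M)"

section \<open>Orthogonal modules\<close>

definition free_of_rank :: "('r, 'p) ring_scheme \<Rightarrow> ('r, 'v, 'q) module_scheme \<Rightarrow> nat \<Rightarrow> bool"
  where "free_of_rank R V n \<longleftrightarrow> (\<exists>b \<in> {..<n} \<rightarrow> carrier V. \<forall>v\<in>carrier V.
    \<exists>!c. c \<in> {..<n} \<rightarrow>\<^sub>E carrier R \<and> v = (\<Oplus>\<^bsub>V\<^esub>i\<in>{..<n}. c i \<odot>\<^bsub>V\<^esub> b i))"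

type_synonym ('r, 'v) orth = "('r, 'v) module \<times> ('v \<Rightarrow> 'v \<Rightarrow> 'r)"

definition symmetric_bilinear :: "('r, 'p) ring_scheme \<Rightarrow> ('r, 'v) orth \<Rightarrow> bool"
  where "symmetric_bilinear R = (\<lambda>(V, B).
    (\<forall>v\<in>carrier V. (\<lambda>w\<in>carrier V. B v w) \<in> linear_maps R V (regular_module R)) \<and>
    (\<forall>w\<in>carrier V. (\<lambda>v\<in>carrier V. B v w) \<in> linear_maps R V (regular_module R)) \<and>
    (\<forall>v\<in>carrier V. \<forall>w\<in>carrier V. B v w = B w v))"

definition nondegenerate :: "('r, 'p) ring_scheme \<Rightarrow> ('r, 'v) orth \<Rightarrow> bool"
  where "nondegenerate R = (\<lambda>(V, B). bij_betw (\<lambda>v. \<lambda>w\<in>carrier V. B v w)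
    (carrier V) (linear_maps R V (regular_module R)))"

definition orthogonal_module :: "('r, 'p) ring_scheme \<Rightarrow> ('r, 'v) orth \<Rightarrow> bool"
  where "orthogonal_module R E \<longleftrightarrow> module R (fst E) \<and> (\<exists>n. free_of_rank R (fst E) n) \<and>
    symmetric_bilinear R E \<and> nondegenerate R E"

definition isometries ::
  "('r, 'p) ring_scheme \<Rightarrow> ('r, 'v) orth \<Rightarrow> ('r, 'w) orth \<Rightarrow> ('v \<Rightarrow> 'w) set"
  where "isometries R = (\<lambda>(V, B) (W, B'). {\<phi> \<in> linear_maps R V W.
    \<forall>v\<in>carrier V. \<forall>w\<in>carrier V. B v w = B' (\<phi> v) (\<phi> w)})"

definition isometric :: "('r, 'p) ring_scheme \<Rightarrow> ('r, 'v) orth \<Rightarrow> ('r, 'w) orth \<Rightarrow> bool"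
  where "isometric R E F \<longleftrightarrow>
    (\<exists>\<phi>\<in>isometries R E F. bij_betw \<phi> (carrier (fst E)) (carrier (fst F)))"

definition std_orth :: "('r, 'p) ring_scheme \<Rightarrow> nat \<Rightarrow> ('r, nat \<Rightarrow> 'r) orth"
  where "std_orth R n = (direct_sum {..<n} (\<lambda>_. regular_module R),
    \<lambda>x y. \<Oplus>\<^bsub>R\<^esub>i\<in>{..<n}. x i \<otimes>\<^bsub>R\<^esub> y i)"

text \<open>The objects are the orthogonal modules whose underlying set is contained in the type
  \<open>'v\<close>.  If \<open>R\<close> is finite, free modules of finite rank are finite sets, so as soon as \<open>'v\<close> is
  infinite every orthogonal \<open>R\<close>-module is isometric to one of these objects.\<close>

definition OrI :: "('r, 'p) ring_scheme \<Rightarrow> (('r, 'v) orth, 'v \<Rightarrow> 'v) cat"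
  where "OrI R = \<lparr>Obj = {E. orthogonal_module R E}, Hom = isometries R,
    Idn = (\<lambda>E. \<lambda>x\<in>carrier (fst E). x),
    Cmp = (\<lambda>E F G \<psi> \<phi>. compose (carrier (fst E)) \<psi> \<phi>)\<rparr>"

text \<open>Only meant for \<open>N > 0\<close>, where rank at most \<open>N - 1\<close> is rank less than \<open>N\<close>.\<close>

definition OrI_le :: "('r, 'p) ring_scheme \<Rightarrow> nat \<Rightarrow> (('r, 'v) orth, 'v \<Rightarrow> 'v) cat"
  where "OrI_le R N = full_subcat (OrI R)
    (\<lambda>E. (\<exists>n<N. free_of_rank R (fst E) n) \<or> isometric R E (std_orth R N))"

section \<open>Linear maps, direct sums and quotients\<close>

lemma linear_mapsD:
  assumes "f \<in> linear_maps K E F"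
  shows "x \<in> carrier E \<Longrightarrow> f x \<in> carrier F"
    and "x \<in> carrier E \<Longrightarrow> y \<in> carrier E \<Longrightarrow> f (x \<oplus>\<^bsub>E\<^esub> y) = f x \<oplus>\<^bsub>F\<^esub> f y"
    and "a \<in> carrier K \<Longrightarrow> x \<in> carrier E \<Longrightarrow> f (a \<odot>\<^bsub>E\<^esub> x) = a \<odot>\<^bsub>F\<^esub> f x"
    and "f \<in> extensional (carrier E)"
  using assms by (auto simp: linear_maps_def PiE_def)

lemma linear_mapsI:
  assumes "\<And>x. x \<in> carrier E \<Longrightarrow> f x \<in> carrier F"
    and "\<And>x y. x \<in> carrier E \<Longrightarrow> y \<in> carrier E \<Longrightarrow> f (x \<oplus>\<^bsub>E\<^esub> y) = f x \<oplus>\<^bsub>F\<^esub> f y"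
    and "\<And>a x. a \<in> carrier K \<Longrightarrow> x \<in> carrier E \<Longrightarrow> f (a \<odot>\<^bsub>E\<^esub> x) = a \<odot>\<^bsub>F\<^esub> f x"
    and "f \<in> extensional (carrier E)"
  shows "f \<in> linear_maps K E F"
  using assms by (auto simp: linear_maps_def PiE_def)

lemma linear_maps_ext:
  assumes "f \<in> linear_maps K E F" "g \<in> linear_maps K E F'"
    and "\<And>x. x \<in> carrier E \<Longrightarrow> f x = g x"
  shows "f = g"
  using assms linear_mapsD(4) by (metis extensionalityI)

lemma linear_maps_compose:
  assumes "f \<in> linear_maps K E F" "g \<in> linear_maps K F G" "left_module K E"
  shows "compose (carrier E) g f \<in> linear_maps K E G"
proof -
  interpret left_module K E by fact
  show ?thesis
    by (rule linear_mapsI)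
      (auto simp: compose_def linear_mapsD[OF assms(1)] linear_mapsD[OF assms(2)])
qed

lemma linear_maps_zero:
  assumes "f \<in> linear_maps K E F" "left_module K E" "left_module K F"
  shows "f \<zero>\<^bsub>E\<^esub> = \<zero>\<^bsub>F\<^esub>"
proof -
  interpret E: left_module K E by fact
  interpret F: left_module K F by fact
  have "f \<zero>\<^bsub>E\<^esub> = f \<zero>\<^bsub>E\<^esub> \<oplus>\<^bsub>F\<^esub> f \<zero>\<^bsub>E\<^esub>"
    using linear_mapsD(2)[OF assms(1), of "\<zero>\<^bsub>E\<^esub>" "\<zero>\<^bsub>E\<^esub>"] by simp
  then show ?thesis
    using linear_mapsD(1)[OF assms(1), of "\<zero>\<^bsub>E\<^esub>"] F.add.l_cancel_one by fastforce
qed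

lemma linear_maps_minus:
  assumes "f \<in> linear_maps K E F" "left_module K E" "left_module K F"
    and "x \<in> carrier E" "y \<in> carrier E"
  shows "f (x \<ominus>\<^bsub>E\<^esub> y) = f x \<ominus>\<^bsub>F\<^esub> f y"
proof -
  interpret E: left_module K E by fact
  interpret F: left_module K F by fact
  note c = linear_mapsD(1)[OF assms(1)]
  have "f y \<oplus>\<^bsub>F\<^esub> f (\<ominus>\<^bsub>E\<^esub> y) = \<zero>\<^bsub>F\<^esub>"
    using linear_mapsD(2)[OF assms(1), of y "\<ominus>\<^bsub>E\<^esub> y"] assms linear_maps_zero[OF assms(1-3)]
    by (simp add: E.M.r_neg)
  then have "f (\<ominus>\<^bsub>E\<^esub> y) = \<ominus>\<^bsub>F\<^esub> f y"
    using assms c by (metis E.M.a_inv_closed F.M.a_comm F.M.minus_equality)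
  then show ?thesis
    using assms by (simp add: a_minus_def linear_mapsD(2)[OF assms(1)])
qed

lemma left_module_smult_zero:
  assumes "left_module K E" "a \<in> carrier K"
  shows "a \<odot>\<^bsub>E\<^esub> \<zero>\<^bsub>E\<^esub> = \<zero>\<^bsub>E\<^esub>"
proof -
  interpret left_module K E by fact
  have "a \<odot>\<^bsub>E\<^esub> \<zero>\<^bsub>E\<^esub> = a \<odot>\<^bsub>E\<^esub> \<zero>\<^bsub>E\<^esub> \<oplus>\<^bsub>E\<^esub> a \<odot>\<^bsub>E\<^esub> \<zero>\<^bsub>E\<^esub>"
    using smult_r_distr[of a "\<zero>\<^bsub>E\<^esub>" "\<zero>\<^bsub>E\<^esub>"] assms by simp
  then show ?thesis using assms by (metis M.add.l_cancel_one M.zero_closed smult_closed)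
qed

lemma left_module_smult_inv:
  assumes "left_module K E" "a \<in> carrier K" "x \<in> carrier E"
  shows "a \<odot>\<^bsub>E\<^esub> (\<ominus>\<^bsub>E\<^esub> x) = \<ominus>\<^bsub>E\<^esub> (a \<odot>\<^bsub>E\<^esub> x)"
proof -
  interpret left_module K E by fact
  have "a \<odot>\<^bsub>E\<^esub> (\<ominus>\<^bsub>E\<^esub> x) \<oplus>\<^bsub>E\<^esub> a \<odot>\<^bsub>E\<^esub> x = \<zero>\<^bsub>E\<^esub>"
    using smult_r_distr[of a "\<ominus>\<^bsub>E\<^esub> x" x] assms
    by (simp add: M.l_neg left_module_smult_zero[OF assms(1)])
  then show ?thesis using assms by (simp add: M.minus_equality)
qed

subsection \<open>Direct sums\<close>

lemma direct_sum_simps [simp]: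
  "carrier (direct_sum I A) = {f \<in> \<Pi>\<^sub>E i\<in>I. carrier (A i). finite {i\<in>I. f i \<noteq> \<zero>\<^bsub>A i\<^esub>}}"
  "\<zero>\<^bsub>direct_sum I A\<^esub> = (\<lambda>i\<in>I. \<zero>\<^bsub>A i\<^esub>)"
  "f \<oplus>\<^bsub>direct_sum I A\<^esub> g = (\<lambda>i\<in>I. f i \<oplus>\<^bsub>A i\<^esub> g i)"
  "a \<odot>\<^bsub>direct_sum I A\<^esub> f = (\<lambda>i\<in>I. a \<odot>\<^bsub>A i\<^esub> f i)"
  by (simp_all add: direct_sum_def)

lemma direct_sum_left_module:
  assumes K: "ring K" and A: "\<And>i. i \<in> I \<Longrightarrow> left_module K (A i)"
  shows "left_module K (direct_sum I A)"
proof -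
  have ag: "abelian_group (A i)" if "i \<in> I" for i
    using A[OF that] by (simp add: left_module_def)
  note ag' = ag[THEN abelian_group.axioms(1)]
  note cl = abelian_monoid.a_closed[OF ag'] abelian_monoid.zero_closed[OF ag']
    abelian_group.a_inv_closed[OF ag] left_module.smult_closed[OF A]
  have "abelian_group (direct_sum I A)"
  proof (rule abelian_groupI)
    fix f g assume f: "f \<in> carrier (direct_sum I A)" and g: "g \<in> carrier (direct_sum I A)"
    have "{i\<in>I. f i \<oplus>\<^bsub>A i\<^esub> g i \<noteq> \<zero>\<^bsub>A i\<^esub>} \<subseteq> {i\<in>I. f i \<noteq> \<zero>\<^bsub>A i\<^esub>} \<union> {i\<in>I. g i \<noteq> \<zero>\<^bsub>A i\<^esub>}"
      using abelian_monoid.l_zero[OF ag' cl(2)] by auto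
    then have "finite {i\<in>I. f i \<oplus>\<^bsub>A i\<^esub> g i \<noteq> \<zero>\<^bsub>A i\<^esub>}"
      by (rule finite_subset) (use f g in simp)
    moreover have "{i\<in>I. (\<lambda>i\<in>I. f i \<oplus>\<^bsub>A i\<^esub> g i) i \<noteq> \<zero>\<^bsub>A i\<^esub>} = {i\<in>I. f i \<oplus>\<^bsub>A i\<^esub> g i \<noteq> \<zero>\<^bsub>A i\<^esub>}"
      by auto
    ultimately show "f \<oplus>\<^bsub>direct_sum I A\<^esub> g \<in> carrier (direct_sum I A)"
      using f g cl(1) by (auto simp: PiE_iff simp del: restrict_apply) (simp add: cl)
    show "f \<oplus>\<^bsub>direct_sum I A\<^esub> g = g \<oplus>\<^bsub>direct_sum I A\<^esub> f"
      using f g abelian_monoid.a_comm[OF ag'] by (auto simp: PiE_iff intro!: restrict_ext)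
  next
    fix f g h assume f: "f \<in> carrier (direct_sum I A)" "g \<in> carrier (direct_sum I A)" "h \<in> carrier (direct_sum I A)"
    then show "f \<oplus>\<^bsub>direct_sum I A\<^esub> g \<oplus>\<^bsub>direct_sum I A\<^esub> h = f \<oplus>\<^bsub>direct_sum I A\<^esub> (g \<oplus>\<^bsub>direct_sum I A\<^esub> h)"
      using abelian_monoid.a_assoc[OF ag'] by (auto simp: PiE_iff intro!: restrict_ext)
  next
    have "{i\<in>I. (\<lambda>i\<in>I. \<zero>\<^bsub>A i\<^esub>) i \<noteq> \<zero>\<^bsub>A i\<^esub>} = {}" by auto
    then show "\<zero>\<^bsub>direct_sum I A\<^esub> \<in> carrier (direct_sum I A)"
      using cl(2) by (simp cong: conj_cong)
  next
    fix f assume f: "f \<in> carrier (direct_sum I A)"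
    then show "\<zero>\<^bsub>direct_sum I A\<^esub> \<oplus>\<^bsub>direct_sum I A\<^esub> f = f"
      using abelian_monoid.l_zero[OF ag'] by (auto simp: PiE_iff intro!: extensionalityI[where A=I])
    let ?g = "\<lambda>i\<in>I. \<ominus>\<^bsub>A i\<^esub> f i"
    have "{i\<in>I. ?g i \<noteq> \<zero>\<^bsub>A i\<^esub>} \<subseteq> {i\<in>I. f i \<noteq> \<zero>\<^bsub>A i\<^esub>}"
      using monoid.inv_one[OF group.is_monoid[OF abelian_group.a_group[OF ag]]] by (auto simp: a_inv_def)
    then have "finite {i\<in>I. ?g i \<noteq> \<zero>\<^bsub>A i\<^esub>}"
      by (rule finite_subset) (use f in simp)
    then have "?g \<in> carrier (direct_sum I A)"
      using f cl(3) by (auto simp: PiE_iff simp del: restrict_apply) (simp add: cl)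
    moreover have "?g \<oplus>\<^bsub>direct_sum I A\<^esub> f = \<zero>\<^bsub>direct_sum I A\<^esub>"
      using f abelian_group.l_neg[OF ag] by (auto simp: PiE_iff intro!: restrict_ext)
    ultimately show "\<exists>g\<in>carrier (direct_sum I A). g \<oplus>\<^bsub>direct_sum I A\<^esub> f = \<zero>\<^bsub>direct_sum I A\<^esub>"
      by blast
  qed
  moreover have "a \<odot>\<^bsub>direct_sum I A\<^esub> f \<in> carrier (direct_sum I A)"
    if a: "a \<in> carrier K" and f: "f \<in> carrier (direct_sum I A)" for a f
  proof -
    let ?g = "\<lambda>i\<in>I. a \<odot>\<^bsub>A i\<^esub> f i"
    have "{i\<in>I. ?g i \<noteq> \<zero>\<^bsub>A i\<^esub>} \<subseteq> {i\<in>I. f i \<noteq> \<zero>\<^bsub>A i\<^esub>}"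
      using left_module_smult_zero[OF A a] by auto
    then have "finite {i\<in>I. ?g i \<noteq> \<zero>\<^bsub>A i\<^esub>}"
      by (rule finite_subset) (use f in simp)
    then show ?thesis
      using f a cl(4) by (auto simp: PiE_iff simp del: restrict_apply) (simp add: cl)
  qed
  ultimately show ?thesis
    using K by (auto simp: left_module_def left_module_axioms_def PiE_iff
        intro!: restrict_ext left_module.smult_l_distr[OF A] left_module.smult_r_distr[OF A]
          left_module.smult_assoc1[OF A] extensionalityI[where A=I] left_module.smult_one[OF A])
qed

context
  fixes K :: "('k, 'p) ring_scheme" and I :: "'i set" and A :: "'i \<Rightarrow> ('k, 'm) module"
  assumes K: "ring K" and A: "\<And>i. i \<in> I \<Longrightarrow> left_module K (A i)"
begin

lemma ds_incl_linear:
  assumes i: "i \<in> I"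
  shows "(\<lambda>x\<in>carrier (A i). ds_incl I A i x) \<in> linear_maps K (A i) (direct_sum I A)"
proof (rule linear_mapsI)
  have ag: "abelian_group (A i)" if "i \<in> I" for i
    using A[OF that] by (simp add: left_module_def)
  note ag' = ag[THEN abelian_group.axioms(1)]
  note cl = abelian_monoid.a_closed[OF ag'] abelian_monoid.zero_closed[OF ag']
    left_module.smult_closed[OF A]
  fix x assume x: "x \<in> carrier (A i)"
  have "finite {j\<in>I. ds_incl I A i x j \<noteq> \<zero>\<^bsub>A j\<^esub>}"
    by (rule finite_subset[of _ "{i}"]) (auto simp: ds_incl_def)
  then have "ds_incl I A i x \<in> carrier (direct_sum I A)"
    using x cl(2) by (auto simp: ds_incl_def)
  then show "(\<lambda>x\<in>carrier (A i). ds_incl I A i x) x \<in> carrier (direct_sum I A)"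
    using x by simp
  show "(\<lambda>x\<in>carrier (A i). ds_incl I A i x) (a \<odot>\<^bsub>A i\<^esub> x) =
      a \<odot>\<^bsub>direct_sum I A\<^esub> (\<lambda>x\<in>carrier (A i). ds_incl I A i x) x" if "a \<in> carrier K" for a
    using x that left_module_smult_zero[OF A] i cl
    by (auto simp: ds_incl_def intro!: restrict_ext)
  fix y assume y: "y \<in> carrier (A i)"
  show "(\<lambda>x\<in>carrier (A i). ds_incl I A i x) (x \<oplus>\<^bsub>A i\<^esub> y) =
      (\<lambda>x\<in>carrier (A i). ds_incl I A i x) x \<oplus>\<^bsub>direct_sum I A\<^esub> (\<lambda>x\<in>carrier (A i). ds_incl I A i x) y"
    using x y i cl abelian_monoid.l_zero[OF ag' cl(2)]
    by (auto simp: ds_incl_def intro!: restrict_ext)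
qed (simp)

lemma ds_incl_closed:
  assumes i: "i \<in> I"
    and "x \<in> carrier (A i)"
  shows "ds_incl I A i x \<in> carrier (direct_sum I A)"
  using linear_mapsD(1)[OF ds_incl_linear[OF assms(1)] assms(2)] assms(2)
  by (simp only: restrict_apply' if_True)

lemma ds_lift_eq:
  assumes F: "left_module K F"
    and g: "\<And>i. i \<in> I \<Longrightarrow> g i \<in> linear_maps K (A i) F"
    and f: "f \<in> carrier (direct_sum I A)"
    and S: "finite S" "{i\<in>I. f i \<noteq> \<zero>\<^bsub>A i\<^esub>} \<subseteq> S" "S \<subseteq> I"
  shows "ds_lift I A F g f = (\<Oplus>\<^bsub>F\<^esub>i\<in>S. g i (f i))"
proof -
  interpret F: left_module K F by fact
  show ?thesis unfolding ds_lift_def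
    by (rule F.M.add.finprod_mono_neutral_cong_left)
      (use S f linear_maps_zero[OF g A F] linear_mapsD(1)[OF g] in \<open>auto simp: PiE_iff\<close>)
qed

lemma ds_lift_linear:
  assumes F: "left_module K F"
    and g: "\<And>i. i \<in> I \<Longrightarrow> g i \<in> linear_maps K (A i) F"
  shows "(\<lambda>f\<in>carrier (direct_sum I A). ds_lift I A F g f) \<in> linear_maps K (direct_sum I A) F"
proof (rule linear_mapsI)
  interpret F: left_module K F by fact
  interpret D: left_module K "direct_sum I A" by (rule direct_sum_left_module[OF K A])
  note eq = ds_lift_eq[OF F g]
  let ?s = "\<lambda>f. {i\<in>I. f i \<noteq> \<zero>\<^bsub>A i\<^esub>}"
  fix f assume f: "f \<in> carrier (direct_sum I A)"
  note gf = linear_mapsD(1)[OF g]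
  have fA: "f i \<in> carrier (A i)" if "i \<in> I" for i using f that by auto
  have ff: "finite (?s f)" using f by auto
  show "(\<lambda>f\<in>carrier (direct_sum I A). ds_lift I A F g f) f \<in> carrier F"
    using f by (auto simp del: direct_sum_simps simp: ds_lift_def intro!: F.M.finsum_closed gf fA)
  { fix h assume h: "h \<in> carrier (direct_sum I A)"
    have hA: "h i \<in> carrier (A i)" if "i \<in> I" for i using h that by auto
    have fh: "finite (?s h)" using h by auto
    have c: "f \<oplus>\<^bsub>direct_sum I A\<^esub> h \<in> carrier (direct_sum I A)" using f h by blast
    have fc: "finite (?s (f \<oplus>\<^bsub>direct_sum I A\<^esub> h))" using c by (simp only: direct_sum_simps) blast
    let ?S = "?s f \<union> ?s h \<union> ?s (f \<oplus>\<^bsub>direct_sum I A\<^esub> h)"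
    have S: "finite ?S" "?S \<subseteq> I" using ff fh fc by auto
    have "ds_lift I A F g (f \<oplus>\<^bsub>direct_sum I A\<^esub> h) = (\<Oplus>\<^bsub>F\<^esub>i\<in>?S. g i ((f \<oplus>\<^bsub>direct_sum I A\<^esub> h) i))"
      by (rule eq) (use c S in blast)+
    also have "\<dots> = (\<Oplus>\<^bsub>F\<^esub>i\<in>?S. g i (f i) \<oplus>\<^bsub>F\<^esub> g i (h i))"
      by (rule F.M.finsum_cong')
        (use S gf fA hA linear_mapsD(2)[OF g] in \<open>auto simp: Pi_iff\<close>)
    also have "\<dots> = (\<Oplus>\<^bsub>F\<^esub>i\<in>?S. g i (f i)) \<oplus>\<^bsub>F\<^esub> (\<Oplus>\<^bsub>F\<^esub>i\<in>?S. g i (h i))"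
      by (rule F.M.finsum_addf) (use gf fA hA S in auto)
    also have "(\<Oplus>\<^bsub>F\<^esub>i\<in>?S. g i (f i)) = ds_lift I A F g f"
      by (rule eq[symmetric]) (use f S in blast)+
    also have "(\<Oplus>\<^bsub>F\<^esub>i\<in>?S. g i (h i)) = ds_lift I A F g h"
      by (rule eq[symmetric]) (use h S in blast)+
    finally show "(\<lambda>f\<in>carrier (direct_sum I A). ds_lift I A F g f) (f \<oplus>\<^bsub>direct_sum I A\<^esub> h) =
        (\<lambda>f\<in>carrier (direct_sum I A). ds_lift I A F g f) f \<oplus>\<^bsub>F\<^esub>
        (\<lambda>f\<in>carrier (direct_sum I A). ds_lift I A F g f) h"
      using f h c by (simp del: direct_sum_simps) }
  { fix a assume a: "a \<in> carrier K"
    have c: "a \<odot>\<^bsub>direct_sum I A\<^esub> f \<in> carrier (direct_sum I A)" using f a by blast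
    have fc: "finite (?s (a \<odot>\<^bsub>direct_sum I A\<^esub> f))" using c by (simp only: direct_sum_simps) blast
    let ?S = "?s f \<union> ?s (a \<odot>\<^bsub>direct_sum I A\<^esub> f)"
    have S: "finite ?S" "?S \<subseteq> I" using ff fc by auto
    have "ds_lift I A F g (a \<odot>\<^bsub>direct_sum I A\<^esub> f) = (\<Oplus>\<^bsub>F\<^esub>i\<in>?S. g i ((a \<odot>\<^bsub>direct_sum I A\<^esub> f) i))"
      by (rule eq) (use c S in blast)+
    also have "\<dots> = (\<Oplus>\<^bsub>F\<^esub>i\<in>?S. a \<odot>\<^bsub>F\<^esub> g i (f i))"
      by (rule F.M.finsum_cong')
        (use S gf fA a linear_mapsD(3)[OF g] in \<open>auto simp: Pi_iff\<close>)
    also have "\<dots> = a \<odot>\<^bsub>F\<^esub> (\<Oplus>\<^bsub>F\<^esub>i\<in>?S. g i (f i))"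
    proof -
      have "(\<Oplus>\<^bsub>F\<^esub>i\<in>T. a \<odot>\<^bsub>F\<^esub> u i) = a \<odot>\<^bsub>F\<^esub> (\<Oplus>\<^bsub>F\<^esub>i\<in>T. u i)" if "finite T" "u \<in> T \<rightarrow> carrier F" for T u
        using that
      proof (induction T)
        case empty then show ?case using a left_module_smult_zero[OF F a] by simp
      next
        case (insert t T) 
        then show ?case using a by (simp add: Pi_iff F.smult_r_distr)
      qed
      then show ?thesis by this (use S gf fA in auto)
    qed
    also have "(\<Oplus>\<^bsub>F\<^esub>i\<in>?S. g i (f i)) = ds_lift I A F g f"
      by (rule eq[symmetric]) (use f S in blast)+
    finally show "(\<lambda>f\<in>carrier (direct_sum I A). ds_lift I A F g f) (a \<odot>\<^bsub>direct_sum I A\<^esub> f) =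
        a \<odot>\<^bsub>F\<^esub> (\<lambda>f\<in>carrier (direct_sum I A). ds_lift I A F g f) f"
      using f c by (simp del: direct_sum_simps) }
qed (simp)

lemma ds_lift_incl:
  assumes F: "left_module K F"
    and g: "\<And>i. i \<in> I \<Longrightarrow> g i \<in> linear_maps K (A i) F"
    and i: "i \<in> I" and x: "x \<in> carrier (A i)"
  shows "ds_lift I A F g (ds_incl I A i x) = g i x"
proof -
  interpret F: left_module K F by fact
  have "ds_lift I A F g (ds_incl I A i x) = (\<Oplus>\<^bsub>F\<^esub>j\<in>{i}. g j (ds_incl I A i x j))"
    by (rule ds_lift_eq[OF F g ds_incl_closed[OF i x]]) (auto simp: ds_incl_def i)
  then show ?thesis using i x linear_mapsD(1)[OF g] by (simp add: ds_incl_def)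
qed

lemma direct_sum_linear_eq:
  assumes h: "h \<in> linear_maps K (direct_sum I A) F" and h': "h' \<in> linear_maps K (direct_sum I A) F"
    and F: "left_module K F"
    and eq: "\<And>i x. i \<in> I \<Longrightarrow> x \<in> carrier (A i) \<Longrightarrow> h (ds_incl I A i x) = h' (ds_incl I A i x)"
    and f: "f \<in> carrier (direct_sum I A)"
  shows "h f = h' f"
proof -
  have D: "left_module K (direct_sum I A)" by (rule direct_sum_left_module[OF K A])
  have "\<forall>f\<in>carrier (direct_sum I A). {i\<in>I. f i \<noteq> \<zero>\<^bsub>A i\<^esub>} \<subseteq> S \<longrightarrow> h f = h' f" if "finite S" for S
    using that
  proof (induction S)
    case empty
    show ?case
    proof (intro ballI impI)
      fix f assume f: "f \<in> carrier (direct_sum I A)" "{i\<in>I. f i \<noteq> \<zero>\<^bsub>A i\<^esub>} \<subseteq> {}"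
      then have "f = \<zero>\<^bsub>direct_sum I A\<^esub>" by (auto simp: PiE_iff intro!: extensionalityI[where A=I])
      then show "h f = h' f" using linear_maps_zero[OF h D F] linear_maps_zero[OF h' D F] by simp
    qed
  next
    case (insert i S)
    show ?case
    proof (intro ballI impI)
      fix f assume f: "f \<in> carrier (direct_sum I A)" "{i\<in>I. f i \<noteq> \<zero>\<^bsub>A i\<^esub>} \<subseteq> insert i S"
      show "h f = h' f"
      proof (cases "i \<in> I")
        case False
        then show ?thesis using insert.IH f by blast
      next
        case True
        interpret Ai: left_module K "A i" by (rule A[OF True])
        let ?f' = "f(i := \<zero>\<^bsub>A i\<^esub>)"
        have "finite {j\<in>I. ?f' j \<noteq> \<zero>\<^bsub>A j\<^esub>}"
          by (rule finite_subset[of _ "{i\<in>I. f i \<noteq> \<zero>\<^bsub>A i\<^esub>}"]) (use f in auto)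
        then have f': "?f' \<in> carrier (direct_sum I A)" "{j\<in>I. ?f' j \<noteq> \<zero>\<^bsub>A j\<^esub>} \<subseteq> S"
          using f True by (auto simp: PiE_iff extensional_def)
        have fi: "f i \<in> carrier (A i)" using f True by auto
        note c = ds_incl_closed[OF True fi]
        have z: "x \<oplus>\<^bsub>A j\<^esub> \<zero>\<^bsub>A j\<^esub> = x" "\<zero>\<^bsub>A j\<^esub> \<oplus>\<^bsub>A j\<^esub> x = x" if "j \<in> I" "x \<in> carrier (A j)" for j x
        proof -
          interpret Aj: left_module K "A j" by (rule A[OF that(1)])
          show "x \<oplus>\<^bsub>A j\<^esub> \<zero>\<^bsub>A j\<^esub> = x" "\<zero>\<^bsub>A j\<^esub> \<oplus>\<^bsub>A j\<^esub> x = x" using that by simp_all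
        qed
        have "f = ds_incl I A i (f i) \<oplus>\<^bsub>direct_sum I A\<^esub> ?f'"
          by (rule extensionalityI[where A=I])
            (use f in \<open>auto simp: ds_incl_def PiE_iff z\<close>)
        then show ?thesis
          using linear_mapsD(2)[OF h c f'(1)] linear_mapsD(2)[OF h' c f'(1)] eq[OF True fi]
            insert.IH f' by simp
      qed
    qed
  qed
  then show ?thesis using f by auto
qed

end

subsection \<open>Quotients\<close>

lemma submodule_generated_submodule:
  assumes E: "left_module K E" and S: "S \<subseteq> carrier E"
  shows "submodule (submodule_generated K E S) K E" "S \<subseteq> submodule_generated K E S"
proof -
  interpret E: left_module K E by fact
  have car: "submodule (carrier E) K E"
    by (auto intro!: submodule.intro submodule_axioms.intro E.M.add.subgroup_self)
  show "submodule (submodule_generated K E S) K E"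
    unfolding submodule_generated_def
  proof (intro submodule.intro submodule_axioms.intro)
    show "subgroup (\<Inter> {H. submodule H K E \<and> S \<subseteq> H}) (add_monoid E)"
      by (rule E.M.add.subgroups_Inter) (use car S in \<open>auto simp: submodule_def\<close>)
  qed (auto intro: submodule.smult_closed)
  show "S \<subseteq> submodule_generated K E S" by (auto simp: submodule_generated_def)
qed

lemma quotient_module_simps:
  "carrier (quotient_module E N) = a_rcosets\<^bsub>E\<^esub> N"
  "S \<oplus>\<^bsub>quotient_module E N\<^esub> T = S <+>\<^bsub>E\<^esub> T"
  "\<zero>\<^bsub>quotient_module E N\<^esub> = N"
  "a \<odot>\<^bsub>quotient_module E N\<^esub> S = (\<Union>x\<in>S. N +>\<^bsub>E\<^esub> (a \<odot>\<^bsub>E\<^esub> x))"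
  by (simp_all add: quotient_module_def)

context
  fixes K :: "('k, 'p) ring_scheme" and E :: "('k, 'm) module" and N :: "'m set"
  assumes E: "left_module K E" and N: "submodule N K E"
begin

lemma N_abelian_subgroup: "abelian_subgroup N E"
proof -
  interpret E: left_module K E by (rule E)
  have "subgroup N (add_monoid E)" using N by (simp add: submodule_def)
  then show ?thesis
    by (intro abelian_subgroupI3 additive_subgroup.intro E.M.abelian_group_axioms)
qed

lemma quotient_carrier: "carrier (quotient_module E N) = (\<lambda>x. N +>\<^bsub>E\<^esub> x) ` carrier E"
  by (auto simp: quotient_module_simps A_RCOSETS_def RCOSETS_def a_r_coset_def)

lemma quotient_smult:
  assumes "a \<in> carrier K" "x \<in> carrier E"
  shows "a \<odot>\<^bsub>quotient_module E N\<^esub> (N +>\<^bsub>E\<^esub> x) = N +>\<^bsub>E\<^esub> (a \<odot>\<^bsub>E\<^esub> x)"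
proof -
  interpret E: left_module K E by (rule E)
  interpret S: abelian_subgroup N E by (rule N_abelian_subgroup)
  have ax: "a \<odot>\<^bsub>E\<^esub> x \<in> carrier E" using assms by (rule E.smult_closed)
  have "N +>\<^bsub>E\<^esub> (a \<odot>\<^bsub>E\<^esub> y) = N +>\<^bsub>E\<^esub> (a \<odot>\<^bsub>E\<^esub> x)" if y: "y \<in> N +>\<^bsub>E\<^esub> x" for y
  proof -
    obtain n where n: "n \<in> N" "y = n \<oplus>\<^bsub>E\<^esub> x"
      using y by (auto simp: a_r_coset_def r_coset_def)
    have "a \<odot>\<^bsub>E\<^esub> y = a \<odot>\<^bsub>E\<^esub> n \<oplus>\<^bsub>E\<^esub> a \<odot>\<^bsub>E\<^esub> x"
      unfolding n(2) by (rule E.smult_r_distr[OF assms(1) S.a_Hcarr[OF n(1)] assms(2)])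
    moreover have "a \<odot>\<^bsub>E\<^esub> n \<in> N" by (rule submodule.smult_closed[OF N assms(1) n(1)])
    ultimately have "a \<odot>\<^bsub>E\<^esub> y \<in> N +>\<^bsub>E\<^esub> (a \<odot>\<^bsub>E\<^esub> x)"
      unfolding a_r_coset_def r_coset_def by auto
    then show ?thesis using S.a_repr_independence' ax by blast
  qed
  moreover have "x \<in> N +>\<^bsub>E\<^esub> x" using assms(2) by (rule S.a_rcos_self)
  ultimately show ?thesis unfolding quotient_module_simps by blast
qed

lemma quotient_add:
  assumes "x \<in> carrier E" "y \<in> carrier E"
  shows "(N +>\<^bsub>E\<^esub> x) \<oplus>\<^bsub>quotient_module E N\<^esub> (N +>\<^bsub>E\<^esub> y) = N +>\<^bsub>E\<^esub> (x \<oplus>\<^bsub>E\<^esub> y)"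
  using assms abelian_subgroup.a_rcos_sum[OF N_abelian_subgroup] by (simp add: quotient_module_simps)

lemma quotient_left_module: "left_module K (quotient_module E N)"
proof -
  interpret E: left_module K E by (rule E)
  interpret S: abelian_subgroup N E by (rule N_abelian_subgroup)
  have z: "\<zero>\<^bsub>quotient_module E N\<^esub> = N +>\<^bsub>E\<^esub> \<zero>\<^bsub>E\<^esub>"
    using S.a_subset by (simp add: quotient_module_simps E.M.a_coset_add_zero)
  have "abelian_group (quotient_module E N)"
  proof (rule abelian_groupI)
    fix S assume "S \<in> carrier (quotient_module E N)"
    then obtain x where x: "x \<in> carrier E" "S = N +>\<^bsub>E\<^esub> x" by (auto simp: quotient_carrier)
    then show "\<exists>T\<in>carrier (quotient_module E N). T \<oplus>\<^bsub>quotient_module E N\<^esub> S = \<zero>\<^bsub>quotient_module E N\<^esub>"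
      by (intro bexI[of _ "N +>\<^bsub>E\<^esub> (\<ominus>\<^bsub>E\<^esub> x)"]) (auto simp: z quotient_carrier quotient_add E.M.l_neg)
  qed (auto simp: z quotient_carrier quotient_add E.M.a_ac)
  then show ?thesis
    by (auto simp: left_module_def left_module_axioms_def quotient_carrier quotient_smult quotient_add
        E.R.ring_axioms E.smult_l_distr E.smult_r_distr E.smult_assoc1)
qed

lemma quotient_proj_linear:
  "(\<lambda>x\<in>carrier E. N +>\<^bsub>E\<^esub> x) \<in> linear_maps K E (quotient_module E N)"
proof -
  interpret E: left_module K E by (rule E)
  show ?thesis
    by (rule linear_mapsI) (auto simp: quotient_carrier quotient_smult quotient_add)
qed

lemma quotient_desc:
  assumes h: "h \<in> linear_maps K E F" and F: "left_module K F"
    and z: "\<And>n. n \<in> N \<Longrightarrow> h n = \<zero>\<^bsub>F\<^esub>" and x: "x \<in> carrier E"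
  shows "h ` (N +>\<^bsub>E\<^esub> x) = {h x}"
proof -
  interpret F: left_module K F by fact
  interpret S: abelian_subgroup N E by (rule N_abelian_subgroup)
  have "h y = h x" if y: "y \<in> N +>\<^bsub>E\<^esub> x" for y
  proof -
    obtain n where n: "n \<in> N" "y = n \<oplus>\<^bsub>E\<^esub> x"
      using y by (auto simp: a_r_coset_def r_coset_def)
    have "h y = h n \<oplus>\<^bsub>F\<^esub> h x"
      unfolding n(2) by (rule linear_mapsD(2)[OF h S.a_Hcarr[OF n(1)] x])
    then show ?thesis by (simp only: z[OF n(1)] F.M.l_zero[OF linear_mapsD(1)[OF h x]])
  qed
  then show ?thesis using S.a_rcos_self[OF x] by blast
qed

end

lemma submodule_generated_kernel:
  assumes E: "left_module K E" and F: "left_module K F" and h: "h \<in> linear_maps K E F"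
    and S: "S \<subseteq> carrier E" and z: "\<And>x. x \<in> S \<Longrightarrow> h x = \<zero>\<^bsub>F\<^esub>"
    and n: "n \<in> submodule_generated K E S"
  shows "h n = \<zero>\<^bsub>F\<^esub>"
proof -
  interpret E: left_module K E by fact
  interpret F: left_module K F by fact
  let ?k = "{x\<in>carrier E. h x = \<zero>\<^bsub>F\<^esub>}"
  have "h (\<ominus>\<^bsub>E\<^esub> x) = \<zero>\<^bsub>F\<^esub>" if "x \<in> carrier E" "h x = \<zero>\<^bsub>F\<^esub>" for x
    using linear_maps_minus[OF h E F E.M.zero_closed that(1)] that linear_maps_zero[OF h E F]
    by (simp add: a_minus_def)
  then have "subgroup ?k (add_monoid E)"
    using linear_maps_zero[OF h E F]
    by (intro E.M.add.subgroupI) (auto simp: linear_mapsD(2)[OF h] simp flip: a_inv_def)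
  then have "submodule ?k K E"
    using left_module_smult_zero[OF F]
    by (auto intro!: submodule.intro submodule_axioms.intro simp: linear_mapsD(3)[OF h])
  then show ?thesis using n S z by (auto simp: submodule_generated_def)
qed

section \<open>The universal property of the left Kan extension\<close>

lemma categoryD:
  assumes "category C"
  shows "U \<in> Obj C \<Longrightarrow> Idn C U \<in> Hom C U U"
    and "\<lbrakk>f \<in> Hom C U V; g \<in> Hom C V W; U \<in> Obj C; V \<in> Obj C; W \<in> Obj C\<rbrakk> \<Longrightarrow>
      Cmp C U V W g f \<in> Hom C U W"
    and "\<lbrakk>f \<in> Hom C U V; U \<in> Obj C; V \<in> Obj C\<rbrakk> \<Longrightarrow> Cmp C U V V (Idn C V) f = f"
    and "\<lbrakk>f \<in> Hom C U V; U \<in> Obj C; V \<in> Obj C\<rbrakk> \<Longrightarrow> Cmp C U U V f (Idn C U) = f"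
    and "\<lbrakk>f \<in> Hom C U V; g \<in> Hom C V W; h \<in> Hom C W Z;
       U \<in> Obj C; V \<in> Obj C; W \<in> Obj C; Z \<in> Obj C\<rbrakk> \<Longrightarrow>
      Cmp C U V Z (Cmp C V W Z h g) f = Cmp C U W Z h (Cmp C U V W g f)"
  using assms unfolding category_def by blast+

lemma is_functorD:
  assumes "is_functor D C p"
  shows "U \<in> Obj D \<Longrightarrow> fob p U \<in> Obj C"
    and "\<lbrakk>f \<in> Hom D U V; U \<in> Obj D; V \<in> Obj D\<rbrakk> \<Longrightarrow> far p U V f \<in> Hom C (fob p U) (fob p V)"
    and "U \<in> Obj D \<Longrightarrow> far p U U (Idn D U) = Idn C (fob p U)"
    and "\<lbrakk>f \<in> Hom D U V; g \<in> Hom D V W; U \<in> Obj D; V \<in> Obj D; W \<in> Obj D\<rbrakk> \<Longrightarrow>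
      far p U W (Cmp D U V W g f) =
        Cmp C (fob p U) (fob p V) (fob p W) (far p V W g) (far p U V f)"
  using assms unfolding is_functor_def by blast+

lemma cat_moduleD:
  assumes "cat_module C K M"
  shows "U \<in> Obj C \<Longrightarrow> left_module K (fob M U)"
    and "\<lbrakk>f \<in> Hom C U V; U \<in> Obj C; V \<in> Obj C\<rbrakk> \<Longrightarrow>
      far M U V f \<in> linear_maps K (fob M U) (fob M V)"
    and "U \<in> Obj C \<Longrightarrow> far M U U (Idn C U) = (\<lambda>x\<in>carrier (fob M U). x)"
    and "\<lbrakk>f \<in> Hom C U V; g \<in> Hom C V W; U \<in> Obj C; V \<in> Obj C; W \<in> Obj C\<rbrakk> \<Longrightarrow>
      far M U W (Cmp C U V W g f) = compose (carrier (fob M U)) (far M V W g) (far M U V f)"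
  using assms unfolding cat_module_def by blast+

lemma nat_transD:
  assumes "nat_trans C K F G \<tau>"
  shows "U \<in> Obj C \<Longrightarrow> \<tau> U \<in> linear_maps K (fob F U) (fob G U)"
    and "\<lbrakk>f \<in> Hom C U V; U \<in> Obj C; V \<in> Obj C; x \<in> carrier (fob F U)\<rbrakk> \<Longrightarrow>
      \<tau> V (far F U V f x) = far G U V f (\<tau> U x)"
proof -
  show "U \<in> Obj C \<Longrightarrow> \<tau> U \<in> linear_maps K (fob F U) (fob G U)"
    using assms unfolding nat_trans_def by blast
  assume *: "f \<in> Hom C U V" "U \<in> Obj C" "V \<in> Obj C" "x \<in> carrier (fob F U)"
  have "compose (carrier (fob F U)) (\<tau> V) (far F U V f) =
      compose (carrier (fob F U)) (far G U V f) (\<tau> U)"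
    using assms * unfolding nat_trans_def by blast
  from fun_cong[OF this, of x] show "\<tau> V (far F U V f x) = far G U V f (\<tau> U x)"
    by (simp only: compose_eq[OF *(4)])
qed

lemma pullback_simps [simp]:
  "fob (pullback p M) U = fob M (fob p U)"
  "far (pullback p M) U V f = far M (fob p U) (fob p V) (far p U V f)"
  by (simp_all add: pullback_def)

lemma pullback_cat_module:
  assumes p: "is_functor D C p" and M: "cat_module C K M"
  shows "cat_module D K (pullback p M)"
  unfolding cat_module_def pullback_simps
  by (auto simp: is_functorD[OF p] cat_moduleD(1,3)[OF M]
      intro!: cat_moduleD(2,4)[OF M] is_functorD[OF p])

context
  fixes D :: "('o, 'a) cat" and C :: "('c, 'b) cat" and p :: "('o, 'a, 'c, 'b) funct"
    and K :: "('k, 'q) ring_scheme" and P :: "('o, 'a, 'k, 'm) catmod"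
  assumes D: "category D" and C: "category C" and p: "is_functor D C p" and K: "ring K"
    and P: "cat_module D K P"
begin

lemma comma_iff: "(U, \<phi>) \<in> comma D C p V \<longleftrightarrow> U \<in> Obj D \<and> \<phi> \<in> Hom C (fob p U) V"
  by (simp add: comma_def)

lemma comma_A: "i \<in> comma D C p V \<Longrightarrow> left_module K (fob P (fst i))"
  by (cases i) (simp add: comma_iff cat_moduleD[OF P])

lemma lan_sum_left_module: "left_module K (lan_sum D C p P V)"
  unfolding lan_sum_def by (rule direct_sum_left_module) (use K comma_A in auto)

lemma lan_gen_linear:
  assumes "i \<in> comma D C p V"
  shows "(\<lambda>x\<in>carrier (fob P (fst i)). lan_gen D C p P V i x) \<in>
    linear_maps K (fob P (fst i)) (lan_sum D C p P V)"
  unfolding lan_sum_def lan_gen_def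
  using ds_incl_linear[where A="\<lambda>i. fob P (fst i)", OF K comma_A assms] by simp

lemma lan_gen_closed:
  assumes "i \<in> comma D C p V" "x \<in> carrier (fob P (fst i))"
  shows "lan_gen D C p P V i x \<in> carrier (lan_sum D C p P V)"
  using linear_mapsD(1)[OF lan_gen_linear[OF assms(1)] assms(2)] assms(2) by simp

lemma comma_precompose:
  assumes "U \<in> Obj D" "U' \<in> Obj D" "u \<in> Hom D U U'" "\<psi> \<in> Hom C (fob p U') V" "V \<in> Obj C"
  shows "Cmp C (fob p U) (fob p U') V \<psi> (far p U U' u) \<in> Hom C (fob p U) V"
  by (rule categoryD(2)[OF C]) (use assms is_functorD[OF p] in auto)

lemma lan_relations_subset:
  assumes V: "V \<in> Obj C"
  shows "lan_relations D C p P V \<subseteq> carrier (lan_sum D C p P V)"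
proof -
  interpret S: left_module K "lan_sum D C p P V" by (rule lan_sum_left_module)
  show ?thesis unfolding lan_relations_def
    using V by (auto intro!: S.M.minus_closed lan_gen_closed
        simp: comma_iff comma_precompose linear_mapsD(1)[OF cat_moduleD(2)[OF P]])
qed

lemma lan_submodule:
  assumes V: "V \<in> Obj C"
  shows "submodule (submodule_generated K (lan_sum D C p P V) (lan_relations D C p P V))
      K (lan_sum D C p P V)"
    and "lan_relations D C p P V \<subseteq>
      submodule_generated K (lan_sum D C p P V) (lan_relations D C p P V)"
  using submodule_generated_submodule[OF lan_sum_left_module lan_relations_subset[OF V]] by auto

lemma lan_ob_left_module: "V \<in> Obj C \<Longrightarrow> left_module K (lan_ob K D C p P V)"
  unfolding lan_ob_def by (rule quotient_left_module[OF lan_sum_left_module lan_submodule(1)])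

lemma lan_class_linear:
  assumes V: "V \<in> Obj C" and i: "i \<in> comma D C p V"
  shows "lan_class K D C p P V i \<in> linear_maps K (fob P (fst i)) (lan_ob K D C p P V)"
proof -
  have "lan_class K D C p P V i = compose (carrier (fob P (fst i)))
      (\<lambda>x\<in>carrier (lan_sum D C p P V).
        submodule_generated K (lan_sum D C p P V) (lan_relations D C p P V)
          +>\<^bsub>lan_sum D C p P V\<^esub> x)
      (\<lambda>x\<in>carrier (fob P (fst i)). lan_gen D C p P V i x)"
    unfolding lan_class_def compose_def
    by (intro restrict_ext) (simp add: lan_gen_closed[OF i])
  also have "\<dots> \<in> linear_maps K (fob P (fst i)) (lan_ob K D C p P V)"
    unfolding lan_ob_def
    by (intro linear_maps_compose[OF lan_gen_linear] quotient_proj_linear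
        lan_sum_left_module lan_submodule V i comma_A[OF i])
  finally show ?thesis .
qed

lemma lan_class_rel:
  assumes V: "V \<in> Obj C"
    and u: "U \<in> Obj D" "U' \<in> Obj D" "u \<in> Hom D U U'" "\<psi> \<in> Hom C (fob p U') V"
    and x: "x \<in> carrier (fob P U)"
  shows "lan_class K D C p P V (U, Cmp C (fob p U) (fob p U') V \<psi> (far p U U' u)) x =
    lan_class K D C p P V (U', \<psi>) (far P U U' u x)"
proof -
  let ?S = "lan_sum D C p P V"
  let ?N = "submodule_generated K ?S (lan_relations D C p P V)"
  interpret S: left_module K ?S by (rule lan_sum_left_module)
  interpret N: abelian_subgroup ?N ?S
    by (rule N_abelian_subgroup[OF lan_sum_left_module lan_submodule(1)[OF V]])
  let ?y = "lan_gen D C p P V (U, Cmp C (fob p U) (fob p U') V \<psi> (far p U U' u)) x"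
  let ?z = "lan_gen D C p P V (U', \<psi>) (far P U U' u x)"
  have fx: "far P U U' u x \<in> carrier (fob P U')"
    using linear_mapsD(1)[OF cat_moduleD(2)[OF P]] u x by blast
  have y: "?y \<in> carrier ?S" and z: "?z \<in> carrier ?S"
    using V u x fx by (auto intro!: lan_gen_closed simp: comma_iff comma_precompose)
  have "?y \<ominus>\<^bsub>?S\<^esub> ?z \<in> lan_relations D C p P V"
    unfolding lan_relations_def using u x by blast
  then have "?y \<ominus>\<^bsub>?S\<^esub> ?z \<in> ?N" using lan_submodule(2)[OF V] by blast
  moreover have "?y = (?y \<ominus>\<^bsub>?S\<^esub> ?z) \<oplus>\<^bsub>?S\<^esub> ?z"
    using y z by (simp add: a_minus_def S.M.a_assoc S.M.l_neg)
  ultimately have "?y \<in> ?N +>\<^bsub>?S\<^esub> ?z"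
    unfolding a_r_coset_def r_coset_def by force
  then have "?N +>\<^bsub>?S\<^esub> ?y = ?N +>\<^bsub>?S\<^esub> ?z" using N.a_repr_independence' z by blast
  then show ?thesis using x fx by (simp add: lan_class_def)
qed

definition cocone :: "'c \<Rightarrow> ('k, 'n) module \<Rightarrow> ('o \<times> 'b \<Rightarrow> 'm \<Rightarrow> 'n) \<Rightarrow> bool"
  where "cocone V F g \<longleftrightarrow> V \<in> Obj C \<and> left_module K F \<and>
    (\<forall>i\<in>comma D C p V. g i \<in> linear_maps K (fob P (fst i)) F) \<and>
    (\<forall>U U' u \<psi> x. U \<in> Obj D \<and> U' \<in> Obj D \<and> u \<in> Hom D U U' \<and> \<psi> \<in> Hom C (fob p U') V \<and>
      x \<in> carrier (fob P U) \<longrightarrow>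
      g (U, Cmp C (fob p U) (fob p U') V \<psi> (far p U U' u)) x = g (U', \<psi>) (far P U U' u x))"

lemma lan_desc:
  assumes "cocone V F g"
  shows "lan_desc K D C p P V F g \<in> linear_maps K (lan_ob K D C p P V) F"
    and "\<lbrakk>i \<in> comma D C p V; x \<in> carrier (fob P (fst i))\<rbrakk> \<Longrightarrow>
      lan_desc K D C p P V F g (lan_class K D C p P V i x) = g i x"
proof -
  let ?S = "lan_sum D C p P V"
  let ?A = "\<lambda>i. fob P (fst i)"
  let ?N = "submodule_generated K ?S (lan_relations D C p P V)"
  let ?l = "ds_lift (comma D C p V) ?A F g"
  let ?h = "\<lambda>f\<in>carrier ?S. ?l f"
  have V: "V \<in> Obj C" and F: "left_module K F"
    and g: "\<And>i. i \<in> comma D C p V \<Longrightarrow> g i \<in> linear_maps K (?A i) F"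
    and geq: "\<And>U U' u \<psi> x. \<lbrakk>U \<in> Obj D; U' \<in> Obj D; u \<in> Hom D U U'; \<psi> \<in> Hom C (fob p U') V;
      x \<in> carrier (fob P U)\<rbrakk> \<Longrightarrow>
      g (U, Cmp C (fob p U) (fob p U') V \<psi> (far p U U' u)) x = g (U', \<psi>) (far P U U' u x)"
    using assms unfolding cocone_def by blast+
  interpret S: left_module K ?S by (rule lan_sum_left_module)
  interpret Q: left_module K "lan_ob K D C p P V" by (rule lan_ob_left_module[OF V])
  interpret F: left_module K F by (rule F)
  interpret N: abelian_subgroup ?N ?S
    by (rule N_abelian_subgroup[OF lan_sum_left_module lan_submodule(1)[OF V]])
  have h: "?h \<in> linear_maps K ?S F"
    unfolding lan_sum_def by (rule ds_lift_linear[where A="?A", OF K comma_A F g])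
  have hg: "?h (lan_gen D C p P V i x) = g i x" if i: "i \<in> comma D C p V" and x: "x \<in> carrier (?A i)" for i x
  proof -
    have "?h (lan_gen D C p P V i x) = ?l (lan_gen D C p P V i x)"
      using lan_gen_closed[OF i x] by (rule restrict_apply')
    also have "\<dots> = g i x"
      unfolding lan_gen_def by (rule ds_lift_incl[where A="?A" and g=g, OF K comma_A F g i x])
    finally show ?thesis .
  qed
  have rel: "?h r = \<zero>\<^bsub>F\<^esub>" if r0: "r \<in> lan_relations D C p P V" for r
  proof -
    obtain U U' u \<psi> x where u: "U \<in> Obj D" "U' \<in> Obj D" "u \<in> Hom D U U'" "\<psi> \<in> Hom C (fob p U') V"
        "x \<in> carrier (fob P U)"
      and r: "r = lan_gen D C p P V (U, Cmp C (fob p U) (fob p U') V \<psi> (far p U U' u)) x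
         \<ominus>\<^bsub>?S\<^esub> lan_gen D C p P V (U', \<psi>) (far P U U' u x)"
      using r0 unfolding lan_relations_def by blast
    have fx: "far P U U' u x \<in> carrier (fob P U')"
      using linear_mapsD(1)[OF cat_moduleD(2)[OF P]] u by blast
    have i: "(U, Cmp C (fob p U) (fob p U') V \<psi> (far p U U' u)) \<in> comma D C p V"
      "(U', \<psi>) \<in> comma D C p V"
      using u V by (auto simp: comma_iff comma_precompose)
    have "?h r = g (U, Cmp C (fob p U) (fob p U') V \<psi> (far p U U' u)) x \<ominus>\<^bsub>F\<^esub>
        g (U', \<psi>) (far P U U' u x)"
      unfolding r
      using i u fx by (subst linear_maps_minus[OF h S.left_module_axioms F])
        (auto simp: hg lan_gen_closed simp del: restrict_apply)
    also have "\<dots> = \<zero>\<^bsub>F\<^esub>"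
      using geq[OF u] linear_mapsD(1)[OF g[OF i(2)]] fx by (simp add: F.M.r_neg a_minus_def)
    finally show ?thesis .
  qed
  have hN: "?h n = \<zero>\<^bsub>F\<^esub>" if "n \<in> ?N" for n
    by (rule submodule_generated_kernel[OF S.left_module_axioms F h lan_relations_subset[OF V] rel that])
  have d: "lan_desc K D C p P V F g (?N +>\<^bsub>?S\<^esub> f) = ?h f" if f: "f \<in> carrier ?S" for f
  proof -
    have "?l ` (?N +>\<^bsub>?S\<^esub> f) = ?h ` (?N +>\<^bsub>?S\<^esub> f)"
      using S.M.a_r_coset_subset_G[OF N.a_subset f] by (intro image_cong) auto
    also have "\<dots> = {?h f}"
      by (rule quotient_desc[OF S.left_module_axioms lan_submodule(1)[OF V] h F hN f])
    finally show ?thesis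
      using f unfolding lan_desc_def lan_ob_def
        quotient_carrier[OF S.left_module_axioms lan_submodule(1)[OF V]] by simp
  qed
  have car: "carrier (lan_ob K D C p P V) = (\<lambda>x. ?N +>\<^bsub>?S\<^esub> x) ` carrier ?S"
    unfolding lan_ob_def by (rule quotient_carrier[OF S.left_module_axioms lan_submodule(1)[OF V]])
  note add = quotient_add[OF S.left_module_axioms lan_submodule(1)[OF V], folded lan_ob_def]
  note sm = quotient_smult[OF S.left_module_axioms lan_submodule(1)[OF V], folded lan_ob_def]
  show "lan_desc K D C p P V F g \<in> linear_maps K (lan_ob K D C p P V) F"
  proof (rule linear_mapsI)
    show "lan_desc K D C p P V F g \<in> extensional (carrier (lan_ob K D C p P V))"
      by (simp add: lan_desc_def)
    fix s assume "s \<in> carrier (lan_ob K D C p P V)"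
    then obtain f where f: "f \<in> carrier ?S" "s = ?N +>\<^bsub>?S\<^esub> f" unfolding car by blast
    show "lan_desc K D C p P V F g s \<in> carrier F"
      unfolding f(2) d[OF f(1)] by (rule linear_mapsD(1)[OF h f(1)])
    show "lan_desc K D C p P V F g (a \<odot>\<^bsub>lan_ob K D C p P V\<^esub> s) =
        a \<odot>\<^bsub>F\<^esub> lan_desc K D C p P V F g s" if a: "a \<in> carrier K" for a
      unfolding f(2) sm[OF a f(1)] d[OF f(1)] d[OF S.smult_closed[OF a f(1)]]
      by (rule linear_mapsD(3)[OF h a f(1)])
    fix t assume "t \<in> carrier (lan_ob K D C p P V)"
    then obtain f' where f': "f' \<in> carrier ?S" "t = ?N +>\<^bsub>?S\<^esub> f'" unfolding car by blast
    show "lan_desc K D C p P V F g (s \<oplus>\<^bsub>lan_ob K D C p P V\<^esub> t) =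
        lan_desc K D C p P V F g s \<oplus>\<^bsub>F\<^esub> lan_desc K D C p P V F g t"
      unfolding f(2) f'(2) add[OF f(1) f'(1)] d[OF f(1)] d[OF f'(1)] d[OF S.M.a_closed[OF f(1) f'(1)]]
      by (rule linear_mapsD(2)[OF h f(1) f'(1)])
  qed
  assume i: "i \<in> comma D C p V" and x: "x \<in> carrier (fob P (fst i))"
  show "lan_desc K D C p P V F g (lan_class K D C p P V i x) = g i x"
    using d[OF lan_gen_closed[OF i x]] hg[OF i x] x by (simp add: lan_class_def)
qed

lemma lan_hom_ext:
  assumes V: "V \<in> Obj C" and F: "left_module K F"
    and h: "h \<in> linear_maps K (lan_ob K D C p P V) F" "h' \<in> linear_maps K (lan_ob K D C p P V) F"
    and eq: "\<And>U \<phi> x. \<lbrakk>U \<in> Obj D; \<phi> \<in> Hom C (fob p U) V; x \<in> carrier (fob P U)\<rbrakk> \<Longrightarrow>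
      h (lan_class K D C p P V (U, \<phi>) x) = h' (lan_class K D C p P V (U, \<phi>) x)"
  shows "h = h'"
proof -
  let ?S = "lan_sum D C p P V"
  let ?N = "submodule_generated K ?S (lan_relations D C p P V)"
  let ?p = "\<lambda>x\<in>carrier ?S. ?N +>\<^bsub>?S\<^esub> x"
  have pr: "?p \<in> linear_maps K ?S (lan_ob K D C p P V)"
    unfolding lan_ob_def by (rule quotient_proj_linear[OF lan_sum_left_module lan_submodule(1)[OF V]])
  have c: "compose (carrier ?S) k ?p \<in> linear_maps K (direct_sum (comma D C p V) (\<lambda>i. fob P (fst i))) F"
    if "k \<in> linear_maps K (lan_ob K D C p P V) F" for k
    using linear_maps_compose[OF pr that lan_sum_left_module] by (simp add: lan_sum_def)
  have "compose (carrier ?S) h ?p f = compose (carrier ?S) h' ?p f" if f: "f \<in> carrier ?S" for f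
  proof (rule direct_sum_linear_eq[where A="\<lambda>i. fob P (fst i)", OF K comma_A c[OF h(1)] c[OF h(2)] F])
    fix i x assume i: "i \<in> comma D C p V" and x: "x \<in> carrier (fob P (fst i))"
    have "lan_class K D C p P V i x = ?p (lan_gen D C p P V i x)"
      using lan_gen_closed[OF i x] x by (simp add: lan_class_def)
    then show "compose (carrier ?S) h ?p (ds_incl (comma D C p V) (\<lambda>i. fob P (fst i)) i x) =
        compose (carrier ?S) h' ?p (ds_incl (comma D C p V) (\<lambda>i. fob P (fst i)) i x)"
      using eq[of "fst i" "snd i" x] i x lan_gen_closed[OF i x]
      by (cases i) (simp add: compose_eq comma_iff flip: lan_gen_def)
  qed (use f in \<open>simp_all add: lan_sum_def\<close>)
  then have "h (?p f) = h' (?p f)" if "f \<in> carrier ?S" for f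
    using that by (simp only: compose_eq)
  then have "h s = h' s" if "s \<in> carrier (lan_ob K D C p P V)" for s
    using that unfolding lan_ob_def quotient_carrier[OF lan_sum_left_module lan_submodule(1)[OF V]]
    by auto
  then show ?thesis using linear_maps_ext[OF h] by blast
qed

lemma lan_class_closed:
  assumes "V \<in> Obj C" "U \<in> Obj D" "\<phi> \<in> Hom C (fob p U) V" "x \<in> carrier (fob P U)"
  shows "lan_class K D C p P V (U, \<phi>) x \<in> carrier (lan_ob K D C p P V)"
  using linear_mapsD(1)[OF lan_class_linear[OF assms(1), of "(U, \<phi>)"]] assms by (simp add: comma_iff)

lemma lan_simps: "fob (lan K D C p P) V = lan_ob K D C p P V"
  "far (lan K D C p P) V W \<theta> = lan_desc K D C p P V (lan_ob K D C p P W)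
      (\<lambda>(U, \<phi>). lan_class K D C p P W (U, Cmp C (fob p U) V W \<theta> \<phi>))"
  by (simp_all add: lan_def)

lemma lan_far_cocone:
  assumes "V \<in> Obj C" "W \<in> Obj C" "\<theta> \<in> Hom C V W"
  shows "cocone V (lan_ob K D C p P W)
    (\<lambda>(U, \<phi>). lan_class K D C p P W (U, Cmp C (fob p U) V W \<theta> \<phi>))"
  unfolding cocone_def
proof (intro conjI ballI allI impI)
  fix i assume "i \<in> comma D C p V"
  then obtain U \<phi> where i: "i = (U, \<phi>)" "U \<in> Obj D" "\<phi> \<in> Hom C (fob p U) V"
    by (cases i) (auto simp: comma_iff)
  then have "Cmp C (fob p U) V W \<theta> \<phi> \<in> Hom C (fob p U) W"
    using assms is_functorD(1)[OF p] by (intro categoryD(2)[OF C]) auto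
  then show "(case i of (U, \<phi>) \<Rightarrow> lan_class K D C p P W (U, Cmp C (fob p U) V W \<theta> \<phi>))
      \<in> linear_maps K (fob P (fst i)) (lan_ob K D C p P W)"
    using lan_class_linear[OF assms(2), of "(U, Cmp C (fob p U) V W \<theta> \<phi>)"] i by (simp add: comma_iff)
next
  fix U U' u \<psi> x
  assume u: "U \<in> Obj D \<and> U' \<in> Obj D \<and> u \<in> Hom D U U' \<and> \<psi> \<in> Hom C (fob p U') V \<and> x \<in> carrier (fob P U)"
  then have "Cmp C (fob p U) V W \<theta> (Cmp C (fob p U) (fob p U') V \<psi> (far p U U' u)) =
      Cmp C (fob p U) (fob p U') W (Cmp C (fob p U') V W \<theta> \<psi>) (far p U U' u)"
    using assms is_functorD[OF p] by (intro categoryD(5)[OF C, symmetric]) auto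
  moreover have "Cmp C (fob p U') V W \<theta> \<psi> \<in> Hom C (fob p U') W"
    using u assms is_functorD(1)[OF p] by (intro categoryD(2)[OF C]) auto
  ultimately show "(case (U, Cmp C (fob p U) (fob p U') V \<psi> (far p U U' u)) of
        (U, \<phi>) \<Rightarrow> lan_class K D C p P W (U, Cmp C (fob p U) V W \<theta> \<phi>)) x =
      (case (U', \<psi>) of (U, \<phi>) \<Rightarrow> lan_class K D C p P W (U, Cmp C (fob p U) V W \<theta> \<phi>)) (far P U U' u x)"
    using u lan_class_rel[OF assms(2), of U U' u] by simp
qed (use assms lan_ob_left_module in auto)

lemma lan_far_class:
  assumes "V \<in> Obj C" "W \<in> Obj C" "\<theta> \<in> Hom C V W"
    and "U \<in> Obj D" "\<phi> \<in> Hom C (fob p U) V" "x \<in> carrier (fob P U)"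
  shows "far (lan K D C p P) V W \<theta> (lan_class K D C p P V (U, \<phi>) x) =
    lan_class K D C p P W (U, Cmp C (fob p U) V W \<theta> \<phi>) x"
  unfolding lan_simps
  using lan_desc(2)[OF lan_far_cocone[OF assms(1-3)], of "(U, \<phi>)" x] assms by (simp add: comma_iff)

lemma lan_far_linear:
  assumes "V \<in> Obj C" "W \<in> Obj C" "\<theta> \<in> Hom C V W"
  shows "far (lan K D C p P) V W \<theta> \<in> linear_maps K (lan_ob K D C p P V) (lan_ob K D C p P W)"
  unfolding lan_simps by (rule lan_desc(1)[OF lan_far_cocone[OF assms]])

theorem lan_cat_module: "cat_module C K (lan K D C p P)"
  unfolding cat_module_def
proof (intro conjI ballI)
  fix V assume V: "V \<in> Obj C"
  interpret Q: left_module K "lan_ob K D C p P V" by (rule lan_ob_left_module[OF V])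
  show "left_module K (fob (lan K D C p P) V)" by (simp add: lan_simps Q.left_module_axioms)
  show "far (lan K D C p P) V V (Idn C V) = (\<lambda>x\<in>carrier (fob (lan K D C p P) V). x)"
    unfolding lan_simps(1)
  proof (rule lan_hom_ext[OF V Q.left_module_axioms lan_far_linear[OF V V categoryD(1)[OF C V]]])
    show "(\<lambda>x\<in>carrier (lan_ob K D C p P V). x) \<in> linear_maps K (lan_ob K D C p P V) (lan_ob K D C p P V)"
      by (rule linear_mapsI) auto
    fix U \<phi> x assume "U \<in> Obj D" "\<phi> \<in> Hom C (fob p U) V" "x \<in> carrier (fob P U)"
    then show "far (lan K D C p P) V V (Idn C V) (lan_class K D C p P V (U, \<phi>) x) =
        (\<lambda>x\<in>carrier (lan_ob K D C p P V). x) (lan_class K D C p P V (U, \<phi>) x)"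
      using V by (simp add: lan_far_class categoryD[OF C] is_functorD[OF p] lan_class_closed)
  qed
  fix W assume W: "W \<in> Obj C"
  { fix \<theta> assume "\<theta> \<in> Hom C V W"
    then show "far (lan K D C p P) V W \<theta> \<in> linear_maps K (fob (lan K D C p P) V) (fob (lan K D C p P) W)"
      unfolding lan_simps(1) by (rule lan_far_linear[OF V W]) }
  fix Z f g assume Z: "Z \<in> Obj C" and f: "f \<in> Hom C V W" and g: "g \<in> Hom C W Z"
  note gf = categoryD(2)[OF C f g V W Z]
  show "far (lan K D C p P) V Z (Cmp C V W Z g f) =
      compose (carrier (fob (lan K D C p P) V)) (far (lan K D C p P) W Z g) (far (lan K D C p P) V W f)"
    unfolding lan_simps(1)
  proof (rule lan_hom_ext[OF V lan_ob_left_module[OF Z] lan_far_linear[OF V Z gf]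
        linear_maps_compose[OF lan_far_linear[OF V W f] lan_far_linear[OF W Z g] Q.left_module_axioms]])
    fix U \<phi> x assume u: "U \<in> Obj D" "\<phi> \<in> Hom C (fob p U) V" "x \<in> carrier (fob P U)"
    note pU = is_functorD(1)[OF p u(1)]
    show "far (lan K D C p P) V Z (Cmp C V W Z g f) (lan_class K D C p P V (U, \<phi>) x) =
      compose (carrier (lan_ob K D C p P V)) (far (lan K D C p P) W Z g) (far (lan K D C p P) V W f)
        (lan_class K D C p P V (U, \<phi>) x)"
      using lan_far_class[OF V Z gf u] lan_far_class[OF V W f u]
        lan_far_class[OF W Z g u(1) categoryD(2)[OF C u(2) f pU V W] u(3)]
        categoryD(5)[OF C u(2) f g pU V W Z] lan_class_closed[OF V u]
      by (simp add: compose_eq)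
  qed
qed

theorem lan_unit_nat_trans: "nat_trans D K P (pullback p (lan K D C p P)) (lan_unit K D C p P)"
  unfolding nat_trans_def
proof (intro conjI ballI)
  fix U assume U: "U \<in> Obj D"
  note pU = is_functorD(1)[OF p U]
  note iU = categoryD(1)[OF C pU]
  show "lan_unit K D C p P U \<in> linear_maps K (fob P U) (fob (pullback p (lan K D C p P)) U)"
    using lan_class_linear[OF pU, of "(U, Idn C (fob p U))"] U iU
    by (simp add: lan_unit_def comma_iff lan_simps)
  fix U' u assume U': "U' \<in> Obj D" and u: "u \<in> Hom D U U'"
  note pU' = is_functorD(1)[OF p U']
  note iU' = categoryD(1)[OF C pU']
  note pu = is_functorD(2)[OF p u U U']
  show "compose (carrier (fob P U)) (lan_unit K D C p P U') (far P U U' u) =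
      compose (carrier (fob P U)) (far (pullback p (lan K D C p P)) U U' u) (lan_unit K D C p P U)"
    unfolding compose_def
  proof (rule restrict_ext)
    fix x assume x: "x \<in> carrier (fob P U)"
    show "lan_unit K D C p P U' (far P U U' u x) =
        far (pullback p (lan K D C p P)) U U' u (lan_unit K D C p P U x)"
      using lan_class_rel[OF pU' U U' u iU' x] lan_far_class[OF pU pU' pu U iU x]
        categoryD(3,4)[OF C pu pU pU']
      by (simp add: lan_unit_def)
  qed
qed

lemma lan_induced:
  assumes F: "cat_module C K F" and \<alpha>: "nat_trans D K P (pullback p F) \<alpha>"
    and g: "\<And>V U \<phi>. \<lbrakk>V \<in> Obj C; U \<in> Obj D; \<phi> \<in> Hom C (fob p U) V\<rbrakk> \<Longrightarrow>
      g V (U, \<phi>) = compose (carrier (fob P U)) (far F (fob p U) V \<phi>) (\<alpha> U)"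
  shows "nat_trans C K (lan K D C p P) F (\<lambda>V. lan_desc K D C p P V (fob F V) (g V))"
    and "\<And>U. U \<in> Obj D \<Longrightarrow> compose (carrier (fob P U))
      (lan_desc K D C p P (fob p U) (fob F (fob p U)) (g (fob p U))) (lan_unit K D C p P U) = \<alpha> U"
proof -
  let ?\<gamma> = "\<lambda>V. lan_desc K D C p P V (fob F V) (g V)"
  have \<alpha>l: "\<alpha> U \<in> linear_maps K (fob P U) (fob F (fob p U))" if "U \<in> Obj D" for U
    using nat_transD(1)[OF \<alpha> that] by simp
  have cc: "cocone V (fob F V) (g V)" if V: "V \<in> Obj C" for V
    unfolding cocone_def
  proof (intro conjI ballI allI impI)
    fix i assume "i \<in> comma D C p V"
    then obtain U \<phi> where i: "i = (U, \<phi>)" "U \<in> Obj D" "\<phi> \<in> Hom C (fob p U) V"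
      by (cases i) (auto simp: comma_iff)
    show "g V i \<in> linear_maps K (fob P (fst i)) (fob F V)"
      unfolding i(1) fst_conv g[OF V i(2,3)]
      by (rule linear_maps_compose[OF \<alpha>l[OF i(2)] cat_moduleD(2)[OF F i(3) is_functorD(1)[OF p i(2)] V]
            cat_moduleD(1)[OF P i(2)]])
  next
    fix U U' u \<psi> x
    assume "U \<in> Obj D \<and> U' \<in> Obj D \<and> u \<in> Hom D U U' \<and> \<psi> \<in> Hom C (fob p U') V \<and> x \<in> carrier (fob P U)"
    then have u: "U \<in> Obj D" "U' \<in> Obj D" "u \<in> Hom D U U'" "\<psi> \<in> Hom C (fob p U') V" "x \<in> carrier (fob P U)"
      by auto
    note pU = is_functorD(1)[OF p u(1)] is_functorD(1)[OF p u(2)]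
    have "\<alpha> U x \<in> carrier (fob F (fob p U))" by (rule linear_mapsD(1)[OF \<alpha>l[OF u(1)] u(5)])
    moreover have "far P U U' u x \<in> carrier (fob P U')"
      by (rule linear_mapsD(1)[OF cat_moduleD(2)[OF P u(3,1,2)] u(5)])
    moreover note g[OF V u(1) comma_precompose[OF u(1-4) V]] g[OF V u(2) u(4)]
    ultimately show "g V (U, Cmp C (fob p U) (fob p U') V \<psi> (far p U U' u)) x =
        g V (U', \<psi>) (far P U U' u x)"
      using nat_transD(2)[OF \<alpha> u(3,1,2,5)] cat_moduleD(4)[OF F is_functorD(2)[OF p u(3,1,2)] u(4) pU V] u(5)
      by (simp add: compose_eq)
  qed (use V cat_moduleD(1)[OF F V] in auto)
  have \<gamma>c: "?\<gamma> V (lan_class K D C p P V (U, \<phi>) x) = far F (fob p U) V \<phi> (\<alpha> U x)"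
    if "V \<in> Obj C" "U \<in> Obj D" "\<phi> \<in> Hom C (fob p U) V" "x \<in> carrier (fob P U)" for V U \<phi> x
    using lan_desc(2)[OF cc[OF that(1)], of "(U, \<phi>)" x] that by (simp add: comma_iff compose_eq g)
  have \<gamma>l: "?\<gamma> V \<in> linear_maps K (lan_ob K D C p P V) (fob F V)" if "V \<in> Obj C" for V
    using lan_desc(1)[OF cc[OF that]] .
  show "nat_trans C K (lan K D C p P) F ?\<gamma>"
    unfolding nat_trans_def lan_simps(1)
  proof (intro conjI ballI)
    fix V assume V: "V \<in> Obj C"
    show "?\<gamma> V \<in> linear_maps K (lan_ob K D C p P V) (fob F V)" by (rule \<gamma>l[OF V])
    fix W \<theta> assume W: "W \<in> Obj C" and t: "\<theta> \<in> Hom C V W"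
    show "compose (carrier (lan_ob K D C p P V)) (?\<gamma> W) (far (lan K D C p P) V W \<theta>) =
        compose (carrier (lan_ob K D C p P V)) (far F V W \<theta>) (?\<gamma> V)"
    proof (rule lan_hom_ext[OF V cat_moduleD(1)[OF F W]
          linear_maps_compose[OF lan_far_linear[OF V W t] \<gamma>l[OF W] lan_ob_left_module[OF V]]
          linear_maps_compose[OF \<gamma>l[OF V] cat_moduleD(2)[OF F t V W] lan_ob_left_module[OF V]]])
      fix U \<phi> x assume u: "U \<in> Obj D" "\<phi> \<in> Hom C (fob p U) V" "x \<in> carrier (fob P U)"
      note pU = is_functorD(1)[OF p u(1)]
      have a: "\<alpha> U x \<in> carrier (fob F (fob p U))" by (rule linear_mapsD(1)[OF \<alpha>l[OF u(1)] u(3)])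
      show "compose (carrier (lan_ob K D C p P V)) (?\<gamma> W) (far (lan K D C p P) V W \<theta>)
          (lan_class K D C p P V (U, \<phi>) x) =
        compose (carrier (lan_ob K D C p P V)) (far F V W \<theta>) (?\<gamma> V)
          (lan_class K D C p P V (U, \<phi>) x)"
        unfolding compose_eq[OF lan_class_closed[OF V u]] lan_far_class[OF V W t u]
          \<gamma>c[OF V u] \<gamma>c[OF W u(1) categoryD(2)[OF C u(2) t pU V W] u(3)]
          cat_moduleD(4)[OF F u(2) t pU V W] compose_eq[OF a] by (rule refl)
    qed
  qed
  show "compose (carrier (fob P U)) (?\<gamma> (fob p U)) (lan_unit K D C p P U) = \<alpha> U" if U: "U \<in> Obj D" for U
  proof (rule extensionalityI[where A="carrier (fob P U)"])
    show "\<alpha> U \<in> extensional (carrier (fob P U))" by (rule linear_mapsD(4)[OF \<alpha>l[OF U]])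
    fix x assume x: "x \<in> carrier (fob P U)"
    note pU = is_functorD(1)[OF p U]
    show "compose (carrier (fob P U)) (?\<gamma> (fob p U)) (lan_unit K D C p P U) x = \<alpha> U x"
      unfolding compose_eq[OF x] lan_unit_def \<gamma>c[OF pU U categoryD(1)[OF C pU] x]
      using cat_moduleD(3)[OF F pU] linear_mapsD(1)[OF \<alpha>l[OF U] x] by simp
  qed (simp add: compose_def)
qed

text \<open>\<open>(Lan_p P, lan_unit)\<close> is initial among the pairs \<open>(F, \<alpha> : P \<rightarrow> F \<circ> p)\<close>.\<close>

theorem lan_universal:
  assumes F: "cat_module C K F" and \<alpha>: "nat_trans D K P (pullback p F) \<alpha>"
  shows "\<exists>!\<gamma>. \<gamma> \<in> extensional (Obj C) \<and> nat_trans C K (lan K D C p P) F \<gamma> \<and>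
    (\<forall>U\<in>Obj D. compose (carrier (fob P U)) (\<gamma> (fob p U)) (lan_unit K D C p P U) = \<alpha> U)"
proof (rule ex_ex1I)
  let ?g = "\<lambda>V (U, \<phi>). compose (carrier (fob P U)) (far F (fob p U) V \<phi>) (\<alpha> U)"
  let ?\<gamma> = "\<lambda>V\<in>Obj C. lan_desc K D C p P V (fob F V) (?g V)"
  have "nat_trans C K (lan K D C p P) F ?\<gamma>"
    using lan_induced(1)[OF F \<alpha>, of ?g] by (simp add: nat_trans_def)
  then show "\<exists>\<gamma>. \<gamma> \<in> extensional (Obj C) \<and> nat_trans C K (lan K D C p P) F \<gamma> \<and>
    (\<forall>U\<in>Obj D. compose (carrier (fob P U)) (\<gamma> (fob p U)) (lan_unit K D C p P U) = \<alpha> U)"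
    using lan_induced(2)[OF F \<alpha>, of ?g] is_functorD(1)[OF p] by (intro exI[of _ ?\<gamma>]) simp
next
  fix \<gamma> \<gamma>'
  let ?ok = "\<lambda>\<gamma>. \<gamma> \<in> extensional (Obj C) \<and> nat_trans C K (lan K D C p P) F \<gamma> \<and>
    (\<forall>U\<in>Obj D. compose (carrier (fob P U)) (\<gamma> (fob p U)) (lan_unit K D C p P U) = \<alpha> U)"
  assume g: "?ok \<gamma>" and g': "?ok \<gamma>'"
  have l: "\<delta> V \<in> linear_maps K (lan_ob K D C p P V) (fob F V)" if "?ok \<delta>" "V \<in> Obj C" for \<delta> V
    using nat_transD(1)[of C K "lan K D C p P" F \<delta> V] that by (simp add: lan_simps)
  have c: "\<delta> V (lan_class K D C p P V (U, \<phi>) x) = far F (fob p U) V \<phi> (\<alpha> U x)"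
    if ok: "?ok \<delta>" and V: "V \<in> Obj C" and u: "U \<in> Obj D" "\<phi> \<in> Hom C (fob p U) V" "x \<in> carrier (fob P U)"
    for \<delta> V U \<phi> x
  proof -
    note pU = is_functorD(1)[OF p u(1)]
    note i = categoryD(1)[OF C pU]
    have "lan_class K D C p P V (U, \<phi>) x = far (lan K D C p P) (fob p U) V \<phi> (lan_unit K D C p P U x)"
      using lan_far_class[OF pU V u(2,1) i u(3)] categoryD(4)[OF C u(2) pU V] by (simp add: lan_unit_def)
    moreover have "lan_unit K D C p P U x \<in> carrier (fob (lan K D C p P) (fob p U))"
      unfolding lan_unit_def lan_simps by (rule lan_class_closed[OF pU u(1) i u(3)])
    ultimately have "\<delta> V (lan_class K D C p P V (U, \<phi>) x) =
        far F (fob p U) V \<phi> (\<delta> (fob p U) (lan_unit K D C p P U x))"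
      using nat_transD(2)[of C K "lan K D C p P" F \<delta>, OF _ u(2) pU V] ok by simp
    moreover have "\<delta> (fob p U) (lan_unit K D C p P U x) = \<alpha> U x"
      using ok u(1) compose_eq[OF u(3), of "\<delta> (fob p U)" "lan_unit K D C p P U"] by metis
    ultimately show ?thesis by simp
  qed
  show "\<gamma> = \<gamma>'"
  proof (rule extensionalityI[where A="Obj C"])
    fix V assume V: "V \<in> Obj C"
    show "\<gamma> V = \<gamma>' V"
      by (rule lan_hom_ext[OF V cat_moduleD(1)[OF F V] l[OF g V] l[OF g' V]])
        (simp add: c[OF g V] c[OF g' V])
  qed (use g g' in auto)
qed

end

theorem lan_canonical_unit:
  assumes D: "category D" and C: "category C" and p: "is_functor D C p" and K: "ring K"
    and M: "cat_module C K M"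
  shows "nat_trans C K (lan K D C p (pullback p M)) M (lan_canonical K D C p M)"
    and "\<And>U. U \<in> Obj D \<Longrightarrow> compose (carrier (fob M (fob p U))) (lan_canonical K D C p M (fob p U))
      (lan_unit K D C p (pullback p M) U) = (\<lambda>x\<in>carrier (fob M (fob p U)). x)"
proof -
  let ?i = "\<lambda>U. \<lambda>x\<in>carrier (fob M (fob p U)). x"
  let ?g = "\<lambda>V (U, \<phi>). far M (fob p U) V \<phi>"
  note P = pullback_cat_module[OF p M]
  have i: "nat_trans D K (pullback p M) (pullback p M) ?i"
    unfolding nat_trans_def pullback_simps
  proof (intro conjI ballI)
    fix U assume U: "U \<in> Obj D"
    interpret U: left_module K "fob M (fob p U)"
      by (rule cat_moduleD(1)[OF M is_functorD(1)[OF p U]])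
    show "?i U \<in> linear_maps K (fob M (fob p U)) (fob M (fob p U))"
      by (rule linear_mapsI) auto
    fix V f assume V: "V \<in> Obj D" and f: "f \<in> Hom D U V"
    have "far M (fob p U) (fob p V) (far p U V f) \<in> linear_maps K (fob M (fob p U)) (fob M (fob p V))"
      using cat_moduleD(2)[OF P f U V] by simp
    from linear_mapsD(1)[OF this]
    show "compose (carrier (fob M (fob p U))) (?i V) (far M (fob p U) (fob p V) (far p U V f)) =
        compose (carrier (fob M (fob p U))) (far M (fob p U) (fob p V) (far p U V f)) (?i U)"
      unfolding compose_def by (intro restrict_ext) simp
  qed
  have g: "?g V (U, \<phi>) = compose (carrier (fob (pullback p M) U)) (far M (fob p U) V \<phi>) (?i U)"
    if "V \<in> Obj C" "U \<in> Obj D" "\<phi> \<in> Hom C (fob p U) V" for V U \<phi>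
  proof (rule extensionalityI[where A="carrier (fob M (fob p U))"])
    show "?g V (U, \<phi>) \<in> extensional (carrier (fob M (fob p U)))"
      using linear_mapsD(4)[OF cat_moduleD(2)[OF M that(3) is_functorD(1)[OF p that(2)] that(1)]] by simp
  qed (simp_all add: compose_def)
  have e: "lan_canonical K D C p M =
      (\<lambda>V. lan_desc K D C p (pullback p M) V (fob M V) (?g V))"
    by (simp add: lan_canonical_def fun_eq_iff)
  show "nat_trans C K (lan K D C p (pullback p M)) M (lan_canonical K D C p M)"
    unfolding e by (rule lan_induced(1)[OF D C p K P M i g])
  show "compose (carrier (fob M (fob p U))) (lan_canonical K D C p M (fob p U))
      (lan_unit K D C p (pullback p M) U) = (\<lambda>x\<in>carrier (fob M (fob p U)). x)" if "U \<in> Obj D" for U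
    unfolding e using lan_induced(2)[OF D C p K P M i g that] unfolding pullback_simps .
qed

section \<open>The categories of orthogonal modules\<close>

lemma OrI_category:
  fixes R :: "('r, 'q) ring_scheme"
  shows "category (OrI R :: (('r, 'v) orth, 'v \<Rightarrow> 'v) cat)"
proof -
  have "(\<lambda>x\<in>carrier (fst E). x) \<in> isometries R E E" if "orthogonal_module R E" for E :: "('r, 'v) orth"
  proof -
    interpret module R "fst E" using that by (simp add: orthogonal_module_def)
    have "(\<lambda>x\<in>carrier (fst E). x) \<in> linear_maps R (fst E) (fst E)"
      by (rule linear_mapsI) auto
    then show ?thesis by (auto simp: isometries_def split: prod.splits)
  qed
  moreover have "compose (carrier (fst E)) g f \<in> isometries R E G"
    if "orthogonal_module R E" "f \<in> isometries R E F" "g \<in> isometries R F G" for E F G :: "('r, 'v) orth" and f g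
  proof -
    have "left_module R (fst E)" using that by (simp add: orthogonal_module_def module_iff_left_module)
    then show ?thesis using that linear_maps_compose[of f R "fst E" "fst F" g "fst G"]
      by (auto simp: isometries_def compose_eq linear_mapsD(1) split: prod.splits)
  qed
  moreover have "compose (carrier (fst E)) (\<lambda>x\<in>carrier (fst F). x) f = f \<and>
      compose (carrier (fst E)) f (\<lambda>x\<in>carrier (fst E). x) = f \<and>
      compose (carrier (fst E)) (compose (carrier (fst F)) h g) f =
        compose (carrier (fst E)) h (compose (carrier (fst E)) g f)"
    if "f \<in> isometries R E F" for E F :: "('r, 'v) orth" and f and g h :: "'v \<Rightarrow> 'v"
  proof -
    have f: "f \<in> linear_maps R (fst E) (fst F)"
      using that by (auto simp: isometries_def split: prod.splits)
    then show ?thesis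
      using linear_mapsD(1,4)[OF f]
      by (auto simp: compose_def extensional_def fun_eq_iff)
  qed
  ultimately show ?thesis
    unfolding category_def OrI_def by (simp del: split_paired_All)
qed

lemma OrI_le_inclusion:
  shows "category (OrI_le R N)" "is_functor (OrI_le R N) (OrI R) inclusion_functor"
  using OrI_category
  by (auto simp: OrI_le_def full_subcat_def category_def is_functor_def inclusion_functor_def)

end

theory Submission
  imports Defs "HOL-Library.Ramsey" "HOL-Library.Sublist" "HOL-Library.List_Lexorder"
begin

text \<open>
  \<open>Lan\<^sub>p (M|)\<close> and \<open>M\<close> are quotients of the same sum of representable functors
  \<open>\<Oplus>\<^sub>s K[Hom(E\<^sub>s, -)]\<close>, indexed by generators of \<open>M\<close>, once the subcategory contains the
  \<open>E\<^sub>s\<close>.  The kernel of the first lies in the kernel \<open>Z\<close> of the second, with equality on the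
  objects of the subcategory.  So it suffices that a subfunctor of \<open>Z\<close> that agrees with \<open>Z\<close> at
  finitely many suitable objects is \<open>Z\<close>; the objects of rank \<open>N\<close> in the subcategory play no role.

  This is a Groebner basis argument.  Every orthogonal module \<open>W\<close> has a frame: pairwise orthogonal
  \<open>v\<^sub>i\<close> and scalars \<open>b\<^sub>i\<close> with \<open>w = \<Sum> b\<^sub>i B(w, v\<^sub>i) v\<^sub>i\<close>.  It is found by splitting off vectors
  whose square \<open>B(v, v)\<close> is not nilpotent, after multiplying them with an idempotent power of that
  square, so \<open>R\<close> need not be split into local rings.  A map \<open>f : E \<rightarrow> W\<close> becomes the word over a
  finite alphabet whose \<open>i\<close>-th letter is \<open>(B(v\<^sub>i, v\<^sub>i), b\<^sub>i, x \<mapsto> B(f x, v\<^sub>i))\<close>.  If \<open>\<sigma>\<close> maps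
  the positions of the word of \<open>f' : E \<rightarrow> W'\<close> onto those of the word of \<open>f\<close>, preserving letters and
  with all fibres of size 1 modulo \<open>|R|\<close>, then \<open>g w = \<Sum>\<^sub>k b'\<^sub>k B(w, v\<^bsub>\<sigma> k\<^esub>) v'\<^sub>k\<close> is an
  isometry with \<open>g \<circ> f = f'\<close>.  If moreover the first occurrences of the positions under \<open>\<sigma>\<close> are
  increasing, composition with \<open>g\<close> is monotone for the lexicographic order of words.  Higman's lemma
  provides such \<open>\<sigma>\<close>, and \<open>K\<close> being Noetherian bounds the leading coefficients.
\<close>

section \<open>Well-quasi-orders on words\<close>

text \<open>For a preorder this is being a well-quasi-order. Stated for an arbitrary relation, it
  applies directly to the existence of a folding or of a morphism, without a composition
  law.\<close>

definition almost_full :: "('a \<Rightarrow> 'a \<Rightarrow> bool) \<Rightarrow> 'a set \<Rightarrow> bool"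
  where "almost_full P X \<longleftrightarrow>
    (\<forall>f :: nat \<Rightarrow> 'a. range f \<subseteq> X \<longrightarrow> (\<exists>i j. i < j \<and> P (f i) (f j)))"

lemma almost_fullD:
  assumes "almost_full P X" "\<And>i :: nat. f i \<in> X"
  obtains i j where "i < j" "P (f i) (f j)"
  using assms unfolding almost_full_def by blast

text \<open>Ramsey's theorem for pairs, coloured by whether \<open>P\<close> holds: the homogeneous
  set cannot have the negative colour, because some pair in it is good.\<close>

lemma almost_full_subseq:
  assumes "almost_full P X" and f: "\<And>i :: nat. f i \<in> X"
  obtains \<phi> :: "nat \<Rightarrow> nat" where "strict_mono \<phi>" "\<And>i j. i < j \<Longrightarrow> P (f (\<phi> i)) (f (\<phi> j))"
proof -
  \<comment> \<open>A colour is attached to an unordered pair, so \<open>Min\<close> and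
    \<open>Max\<close> recover the order of its indices.\<close>
  let ?c = "\<lambda>e. if P (f (Min e)) (f (Max e)) then 1 else 0 :: nat"
  have "\<forall>x\<in>UNIV. \<forall>y\<in>UNIV. x \<noteq> y \<longrightarrow> ?c {x, y} < 2" by simp
  from Ramsey2[OF infinite_UNIV_nat this]
  obtain Y t where Y: "infinite Y" and "\<forall>x\<in>Y. \<forall>y\<in>Y. x \<noteq> y \<longrightarrow> ?c {x, y} = t"
    by (elim exE conjE)
  then have t: "?c {x, y} = t" if "x \<in> Y" "y \<in> Y" "x \<noteq> y" for x y
    using that by (elim ballE impE) auto
  let ?\<phi> = "enumerate Y"
  have mono: "strict_mono ?\<phi>" using Y by (rule strict_mono_enumerate)
  have c: "?c {?\<phi> i, ?\<phi> j} = (if P (f (?\<phi> i)) (f (?\<phi> j)) then 1 else 0)" if "i < j" for i j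
    using strict_monoD[OF mono that] by (simp add: max_def min_def)
  have ct: "?c {?\<phi> i, ?\<phi> j} = t" if "i < j" for i j
    using t[OF enumerate_in_set[OF Y] enumerate_in_set[OF Y]] strict_monoD[OF mono that] by (metis less_irrefl)
  obtain i j where ij: "i < j" "P (f (?\<phi> i)) (f (?\<phi> j))"
    using assms(1) f by (rule almost_fullD[where f="\<lambda>i. f (?\<phi> i)"])
  then have "t = 1" using ct[OF ij(1)] c[OF ij(1)] by simp
  then have "P (f (?\<phi> i)) (f (?\<phi> j))" if "i < j" for i j
    using ct[OF that] c[OF that] by (metis zero_neq_one)
  with mono show thesis by (rule that)
qed

text \<open>Thin the sequence until every pair is good for \<open>P\<close>; one pair good for
  \<open>Q\<close> is then good for both.\<close>

lemma almost_full_prod: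
  fixes X :: "'a set" and Y :: "'b set"
  assumes P: "almost_full P X" and Q: "almost_full Q Y"
  shows "almost_full (\<lambda>x y. P (fst x) (fst y) \<and> Q (snd x) (snd y)) (X \<times> Y)"
  unfolding almost_full_def
proof (intro allI impI)
  fix f :: "nat \<Rightarrow> 'a \<times> 'b" assume "range f \<subseteq> X \<times> Y"
  then have f: "fst (f i) \<in> X" "snd (f i) \<in> Y" for i by (auto simp: mem_Times_iff image_subset_iff)
  obtain \<phi> :: "nat \<Rightarrow> nat" where \<phi>: "strict_mono \<phi>" "\<And>i j. i < j \<Longrightarrow> P (fst (f (\<phi> i))) (fst (f (\<phi> j)))"
    by (rule almost_full_subseq[OF P, of "\<lambda>i. fst (f i)", OF f(1)]) (rule that)
  obtain i j where "i < j" "Q (snd (f (\<phi> i))) (snd (f (\<phi> j)))"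
    by (rule almost_fullD[OF Q, of "\<lambda>i. snd (f (\<phi> i))"]) (use f in auto)
  then show "\<exists>i j. i < j \<and> P (fst (f i)) (fst (f j)) \<and> Q (snd (f i)) (snd (f j))"
    using \<phi> strict_monoD by blast
qed

lemma almost_full_map:
  fixes X :: "'a set"
  assumes "almost_full Q Y" "h ` X \<subseteq> Y"
    and "\<And>x y. \<lbrakk>x \<in> X; y \<in> X; Q (h x) (h y)\<rbrakk> \<Longrightarrow> P x y"
  shows "almost_full P X"
  unfolding almost_full_def
proof (intro allI impI)
  fix f :: "nat \<Rightarrow> 'a" assume f: "range f \<subseteq> X"
  obtain i j where "i < j" "Q (h (f i)) (h (f j))"
    by (rule almost_fullD[OF assms(1), of "\<lambda>i. h (f i)"]) (use f assms(2) in blast)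
  then show "\<exists>i j. i < j \<and> P (f i) (f j)" using assms(3) f by blast
qed

text \<open>One of the two sets receives infinitely many terms, and the subsequence of those terms
  has a good pair.\<close>

lemma almost_full_Un:
  fixes X :: "'a set"
  assumes X: "almost_full P X" and Y: "almost_full P Y"
  shows "almost_full P (X \<union> Y)"
  unfolding almost_full_def
proof (intro allI impI)
  fix f :: "nat \<Rightarrow> 'a" assume f: "range f \<subseteq> X \<union> Y"
  have *: "\<exists>i j. i < j \<and> P (f i) (f j)" if Z: "almost_full P Z" and inf: "infinite {i. f i \<in> Z}" for Z
  proof -
    let ?\<phi> = "enumerate {i. f i \<in> Z}"
    obtain i j where "i < j" "P (f (?\<phi> i)) (f (?\<phi> j))"
      by (rule almost_fullD[OF Z, of "\<lambda>i. f (?\<phi> i)"]) (use enumerate_in_set[OF inf] in auto)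
    then show ?thesis using strict_monoD[OF strict_mono_enumerate[OF inf]] by blast
  qed
  have "UNIV = {i. f i \<in> X} \<union> {i. f i \<in> Y}" using f by auto
  then have "infinite {i. f i \<in> X} \<or> infinite {i. f i \<in> Y}"
    using infinite_UNIV_nat by (metis finite_UnI)
  then show "\<exists>i j. i < j \<and> P (f i) (f j)" using * X Y by blast
qed

lemma almost_full_finite_eq:
  fixes X :: "'a set"
  assumes "finite X"
  shows "almost_full (=) X"
  unfolding almost_full_def
proof (intro allI impI)
  fix f :: "nat \<Rightarrow> 'a" assume "range f \<subseteq> X"
  then have "\<not> inj f"
    using assms finite_subset range_inj_infinite by blast
  then show "\<exists>i j. i < j \<and> f i = f j" unfolding inj_def by (metis nat_neq_iff)
qed

text \<open>A word avoiding \<open>a # u\<close> either has no letter \<open>a\<close>, or is \<open>x @ a # y\<close> with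
  \<open>x\<close> free of \<open>a\<close> and \<open>y\<close> avoiding \<open>u\<close>.\<close>

lemma almost_full_avoiding:
  assumes "\<And>a. a \<in> A \<Longrightarrow> almost_full subseq (lists (A - {a}))" and "set u \<subseteq> A"
  shows "almost_full subseq {w \<in> lists A. \<not> subseq u w}"
  using assms(2)
proof (induction u)
  case Nil
  then show ?case by (simp add: almost_full_def)
next
  case (Cons a u)
  let ?Y = "{w \<in> lists A. \<not> subseq (a # u) w \<and> a \<in> set w}"
  have "\<exists>p. w = fst p @ a # snd p \<and> a \<notin> set (fst p)" if "a \<in> set w" for w
    using split_list_first[OF that] by auto
  then obtain h where h: "\<And>w. a \<in> set w \<Longrightarrow> w = fst (h w) @ a # snd (h w)"
      "\<And>w. a \<in> set w \<Longrightarrow> a \<notin> set (fst (h w))"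
    by metis
  have "almost_full subseq ?Y"
  proof (rule almost_full_map[where h=h])
    show "almost_full (\<lambda>x y. subseq (fst x) (fst y) \<and> subseq (snd x) (snd y))
        (lists (A - {a}) \<times> {w \<in> lists A. \<not> subseq u w})"
      using Cons by (intro almost_full_prod assms(1)) auto
    have "h w \<in> lists (A - {a}) \<times> {w \<in> lists A. \<not> subseq u w}" if w: "w \<in> ?Y" for w
    proof -
      have eq: "w = fst (h w) @ a # snd (h w)" and a: "a \<notin> set (fst (h w))" using h[of w] w by blast+
      \<comment> \<open>Were \<open>u\<close> a subsequence of the tail, \<open>a # u\<close> would
        be one of \<open>w\<close>.\<close>
      have "subseq (a # snd (h w)) w" using list_emb_append2[of "(=)" "a # snd (h w)" "a # snd (h w)" "fst (h w)"]
        by (simp add: eq[symmetric])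
      then have "\<not> subseq u (snd (h w))"
        using w subseq_order.order_trans[of "a # u" "a # snd (h w)" w] by auto
      moreover have "set (fst (h w) @ a # snd (h w)) \<subseteq> A"
        by (subst eq[symmetric]) (use w in auto)
      ultimately show ?thesis using a by (auto simp: mem_Times_iff in_lists_conv_set)
    qed
    then show "h ` ?Y \<subseteq> lists (A - {a}) \<times> {w \<in> lists A. \<not> subseq u w}" by blast
    fix x y assume xy: "x \<in> ?Y" "y \<in> ?Y" "subseq (fst (h x)) (fst (h y)) \<and> subseq (snd (h x)) (snd (h y))"
    then have "subseq (fst (h x) @ a # snd (h x)) (fst (h y) @ a # snd (h y))"
      by (intro list_emb_append_mono) auto
    then show "subseq x y" using h(1)[of x, symmetric] h(1)[of y, symmetric] xy by simp
  qed
  then have "almost_full subseq (lists (A - {a}) \<union> ?Y)"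
    using Cons.prems assms(1) by (intro almost_full_Un) auto
  moreover have "{w \<in> lists A. \<not> subseq (a # u) w} \<subseteq> lists (A - {a}) \<union> ?Y" by auto
  ultimately show ?case unfolding almost_full_def by (meson subset_trans)
qed

text \<open>Higman's lemma for equality of letters, by induction on the alphabet. In a bad sequence
  every later word avoids the first one, and the avoiding words are almost full once all smaller
  alphabets are settled.\<close>

lemma almost_full_subseq_lists:
  fixes A :: "'a set"
  assumes "finite A"
  shows "almost_full subseq (lists A)"
  using assms
proof (induction "card A" arbitrary: A rule: less_induct)
  case less
  have a: "almost_full subseq (lists (A - {a}))" if "a \<in> A" for a
    using less.hyps[OF card_Diff1_less[OF less.prems that]] less.prems by simp
  show ?case unfolding almost_full_def
  proof (intro allI impI)
    fix f :: "nat \<Rightarrow> 'a list" assume f: "range f \<subseteq> lists A"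
    show "\<exists>i j. i < j \<and> subseq (f i) (f j)"
    proof (rule ccontr)
      assume bad: "\<not> ?thesis"
      then have "f (Suc i) \<in> {w \<in> lists A. \<not> subseq (f 0) w}" for i using f bad by blast
      moreover have "set (f 0) \<subseteq> A" using f by (auto simp: image_subset_iff in_lists_conv_set)
      ultimately obtain i j where "i < j" "subseq (f (Suc i)) (f (Suc j))"
        using almost_fullD[OF almost_full_avoiding[OF a, of "f 0"], of "\<lambda>i. f (Suc i)"] by blast
      then show False using bad by blast
    qed
  qed
qed

lemma subseq_index:
  assumes "subseq xs ys"
  obtains e where "strict_mono_on {..<length xs} e" "\<And>p. p < length xs \<Longrightarrow> e p < length ys \<and> ys ! e p = xs ! p"
proof -
  have "\<exists>e. strict_mono_on {..<length xs} e \<and> (\<forall>p<length xs. e p < length ys \<and> ys ! e p = xs ! p)"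
    using assms
  proof (induction rule: list_emb.induct)
    case (list_emb_Nil ys)
    then show ?case by (simp add: strict_mono_on_def)
  next
    case (list_emb_Cons xs ys y)
    then obtain e where "strict_mono_on {..<length xs} e" "\<forall>p<length xs. e p < length ys \<and> ys ! e p = xs ! p"
      by blast
    then show ?case by (intro exI[of _ "\<lambda>p. Suc (e p)"]) (auto simp: strict_mono_on_def)
  next
    case (list_emb_Cons2 x y xs ys)
    then obtain e where "strict_mono_on {..<length xs} e" "\<forall>p<length xs. e p < length ys \<and> ys ! e p = xs ! p"
      by blast
    then show ?case using list_emb_Cons2(1)
      by (intro exI[of _ "\<lambda>p. case p of 0 \<Rightarrow> 0 | Suc p \<Rightarrow> Suc (e p)"])
        (auto simp: strict_mono_on_def less_Suc_eq_0_disj split: nat.split)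
  qed
  then show thesis using that by blast
qed


section \<open>Folding one word onto another\<close>

text \<open>The marks make an embedding of marked words send the first occurrence of a letter to the
  first occurrence of that letter.\<close>

definition first_occs :: "'a list \<Rightarrow> ('a \<times> bool) list"
  where "first_occs w = map (\<lambda>i. (w ! i, w ! i \<notin> set (take i w))) [0..<length w]"

text \<open>Fibres of size 1 modulo \<open>m\<close> keep sums in a group of order \<open>m\<close>
  unchanged. The last clause says that the first preimages of successive positions appear in
  increasing order, so that reindexing preserves lexicographic comparison.\<close>

definition folds_onto :: "nat \<Rightarrow> 'a list \<Rightarrow> 'a list \<Rightarrow> (nat \<Rightarrow> nat) \<Rightarrow> bool"
  where "folds_onto m w w' \<sigma> \<longleftrightarrow>
    (\<forall>k<length w'. \<sigma> k < length w \<and> w' ! k = w ! \<sigma> k) \<and>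
    (\<forall>p<length w. card {k. k < length w' \<and> \<sigma> k = p} mod m = 1 mod m) \<and>
    (\<forall>p<length w. \<exists>k<length w'. \<sigma> k = p \<and> (\<forall>k'<k. \<sigma> k' < p))"

text \<open>\<open>\<sigma>\<close> inverts the embedding on its image and sends every other
  position to the first occurrence of its letter. Only the fibres over first occurrences grow, and
  they grow by a multiple of \<open>m\<close>.\<close>

lemma folds_ontoI:
  assumes sub: "subseq (first_occs w) (first_occs w')" and set: "set w' = set w"
    and cnt: "\<And>a. a \<in> set w \<Longrightarrow> count_list w' a mod m = count_list w a mod m"
  shows "\<exists>\<sigma>. folds_onto m w w' \<sigma>"
proof -
  let ?n = "length w" and ?n' = "length w'"
  obtain e where mono: "strict_mono_on {..<?n} e"
    and e: "\<And>p. p < ?n \<Longrightarrow> e p < ?n' \<and> first_occs w' ! e p = first_occs w ! p"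
    using subseq_index[OF sub] by (auto simp: first_occs_def)
  have ew: "w' ! e p = w ! p" "w ! p \<in> set (take p w) \<longleftrightarrow> w ! p \<in> set (take (e p) w')" if "p < ?n" for p
    using e[OF that] that by (auto simp: first_occs_def)
  have inj: "inj_on e {..<?n}" using mono by (rule strict_mono_on_imp_inj_on)
  define fst_pos where "fst_pos a = (LEAST p. p < ?n \<and> w ! p = a)" for a
  have fp: "fst_pos a < ?n" "w ! fst_pos a = a" "\<And>p. p < ?n \<Longrightarrow> w ! p = a \<Longrightarrow> fst_pos a \<le> p"
    if "a \<in> set w" for a
  proof -
    have "\<exists>p. p < ?n \<and> w ! p = a" using that by (auto simp: in_set_conv_nth)
    from LeastI_ex[OF this] show "fst_pos a < ?n" "w ! fst_pos a = a" by (auto simp: fst_pos_def)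
    show "fst_pos a \<le> p" if "p < ?n" "w ! p = a" for p
      unfolding fst_pos_def by (rule Least_le) (use that in auto)
  qed
  \<comment> \<open>Thanks to the marks, no occurrence of \<open>a\<close> in \<open>w'\<close>
    precedes the image of its first occurrence in \<open>w\<close>.\<close>
  have first: "e (fst_pos a) \<le> k" if k: "k < ?n'" "w' ! k = a" for a k
  proof -
    have a: "a \<in> set w" using k set nth_mem by metis
    have "a \<notin> set (take (fst_pos a) w)"
    proof
      assume "a \<in> set (take (fst_pos a) w)"
      then obtain p where "p < fst_pos a" "w ! p = a" by (auto simp: in_set_conv_nth)
      then show False using fp(3)[OF a, of p] fp(1)[OF a] by simp
    qed
    then have n: "a \<notin> set (take (e (fst_pos a)) w')" using ew(2)[OF fp(1)[OF a]] fp(2)[OF a] by simp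
    show ?thesis
    proof (rule ccontr)
      assume "\<not> ?thesis"
      then have "a \<in> set (take (e (fst_pos a)) w')"
        using k by (auto simp: in_set_conv_nth intro!: exI[of _ k])
      with n show False ..
    qed
  qed
  define \<sigma> where "\<sigma> k = (if k \<in> e ` {..<?n} then inv_into {..<?n} e k else fst_pos (w' ! k))" for k
  have \<sigma>e: "\<sigma> (e p) = p" if "p < ?n" for p
    using that inj by (simp add: \<sigma>_def)
  have \<sigma>n: "\<sigma> k = fst_pos (w' ! k)" if "k \<notin> e ` {..<?n}" for k
    using that by (simp add: \<sigma>_def)
  have 1: "\<sigma> k < ?n \<and> w' ! k = w ! \<sigma> k" if "k < ?n'" for k
  proof (cases "k \<in> e ` {..<?n}")
    case True
    then show ?thesis using \<sigma>e ew by auto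
  next
    case False
    moreover have "w' ! k \<in> set w" using that set nth_mem by blast
    ultimately show ?thesis using fp \<sigma>n by simp
  qed
  have 2: "\<exists>k<?n'. \<sigma> k = p \<and> (\<forall>k'<k. \<sigma> k' < p)" if p: "p < ?n" for p
  proof (intro exI[of _ "e p"] conjI allI impI)
    show "e p < ?n'" "\<sigma> (e p) = p" using e \<sigma>e p by auto
    fix k' assume k': "k' < e p"
    show "\<sigma> k' < p"
    proof (cases "k' \<in> e ` {..<?n}")
      case True
      then obtain q where q: "k' = e q" "q < ?n" by auto
      have "q < p"
        using k' strict_mono_on_leD[OF mono, of p q] q p by (meson leD lessThan_iff not_le)
      then show ?thesis using q \<sigma>e by simp
    next
      case False
      \<comment> \<open>A position outside the image folds to the first occurrence of its letter,
        which is embedded at or before \<open>k'\<close>, hence before \<open>e p\<close>.\<close>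
      let ?q = "fst_pos (w' ! k')"
      have k'': "k' < ?n'" using k' e[OF p] by simp
      then have "w' ! k' \<in> set w" using set nth_mem by blast
      then have q: "?q < ?n" by (rule fp)
      have "e ?q < e p" using first[OF k'' refl] k' by simp
      then have "?q < p"
        using strict_mono_on_leD[OF mono, of p ?q] q p by (meson leD lessThan_iff not_le)
      then show ?thesis using \<sigma>n[OF False] by simp
    qed
  qed
  have 3: "card {k. k < ?n' \<and> \<sigma> k = p} mod m = 1 mod m" if p: "p < ?n" for p
  proof (cases "fst_pos (w ! p) = p")
    case False
    have "{k. k < ?n' \<and> \<sigma> k = p} = {e p}"
    proof safe
      fix k assume k: "k < ?n'" "p = \<sigma> k"
      show "k = e (\<sigma> k)"
      proof (cases "k \<in> e ` {..<?n}")
        case True then show ?thesis using \<sigma>e by auto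
      next
        case n: False
        then have "fst_pos (w ! p) = p" using 1[OF k(1)] k(2) \<sigma>n[OF n] by metis
        then show ?thesis using False by simp
      qed
    qed (use e \<sigma>e p in auto)
    then show ?thesis by simp
  next
    case True
    \<comment> \<open>For a first occurrence \<open>p\<close> the fibre is \<open>e p\<close>
      together with all unembedded occurrences of the letter, so its size is the difference of the
      two counts plus one.\<close>
    let ?a = "w ! p"
    let ?I = "{k. k < ?n' \<and> w' ! k = ?a}" and ?J = "e ` {q. q < ?n \<and> w ! q = ?a}"
    have eq: "{k. k < ?n' \<and> \<sigma> k = p} = insert (e p) (?I - ?J)"
    proof (intro Set.set_eqI iffI)
      fix k assume k: "k \<in> {k. k < ?n' \<and> \<sigma> k = p}"
      then have "k \<in> ?I" using 1 by auto
      moreover have "k = e p" if "k \<in> ?J" using that k \<sigma>e by auto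
      ultimately show "k \<in> insert (e p) (?I - ?J)" by blast
    next
      fix k assume k: "k \<in> insert (e p) (?I - ?J)"
      show "k \<in> {k. k < ?n' \<and> \<sigma> k = p}"
      proof (cases "k = e p")
        case False
        then have "k \<notin> e ` {..<?n}" using k ew(1) by auto
        then show ?thesis using k False True \<sigma>n by auto
      qed (use e \<sigma>e p in auto)
    qed
    have J: "?J \<subseteq> ?I" using e ew by auto
    have "e p \<in> ?J" using p by auto
    then have "card {k. k < ?n' \<and> \<sigma> k = p} = Suc (card ?I - card ?J)"
      unfolding eq using J by (subst card_insert_disjoint) (auto simp: card_Diff_subset)
    moreover have "card ?I = count_list w' ?a"
      by (simp add: count_list_eq_length_filter length_filter_conv_card eq_commute)
    moreover have "card ?J = count_list w ?a"
      by (subst card_image) (auto intro: inj_on_subset[OF inj]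
          simp: count_list_eq_length_filter length_filter_conv_card eq_commute)
    moreover have "card ?J \<le> card ?I" using J by (intro card_mono) auto
    moreover have "(count_list w' ?a - count_list w ?a) mod m = 0"
      using cnt[of ?a] p calculation by (metis mod_eq_dvd_iff_nat mod_0_imp_dvd dvd_imp_mod_0 nth_mem)
    ultimately show ?thesis by (metis One_nat_def mod_Suc_eq)
  qed
  show ?thesis using 1 2 3 unfolding folds_onto_def by blast
qed

text \<open>A folding exists as soon as the letter sets and the letter counts modulo
  \<open>m\<close> agree and the marked words embed. The first two take finitely many values, and
  Higman's lemma covers the third.\<close>

lemma almost_full_folds_onto:
  fixes A :: "'a set"
  assumes A: "finite A" and m: "m > 0"
  shows "almost_full (\<lambda>w w'. \<exists>\<sigma>. folds_onto m w w' \<sigma>) (lists A)"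
proof (rule almost_full_map)
  let ?h = "\<lambda>w. ((set w, \<lambda>a\<in>A. count_list w a mod m), first_occs w)"
  let ?Y = "(Pow A \<times> (A \<rightarrow>\<^sub>E {..<m})) \<times> lists (A \<times> (UNIV :: bool set))"
  show "almost_full (\<lambda>x y. fst x = fst y \<and> subseq (snd x) (snd y)) ?Y"
    using A by (intro almost_full_prod almost_full_finite_eq almost_full_subseq_lists) (auto intro: finite_PiE)
  show "?h ` lists A \<subseteq> ?Y" using m by (auto simp: first_occs_def in_lists_conv_set)
  fix w w' assume w: "w \<in> lists A" "w' \<in> lists A" and h: "fst (?h w) = fst (?h w') \<and> subseq (snd (?h w)) (snd (?h w'))"
  have "count_list w' a mod m = count_list w a mod m" if "a \<in> set w" for a
  proof -
    have "a \<in> A" using w that by (auto simp: in_lists_conv_set)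
    moreover have "(\<lambda>a\<in>A. count_list w a mod m) a = (\<lambda>a\<in>A. count_list w' a mod m) a" using h by simp
    ultimately show ?thesis by simp
  qed
  then show "\<exists>\<sigma>. folds_onto m w w' \<sigma>" using h by (intro folds_ontoI) auto
qed


section \<open>Leading coefficients\<close>

text \<open>Otherwise elements could be chosen one after another, none of them above an earlier one,
  which is a bad sequence.\<close>

lemma almost_full_finite_basis:
  fixes X :: "'a set"
  assumes "almost_full P X"
  shows "\<exists>G. finite G \<and> G \<subseteq> X \<and> (\<forall>y\<in>X. \<exists>x\<in>G. P x y)"
proof (rule ccontr)
  assume no: "\<not> ?thesis"
  have "\<exists>y. y \<in> X \<and> (\<forall>x\<in>G. \<not> P x y)" if "finite G" "G \<subseteq> X" for G
    using no[THEN not_ex[THEN iffD1], THEN spec[of _ G]] that by blast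
  then obtain c where c: "\<And>G. \<lbrakk>finite G; G \<subseteq> X\<rbrakk> \<Longrightarrow> c G \<in> X \<and> (\<forall>x\<in>G. \<not> P x (c G))"
    by metis
  \<comment> \<open>\<open>g n\<close> collects the first \<open>n\<close> choices, and
    \<open>c\<close> picks an element of \<open>X\<close> that lies above none of them.\<close>
  define g where "g = rec_nat {} (\<lambda>_ G. insert (c G) G)"
  have g0: "g 0 = {}" and gS: "\<And>n. g (Suc n) = insert (c (g n)) (g n)"
    by (simp_all add: g_def)
  have g: "finite (g n) \<and> g n \<subseteq> X" for n
    by (induction n) (use c in \<open>auto simp: g0 gS\<close>)
  have mono: "c (g i) \<in> g j" if "i < j" for i j
    using that by (induction j) (auto simp: gS less_Suc_eq)
  obtain i j where "i < j" "P (c (g i)) (c (g j))"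
    by (rule almost_fullD[OF assms, of "\<lambda>n. c (g n)"]) (use c g in auto)
  then show False using c[of "g j"] g[of j] mono by blast
qed

text \<open>The union of the chain is a left ideal, and its finitely many generators already lie in
  one member. The conclusion has the shape of a good pair.\<close>

lemma (in left_noetherian_ring) ideal_chain_repeats:
  fixes I :: "nat \<Rightarrow> 'a set"
  assumes sub: "\<And>i. submodule (I i) K (regular_module K)"
    and chain: "\<And>i j. i < j \<Longrightarrow> I i \<subseteq> I j"
  shows "\<exists>i j. i < j \<and> I i = I j"
proof -
  have mono: "I i \<subseteq> I j" if "i \<le> j" for i j using chain that by (cases "i = j") auto
  have sg: "subgroup (I i) (add_monoid (regular_module K))" for i
    using sub by (simp add: submodule_def)
  let ?U = "\<Union>i. I i"
  have "subgroup ?U (add_monoid (regular_module K))"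
  proof
    fix x y assume "x \<in> ?U" "y \<in> ?U"
    then obtain i j where ij: "x \<in> I i" "y \<in> I j" by blast
    then have "x \<in> I (max i j)" "y \<in> I (max i j)"
      using mono[of i "max i j"] mono[of j "max i j"] by auto
    then show "x \<otimes>\<^bsub>add_monoid (regular_module K)\<^esub> y \<in> ?U"
      using subgroup.m_closed[OF sg] by blast
  next
    show "?U \<subseteq> carrier (add_monoid (regular_module K))" using subgroup.subset[OF sg] by blast
    show "\<one>\<^bsub>add_monoid (regular_module K)\<^esub> \<in> ?U" using subgroup.one_closed[OF sg] by blast
    show "inv\<^bsub>add_monoid (regular_module K)\<^esub> x \<in> ?U" if "x \<in> ?U" for x
      using subgroup.m_inv_closed[OF sg] that by blast
  qed
  then have "submodule ?U K (regular_module K)"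
    using submodule.smult_closed[OF sub] by (auto intro!: submodule.intro submodule_axioms.intro)
  then obtain A where A: "finite A" "A \<subseteq> carrier K" and U: "?U = submodule_generated K (regular_module K) A"
    using left_ideal_fin_gen[OF \<open>submodule ?U K _\<close>] by (elim exE conjE)
  have "A \<subseteq> ?U" unfolding U by (auto simp: submodule_generated_def)
  with A(1) have "\<exists>i. A \<subseteq> I i"
  proof induction
    case (insert a A)
    then obtain i j where ij: "A \<subseteq> I i" "a \<in> I j" by blast
    then have "insert a A \<subseteq> I (max i j)"
      using mono[of i "max i j"] mono[of j "max i j"] by auto
    then show ?case ..
  qed simp
  then obtain i where "A \<subseteq> I i" ..
  then have "?U \<subseteq> I i" unfolding U submodule_generated_def using sub by blast
  then have "I i = I (Suc i)" using chain[of i "Suc i"] by blast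
  then show ?thesis by blast
qed

section \<open>Groebner bases for families of coefficient functions\<close>

text \<open>\<open>T U\<close> serves as a finite set of monomials at \<open>U\<close>, ordered by
  \<open>key\<close>; the maps in \<open>Mor\<close> carry monomials between objects and respect the
  order. \<open>wqo\<close> supplies finite bases of leading monomials.\<close>

locale ordered_shapes = left_noetherian_ring K
  for K :: "('k, 'p) ring_scheme" (structure) +
  fixes Ob :: "'o set" and T :: "'o \<Rightarrow> 't set" and key :: "'o \<Rightarrow> 't \<Rightarrow> 'w :: linorder"
    and Mor :: "'o \<Rightarrow> 'o \<Rightarrow> ('t \<Rightarrow> 't) set"
  assumes finite_T: "U \<in> Ob \<Longrightarrow> finite (T U)"
    and inj_key: "U \<in> Ob \<Longrightarrow> inj_on (key U) (T U)"
    and Mor_closed: "\<lbrakk>U \<in> Ob; V \<in> Ob; a \<in> Mor U V; t \<in> T U\<rbrakk> \<Longrightarrow> a t \<in> T V"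
    and Mor_mono: "\<lbrakk>U \<in> Ob; V \<in> Ob; a \<in> Mor U V; t \<in> T U; u \<in> T U; key U t < key U u\<rbrakk> \<Longrightarrow>
      key V (a t) < key V (a u)"
    and wqo: "almost_full (\<lambda>x y. \<exists>a\<in>Mor (fst x) (fst y). a (snd x) = snd y) (SIGMA U:Ob. T U)"
begin

text \<open>Extension by zero along \<open>a\<close>, which is injective by \<open>Mor_inj\<close>.
  Functions on the finite set \<open>T V\<close> stand for elements of the free module on
  it.\<close>

definition push :: "'o \<Rightarrow> 'o \<Rightarrow> ('t \<Rightarrow> 't) \<Rightarrow> ('t \<Rightarrow> 'k) \<Rightarrow> 't \<Rightarrow> 'k"
  where "push U V a c = (\<lambda>t\<in>T V. if t \<in> a ` T U then c (inv_into (T U) a t) else \<zero>)"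

text \<open>A submodule of the functor that sends \<open>U\<close> to the free module on
  \<open>T U\<close>, with sums and multiples combined into one closure condition.\<close>

definition coeff_family :: "('o \<Rightarrow> ('t \<Rightarrow> 'k) set) \<Rightarrow> bool"
  where "coeff_family N \<longleftrightarrow>
    (\<forall>U\<in>Ob. N U \<subseteq> T U \<rightarrow>\<^sub>E carrier K \<and> (\<lambda>t\<in>T U. \<zero>) \<in> N U \<and>
      (\<forall>c\<in>N U. \<forall>d\<in>N U. \<forall>r\<in>carrier K. (\<lambda>t\<in>T U. c t \<oplus> r \<otimes> d t) \<in> N U)) \<and>
    (\<forall>U\<in>Ob. \<forall>V\<in>Ob. \<forall>a\<in>Mor U V. \<forall>c\<in>N U. push U V a c \<in> N V)"

text \<open>The value at \<open>t\<close> may be zero; this is what makes the set a left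
  ideal.\<close>

definition lead_ideal :: "('o \<Rightarrow> ('t \<Rightarrow> 'k) set) \<Rightarrow> 'o \<Rightarrow> 't \<Rightarrow> 'k set"
  where "lead_ideal N U t = {c t |c. c \<in> N U \<and> (\<forall>u\<in>T U. key U t < key U u \<longrightarrow> c u = \<zero>)}"

lemma Mor_inj:
  assumes "U \<in> Ob" "V \<in> Ob" "a \<in> Mor U V"
  shows "inj_on a (T U)"
proof (rule inj_onI, rule ccontr)
  fix t u assume t: "t \<in> T U" "u \<in> T U" "a t = a u" "t \<noteq> u"
  then have "key U t < key U u \<or> key U u < key U t"
    using inj_key[OF assms(1)] by (metis inj_on_def neqE)
  then show False using Mor_mono[OF assms] t by fastforce
qed

lemma push_image:
  assumes "U \<in> Ob" "V \<in> Ob" "a \<in> Mor U V" "t \<in> T U"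
  shows "push U V a c (a t) = c t"
  using assms Mor_inj[OF assms(1-3)] Mor_closed[OF assms] by (simp add: push_def)

lemma coeff_familyD:
  assumes "coeff_family N" "U \<in> Ob"
  shows "c \<in> N U \<Longrightarrow> t \<in> T U \<Longrightarrow> c t \<in> carrier K"
    and "c \<in> N U \<Longrightarrow> c \<in> extensional (T U)"
    and "(\<lambda>t\<in>T U. \<zero>) \<in> N U"
    and "\<lbrakk>c \<in> N U; d \<in> N U; r \<in> carrier K\<rbrakk> \<Longrightarrow> (\<lambda>t\<in>T U. c t \<oplus> r \<otimes> d t) \<in> N U"
    and "\<lbrakk>c \<in> N U; V \<in> Ob; a \<in> Mor U V\<rbrakk> \<Longrightarrow> push U V a c \<in> N V"
proof -
  have N: "N U \<subseteq> T U \<rightarrow>\<^sub>E carrier K" "(\<lambda>t\<in>T U. \<zero>) \<in> N U"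
    "\<forall>c\<in>N U. \<forall>d\<in>N U. \<forall>r\<in>carrier K. (\<lambda>t\<in>T U. c t \<oplus> r \<otimes> d t) \<in> N U"
    "\<forall>V\<in>Ob. \<forall>a\<in>Mor U V. \<forall>c\<in>N U. push U V a c \<in> N V"
    using assms unfolding coeff_family_def by blast+
  show "c \<in> N U \<Longrightarrow> t \<in> T U \<Longrightarrow> c t \<in> carrier K" "c \<in> N U \<Longrightarrow> c \<in> extensional (T U)"
    using N(1) by (meson PiE_mem subsetD, meson PiE_iff subsetD)
  show "(\<lambda>t\<in>T U. \<zero>) \<in> N U" "\<lbrakk>c \<in> N U; d \<in> N U; r \<in> carrier K\<rbrakk> \<Longrightarrow> (\<lambda>t\<in>T U. c t \<oplus> r \<otimes> d t) \<in> N U"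
    "\<lbrakk>c \<in> N U; V \<in> Ob; a \<in> Mor U V\<rbrakk> \<Longrightarrow> push U V a c \<in> N V"
    using N(2-4) by blast+
qed

lemma lead_ideal_submodule:
  assumes N: "coeff_family N" and U: "U \<in> Ob" and t: "t \<in> T U"
  shows "submodule (lead_ideal N U t) K (regular_module K)"
proof -
  note D = coeff_familyD[OF N U]
  have comb: "x \<oplus> r \<otimes> y \<in> lead_ideal N U t"
    if x: "x \<in> lead_ideal N U t" and y: "y \<in> lead_ideal N U t" and r: "r \<in> carrier K" for x y r
  proof -
    obtain c d where c: "c \<in> N U" "x = c t" "\<forall>u\<in>T U. key U t < key U u \<longrightarrow> c u = \<zero>"
      and d: "d \<in> N U" "y = d t" "\<forall>u\<in>T U. key U t < key U u \<longrightarrow> d u = \<zero>"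
      using x y unfolding lead_ideal_def by auto
    show ?thesis unfolding lead_ideal_def
      using c d r t D(4)[OF c(1) d(1) r] by (intro CollectI exI[of _ "\<lambda>t\<in>T U. c t \<oplus> r \<otimes> d t"]) auto
  qed
  have carr: "x \<in> carrier K" if "x \<in> lead_ideal N U t" for x
    using that D(1) t by (auto simp: lead_ideal_def)
  have zero: "\<zero> \<in> lead_ideal N U t" unfolding lead_ideal_def
    using D(3) t by (intro CollectI exI[of _ "\<lambda>t\<in>T U. \<zero>"]) auto
  have smult: "r \<otimes> x \<in> lead_ideal N U t" if "r \<in> carrier K" "x \<in> lead_ideal N U t" for r x
    using comb[OF zero that(2,1)] carr[OF that(2)] that(1) by simp
  have add: "x \<oplus> y \<in> lead_ideal N U t" if "x \<in> lead_ideal N U t" "y \<in> lead_ideal N U t" for x y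
    using comb[OF that one_closed] carr[OF that(2)] by simp
  \<comment> \<open>Negatives come from the scalar \<open>\<ominus> \<one>\<close>, and closure
    under them gives a subgroup.\<close>
  have neg: "\<ominus> x \<in> lead_ideal N U t" if "x \<in> lead_ideal N U t" for x
    using smult[of "\<ominus> \<one>" x] carr[OF that] that by (simp add: l_minus)
  have inv: "inv\<^bsub>add_monoid (regular_module K)\<^esub> x = \<ominus> x" for x
    by (simp add: regular_module_def a_inv_def m_inv_def)
  have "subgroup (lead_ideal N U t) (add_monoid (regular_module K))"
    using carr zero add neg by (auto simp: subgroup_def inv) (auto simp: regular_module_def)
  then show ?thesis
    using smult by (auto intro!: submodule.intro submodule_axioms.intro simp: regular_module_def)
qed

text \<open>Pushing forward keeps the coefficient, and strict monotonicity of \<open>a\<close> keeps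
  everything above \<open>a t\<close> equal to zero.\<close>

lemma lead_ideal_mono:
  assumes N: "coeff_family N" and U: "U \<in> Ob" "V \<in> Ob" and a: "a \<in> Mor U V" and t: "t \<in> T U"
  shows "lead_ideal N U t \<subseteq> lead_ideal N V (a t)"
proof
  fix x assume "x \<in> lead_ideal N U t"
  then obtain c where c: "c \<in> N U" "x = c t" "\<forall>u\<in>T U. key U t < key U u \<longrightarrow> c u = \<zero>"
    by (auto simp: lead_ideal_def)
  have "push U V a c u = \<zero>" if u: "u \<in> T V" "key V (a t) < key V u" for u
  proof (cases "u \<in> a ` T U")
    case True
    then obtain s where s: "s \<in> T U" "u = a s" by blast
    have "key U t < key U s"
      using Mor_mono[OF U a s(1) t] u(2) s inj_key[OF U(1)] t
      by (metis inj_onD less_asym less_irrefl neqE)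
    then show ?thesis using push_image[OF U a s(1)] c(3) s by simp
  qed (use u in \<open>simp add: push_def\<close>)
  then show "x \<in> lead_ideal N V (a t)" unfolding lead_ideal_def
    using c(2) coeff_familyD(5)[OF N U(1) c(1) U(2) a] push_image[OF U a t]
    by (intro CollectI exI[of _ "push U V a c"]) auto
qed

text \<open>Along a subsequence linked by morphisms the leading ideals increase, so the Noetherian
  condition makes two of them equal.\<close>

lemma almost_full_lead_ideal:
  assumes N: "coeff_family N"
  shows "almost_full (\<lambda>x y. (\<exists>a\<in>Mor (fst x) (fst y). a (snd x) = snd y) \<and>
    lead_ideal N (fst x) (snd x) = lead_ideal N (fst y) (snd y)) (SIGMA U:Ob. T U)"
  unfolding almost_full_def
proof (intro allI impI)
  fix f :: "nat \<Rightarrow> 'o \<times> 't" assume "range f \<subseteq> (SIGMA U:Ob. T U)"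
  then have f: "f i \<in> (SIGMA U:Ob. T U)" for i by blast
  then have f': "fst (f i) \<in> Ob" "snd (f i) \<in> T (fst (f i))" for i
    by (metis SigmaE fst_conv snd_conv)+
  let ?I = "\<lambda>x. lead_ideal N (fst x) (snd x)"
  obtain \<phi> :: "nat \<Rightarrow> nat" where \<phi>: "strict_mono \<phi>"
    and m: "\<And>i j. i < j \<Longrightarrow> \<exists>a\<in>Mor (fst (f (\<phi> i))) (fst (f (\<phi> j))). a (snd (f (\<phi> i))) = snd (f (\<phi> j))"
    by (rule almost_full_subseq[OF wqo, of f, OF f]) (rule that)
  obtain i j where ij: "i < j" "?I (f (\<phi> i)) = ?I (f (\<phi> j))"
  proof -
    have 1: "submodule (?I (f (\<phi> i))) K (regular_module K)" for i
      using f' by (intro lead_ideal_submodule[OF N])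
    have 2: "?I (f (\<phi> i)) \<subseteq> ?I (f (\<phi> j))" if "i < j" for i j
      using m[OF that] lead_ideal_mono[OF N f'(1) f'(1) _ f'(2)] by metis
    show thesis using ideal_chain_repeats[of "\<lambda>i. ?I (f (\<phi> i))", OF 1 2] that by blast
  qed
  then show "\<exists>i j. i < j \<and> (\<exists>a\<in>Mor (fst (f i)) (fst (f j)). a (snd (f i)) = snd (f j)) \<and> ?I (f i) = ?I (f j)"
    using m[OF ij(1)] ij(2) strict_monoD[OF \<phi> ij(1)] by (intro exI[of _ "\<phi> i"] exI[of _ "\<phi> j"]) simp
qed

text \<open>\<open>F\<close> consists of the objects of a finite basis of monomials. Over them
  \<open>L\<close> and \<open>N\<close> have the same leading ideals, these ideals propagate to all
  monomials, and subtracting elements of \<open>L\<close> reduces every element of \<open>N\<close>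
  to zero.\<close>

theorem coeff_family_determined:
  assumes N: "coeff_family N"
  obtains F where "finite F" "F \<subseteq> Ob"
    "\<And>L U. \<lbrakk>coeff_family L; \<And>V. V \<in> Ob \<Longrightarrow> L V \<subseteq> N V; \<And>V. V \<in> F \<Longrightarrow> L V = N V; U \<in> Ob\<rbrakk> \<Longrightarrow> L U = N U"
proof -
  obtain G where G: "finite G" "G \<subseteq> (SIGMA U:Ob. T U)"
    and basis: "\<And>y. y \<in> (SIGMA U:Ob. T U) \<Longrightarrow> \<exists>x\<in>G. (\<exists>a\<in>Mor (fst x) (fst y). a (snd x) = snd y) \<and>
      lead_ideal N (fst x) (snd x) = lead_ideal N (fst y) (snd y)"
    using almost_full_finite_basis[OF almost_full_lead_ideal[OF N]] by blast
  show thesis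
  proof (rule that)
    show "finite (fst ` G)" "fst ` G \<subseteq> Ob" using G by auto
    fix L U assume L: "coeff_family L" and LN: "\<And>V. V \<in> Ob \<Longrightarrow> L V \<subseteq> N V"
      and F: "\<And>V. V \<in> fst ` G \<Longrightarrow> L V = N V" and U: "U \<in> Ob"
    note D = coeff_familyD[OF N U] and LD = coeff_familyD[OF L U]
    \<comment> \<open>Division with remainder, by induction on a set that contains the support and
      is closed downwards for \<open>key\<close>.\<close>
    have "\<forall>c\<in>N U. {t\<in>T U. c t \<noteq> \<zero>} \<subseteq> S \<longrightarrow> c \<in> L U"
      if "finite S" "S \<subseteq> T U" "\<And>s t. s \<in> S \<Longrightarrow> t \<in> T U \<Longrightarrow> key U t < key U s \<Longrightarrow> t \<in> S" for S
      using that
    proof (induction "card S" arbitrary: S)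
      case 0
      then have "c = (\<lambda>t\<in>T U. \<zero>)" if "c \<in> N U" "{t\<in>T U. c t \<noteq> \<zero>} \<subseteq> S" for c
        using that D(2)[OF that(1)] by (auto intro: extensionalityI[where A="T U"])
      then show ?case using LD(3) by blast
    next
      case (Suc n)
      have "S \<noteq> {}" using Suc(2) by auto
      have fk: "finite (key U ` S)" "key U ` S \<noteq> {}" using Suc(3) \<open>S \<noteq> {}\<close> by auto
      then obtain t where t: "t \<in> S" "key U t = Max (key U ` S)" using Max_in by (metis imageE)
      have tT: "t \<in> T U" using t(1) Suc(4) by blast
      have tmax: "key U s \<le> key U t" if "s \<in> S" for s using fk that t(2) by simp
      have low: "\<forall>c\<in>N U. {t\<in>T U. c t \<noteq> \<zero>} \<subseteq> S - {t} \<longrightarrow> c \<in> L U"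
      proof (rule Suc(1))
        show "n = card (S - {t})" using Suc(2,3) t(1) by simp
        fix s u assume "s \<in> S - {t}" "u \<in> T U" "key U u < key U s"
        then show "u \<in> S - {t}" using Suc(5)[of s u] tmax[of s] by auto
      qed (use Suc(3,4) in auto)
      show ?case
      proof (intro ballI impI)
        fix c assume c: "c \<in> N U" "{t\<in>T U. c t \<noteq> \<zero>} \<subseteq> S"
        obtain x a where x: "x \<in> G" "a \<in> Mor (fst x) U" "a (snd x) = t"
          and I: "lead_ideal N (fst x) (snd x) = lead_ideal N U t"
          using basis[of "(U, t)"] U tT by auto
        have xT: "fst x \<in> Ob" "snd x \<in> T (fst x)" using x(1) G(2) by auto
        have "\<forall>u\<in>T U. key U t < key U u \<longrightarrow> c u = \<zero>" using c(2) tmax by fastforce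
        \<comment> \<open>The basis element \<open>x\<close> has the same leading ideal for
          \<open>N\<close> as \<open>t\<close>, and over its object \<open>L\<close> equals
          \<open>N\<close>; monotonicity brings the coefficient into the leading ideal of
          \<open>L\<close> at \<open>t\<close>.\<close>
        then have "c t \<in> lead_ideal N U t" using c(1) by (auto simp: lead_ideal_def)
        also have "\<dots> = lead_ideal L (fst x) (snd x)"
          using I F[of "fst x"] x(1) by (simp add: lead_ideal_def)
        also have "\<dots> \<subseteq> lead_ideal L U t" using lead_ideal_mono[OF L xT(1) U x(2) xT(2)] x(3) by simp
        finally obtain d where d: "d \<in> L U" "d t = c t" "\<forall>u\<in>T U. key U t < key U u \<longrightarrow> d u = \<zero>"
          unfolding lead_ideal_def by auto
        note cK = D(1)[OF c(1)] and dK = LD(1)[OF d(1)]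
        \<comment> \<open>Subtracting \<open>d\<close> cancels the coefficient at \<open>t\<close>,
          so the remainder is supported in \<open>S - {t}\<close>.\<close>
        let ?c = "\<lambda>t\<in>T U. c t \<oplus> (\<ominus> \<one>) \<otimes> d t"
        have "?c \<in> N U" using D(4)[OF c(1), of d "\<ominus> \<one>"] d(1) LN[OF U] by blast
        moreover have "?c u = \<zero>" if u: "u \<in> T U" "u \<notin> S - {t}" for u
        proof (cases "u = t")
          case True
          then show ?thesis using d(2) cK[OF tT] tT by (simp add: l_minus r_neg)
        next
          case False
          then have "c u = \<zero>" using c(2) u by blast
          moreover have "key U t < key U u"
          proof (rule ccontr)
            assume "\<not> ?thesis"
            then have "key U u < key U t" using False inj_key[OF U] u(1) tT by (metis inj_onD neqE)
            then show False using Suc(5)[OF t(1) u(1)] u(2) False by blast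
          qed
          ultimately show ?thesis using d(3) u(1) by simp
        qed
        ultimately have "?c \<in> L U" using low by blast
        from LD(4)[OF this d(1) one_closed]
        have "(\<lambda>t\<in>T U. ?c t \<oplus> \<one> \<otimes> d t) \<in> L U" .
        moreover have "(\<lambda>t\<in>T U. ?c t \<oplus> \<one> \<otimes> d t) = c"
          by (rule extensionalityI[where A="T U"])
            (use D(2)[OF c(1)] cK dK in \<open>auto simp: l_minus a_assoc l_neg\<close>)
        ultimately show "c \<in> L U" by simp
      qed
    qed
    from this[of "T U"] have "N U \<subseteq> L U" using finite_T[OF U] by blast
    then show "L U = N U" using LN[OF U] by blast
  qed
qed

end


section \<open>Frames of orthogonal modules\<close>

text \<open>In a finite commutative group powers depend only on the exponent modulo the group order,
  so each fibre contributes its common value exactly once.\<close>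

lemma (in comm_group) finprod_eq_finprod_fibres:
  fixes n n' :: nat
  assumes fin: "finite (carrier G)"
    and \<sigma>: "\<And>k. k < n' \<Longrightarrow> \<sigma> k < n"
    and cnt: "\<And>p. p < n \<Longrightarrow> card {k. k < n' \<and> \<sigma> k = p} mod card (carrier G) = 1 mod card (carrier G)"
    and h: "\<And>p. p < n \<Longrightarrow> h p \<in> carrier G"
  shows "(\<Otimes>k\<in>{..<n'}. h (\<sigma> k)) = (\<Otimes>p\<in>{..<n}. h p)"
proof -
  let ?m = "card (carrier G)"
  have pow: "x [^] q = x [^] (q mod ?m)" if "x \<in> carrier G" for x and q :: nat
  proof -
    have "x [^] q = x [^] (?m * (q div ?m) + q mod ?m)" by simp
    also have "\<dots> = (x [^] ?m) [^] (q div ?m) \<otimes> x [^] (q mod ?m)"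
      using that by (simp only: nat_pow_mult nat_pow_pow)
    finally show ?thesis using that by (simp add: power_order_eq_one[OF fin])
  qed
  have "finite {k. k < n' \<and> \<sigma> k = p}" for p by (rule finite_subset[of _ "{..<n'}"]) auto
  note fib = this
  have "(\<Otimes>k\<in>{..<n'}. h (\<sigma> k)) = (\<Otimes>k\<in>(\<Union>p\<in>{..<n}. {k. k < n' \<and> \<sigma> k = p}). h (\<sigma> k))"
    using \<sigma> by (intro arg_cong[where f="finprod G _"]) auto
  also have "\<dots> = (\<Otimes>p\<in>{..<n}. \<Otimes>k\<in>{k. k < n' \<and> \<sigma> k = p}. h (\<sigma> k))"
    using h by (intro finprod_UN_disjoint) (auto simp: pairwise_def disjnt_def fib)
  also have "\<dots> = (\<Otimes>p\<in>{..<n}. h p)"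
  proof (rule finprod_cong')
    fix p assume "p \<in> {..<n}"
    then have p: "p < n" by simp
    have "(\<Otimes>k\<in>{k. k < n' \<and> \<sigma> k = p}. h (\<sigma> k)) = (\<Otimes>k\<in>{k. k < n' \<and> \<sigma> k = p}. h p)"
      using h p by (intro finprod_cong') auto
    also have "\<dots> = h p [^] card {k. k < n' \<and> \<sigma> k = p}"
      using h p by (intro finprod_const) auto
    also have "\<dots> = h p [^] (1::nat)"
      using pow[OF h[OF p]] cnt[OF p] by metis
    finally show "(\<Otimes>k\<in>{k. k < n' \<and> \<sigma> k = p}. h (\<sigma> k)) = h p" using h p by simp
  qed (use h in auto)
  finally show ?thesis .
qed

section \<open>Nilpotent elements and idempotent powers\<close>

definition (in cring) nilpotent :: "'a \<Rightarrow> bool"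
  where "nilpotent a \<longleftrightarrow> (\<exists>n::nat. a [^] n = \<zero>)"

context cring
begin

lemma nilpotent_mult:
  assumes "a \<in> carrier R" "s \<in> carrier R" "nilpotent a"
  shows "nilpotent (s \<otimes> a)"
  using assms unfolding nilpotent_def by (metis nat_pow_distrib nat_pow_closed r_null)

lemma nilpotent_add:
  assumes a: "a \<in> carrier R" "b \<in> carrier R" "nilpotent a" "nilpotent b"
  shows "nilpotent (a \<oplus> b)"
proof -
  \<comment> \<open>A multiplier \<open>x\<close> replaces the binomial expansion: peeling off one
    factor \<open>a \<oplus> b\<close> moves \<open>a\<close> or \<open>b\<close> into
    \<open>x\<close> and lowers one exponent.\<close>
  have aux: "x \<otimes> (a \<oplus> b) [^] k = \<zero>"
    if "n + m = k" "x \<in> carrier R" "x \<otimes> a [^] n = \<zero>" "x \<otimes> b [^] m = \<zero>" for x and n m k :: nat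
    using that
  proof (induction k arbitrary: x n m)
    case 0
    then show ?case by simp
  next
    case (Suc k)
    show ?case
    proof (cases "n = 0 \<or> m = 0")
      case True
      then have "x = \<zero>" using Suc.prems by auto
      then show ?thesis using a by simp
    next
      case False
      then obtain n' m' where nm: "n = Suc n'" "m = Suc m'" by (metis not0_implies_Suc)
      have 1: "x \<otimes> a \<otimes> (a \<oplus> b) [^] k = \<zero>"
      proof (rule Suc.IH[of n' m])
        show "x \<otimes> a \<otimes> a [^] n' = \<zero>"
          using Suc.prems nm a nat_pow_Suc2[OF a(1), of n'] by (simp add: m_assoc del: nat_pow_Suc)
        have "x \<otimes> a \<otimes> b [^] m = a \<otimes> (x \<otimes> b [^] m)"
          using Suc.prems(2) a by (simp add: m_ac)
        then show "x \<otimes> a \<otimes> b [^] m = \<zero>" using Suc.prems a by simp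
      qed (use Suc.prems nm a in auto)
      have 2: "x \<otimes> b \<otimes> (a \<oplus> b) [^] k = \<zero>"
      proof (rule Suc.IH[of n m'])
        show "x \<otimes> b \<otimes> b [^] m' = \<zero>"
          using Suc.prems nm a nat_pow_Suc2[OF a(2), of m'] by (simp add: m_assoc del: nat_pow_Suc)
        have "x \<otimes> b \<otimes> a [^] n = b \<otimes> (x \<otimes> a [^] n)"
          using Suc.prems(2) a by (simp add: m_ac)
        then show "x \<otimes> b \<otimes> a [^] n = \<zero>" using Suc.prems a by simp
      qed (use Suc.prems nm a in auto)
      have "x \<otimes> (a \<oplus> b) [^] Suc k = x \<otimes> ((a \<oplus> b) \<otimes> (a \<oplus> b) [^] k)"
        using a nat_pow_Suc2[of "a \<oplus> b" k] by simp
      also have "\<dots> = x \<otimes> a \<otimes> (a \<oplus> b) [^] k \<oplus> x \<otimes> b \<otimes> (a \<oplus> b) [^] k"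
        using a Suc.prems(2) by (simp add: l_distr r_distr m_assoc)
      finally show ?thesis using 1 2 by simp
    qed
  qed
  obtain n m :: nat where "a [^] n = \<zero>" "b [^] m = \<zero>" using a by (auto simp: nilpotent_def)
  then have "\<one> \<otimes> (a \<oplus> b) [^] (n + m) = \<zero>" using a by (intro aux) auto
  then show ?thesis using a by (auto simp: nilpotent_def)
qed

text \<open>The powers of \<open>a\<close> are eventually periodic. A positive exponent that is a
  multiple of the period and lies beyond the preperiod gives an idempotent.\<close>

lemma idempotent_power:
  assumes fin: "finite (carrier R)" and a: "a \<in> carrier R"
  obtains k :: nat where "k > 0" "a [^] k \<otimes> a [^] k = a [^] k"
proof -
  have "\<not> inj (\<lambda>i::nat. a [^] i)"
  proof
    assume "inj (\<lambda>i::nat. a [^] i)"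
    moreover have "range (\<lambda>i::nat. a [^] i) \<subseteq> carrier R" using a by auto
    ultimately show False using fin finite_imageD finite_subset infinite_UNIV_nat by metis
  qed
  then obtain i j :: nat where "i < j" "a [^] i = a [^] j"
    unfolding inj_def by (metis nat_neq_iff)
  then obtain p where p: "p > 0" "a [^] i = a [^] (i + p)"
    by (metis less_imp_add_positive)
  have step: "a [^] l = a [^] (l + p)" if "i \<le> l" for l
  proof -
    have "a [^] l = a [^] i \<otimes> a [^] (l - i)" using a that by (simp add: nat_pow_mult)
    also have "\<dots> = a [^] (i + p) \<otimes> a [^] (l - i)" using p by simp
    also have "\<dots> = a [^] (l + p)" using a that by (simp add: nat_pow_mult add.commute)
    finally show ?thesis .
  qed
  have steps: "a [^] l = a [^] (l + q * p)" if "i \<le> l" for l q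
  proof (induction q)
    case (Suc q)
    then show ?case using step[of "l + q * p"] that by (simp add: algebra_simps)
  qed simp
  have "i \<le> Suc i * p" using p(1) by (metis le_add2 le_trans mult_Suc mult_le_mono2 mult.right_neutral Suc_leI One_nat_def add.commute)
  then have "a [^] (Suc i * p) \<otimes> a [^] (Suc i * p) = a [^] (Suc i * p)"
    unfolding nat_pow_mult[OF a] by (rule steps[symmetric])
  then show thesis using p(1) by (intro that[of "Suc i * p"]) simp_all
qed

text \<open>If \<open>c\<close> is nilpotent and \<open>r \<otimes> c \<noteq> \<zero>\<close>, then \<open>r\<close> is not a multiple of \<open>r \<otimes> c\<close>, for
  \<open>r = r \<otimes> (c \<otimes> s)\<close> can be iterated.\<close>

lemma nilpotent_mult_ideal_card:
  assumes fin: "finite (carrier R)" and r: "r \<in> carrier R" "r \<noteq> \<zero>" and c: "c \<in> carrier R" "nilpotent c"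
  shows "card ((\<lambda>x. r \<otimes> c \<otimes> x) ` carrier R) < card ((\<lambda>x. r \<otimes> x) ` carrier R)"
proof (rule psubset_card_mono)
  show "finite ((\<lambda>x. r \<otimes> x) ` carrier R)" using fin by simp
  have "(\<lambda>x. r \<otimes> c \<otimes> x) ` carrier R \<subseteq> (\<lambda>x. r \<otimes> x) ` carrier R"
    using r c by (auto simp: m_assoc)
  moreover have "r \<notin> (\<lambda>x. r \<otimes> c \<otimes> x) ` carrier R"
  proof
    assume "r \<in> (\<lambda>x. r \<otimes> c \<otimes> x) ` carrier R"
    then obtain s where s: "s \<in> carrier R" "r = r \<otimes> c \<otimes> s" by blast
    have it: "r = r \<otimes> (s \<otimes> c) [^] n" for n :: nat
    proof (induction n)
      case (Suc n)
      have "r = r \<otimes> c \<otimes> s" by (rule s(2))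
      also have "\<dots> = (r \<otimes> (s \<otimes> c) [^] n) \<otimes> c \<otimes> s" using Suc by simp
      also have "\<dots> = r \<otimes> (s \<otimes> c) [^] Suc n" using r c s(1) by (simp add: m_ac)
      finally show ?case .
    qed (use r in simp)
    then show False using nilpotent_mult[OF c(1) s(1) c(2)] r by (auto simp: nilpotent_def) (metis r_null)
  qed
  moreover have "r \<in> (\<lambda>x. r \<otimes> x) ` carrier R" using r by (intro image_eqI[of _ _ \<one>]) auto
  ultimately show "(\<lambda>x. r \<otimes> c \<otimes> x) ` carrier R \<subset> (\<lambda>x. r \<otimes> x) ` carrier R" by blast
qed

end

lemma linear_maps_finsum:
  assumes f: "f \<in> linear_maps K E F" and E: "left_module K E" and F: "left_module K F"
    and "finite A" "\<And>i. i \<in> A \<Longrightarrow> h i \<in> carrier E"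
  shows "f (\<Oplus>\<^bsub>E\<^esub>i\<in>A. h i) = (\<Oplus>\<^bsub>F\<^esub>i\<in>A. f (h i))"
proof -
  interpret E: left_module K E by fact
  interpret F: left_module K F by fact
  show ?thesis using assms(4,5)
  proof (induction A)
    case empty
    then show ?case using linear_maps_zero[OF f E F] by simp
  next
    case (insert i A)
    then show ?case by (simp add: Pi_iff linear_mapsD[OF f])
  qed
qed

lemma regular_module_simps:
  "carrier (regular_module K) = carrier K" "\<zero>\<^bsub>regular_module K\<^esub> = \<zero>\<^bsub>K\<^esub>"
  "x \<oplus>\<^bsub>regular_module K\<^esub> y = x \<oplus>\<^bsub>K\<^esub> y" "x \<odot>\<^bsub>regular_module K\<^esub> y = x \<otimes>\<^bsub>K\<^esub> y"
  by (simp_all add: regular_module_def)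

section \<open>Forms, dual bases and orthogonal frames\<close>

locale orthogonal = module R V
  for R :: "('r, 'p) ring_scheme" (structure) and V :: "('r, 'v) module" +
  fixes B :: "'v \<Rightarrow> 'v \<Rightarrow> 'r"
  assumes orthogonal: "orthogonal_module R (V, B)"
begin

lemma form_linear:
  assumes "w \<in> carrier V"
  shows "(\<lambda>v\<in>carrier V. B v w) \<in> linear_maps R V (regular_module R)"
  using orthogonal assms by (simp add: orthogonal_module_def symmetric_bilinear_def)

lemma form_closed [simp, intro]: "\<lbrakk>v \<in> carrier V; w \<in> carrier V\<rbrakk> \<Longrightarrow> B v w \<in> carrier R"
  using linear_mapsD(1)[OF form_linear[of w], of v] by (simp add: regular_module_simps)

lemma form_sym: "\<lbrakk>v \<in> carrier V; w \<in> carrier V\<rbrakk> \<Longrightarrow> B v w = B w v"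
  using orthogonal by (simp add: orthogonal_module_def symmetric_bilinear_def)

lemma form_add:
  assumes "v \<in> carrier V" "v' \<in> carrier V" "w \<in> carrier V"
  shows "B (v \<oplus>\<^bsub>V\<^esub> v') w = B v w \<oplus> B v' w"
  using linear_mapsD(2)[OF form_linear[of w], of v v'] assms by (simp add: regular_module_simps)

lemma form_smult:
  assumes "a \<in> carrier R" "v \<in> carrier V" "w \<in> carrier V"
  shows "B (a \<odot>\<^bsub>V\<^esub> v) w = a \<otimes> B v w"
  using linear_mapsD(3)[OF form_linear[of w], of a v] assms by (simp add: regular_module_simps)

lemma form_zero: "w \<in> carrier V \<Longrightarrow> B \<zero>\<^bsub>V\<^esub> w = \<zero>"
  using form_smult[of \<zero> "\<zero>\<^bsub>V\<^esub>" w] by (simp add: smult_l_null)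

lemma form_finsum:
  assumes "finite A" "\<And>i. i \<in> A \<Longrightarrow> f i \<in> carrier V" "w \<in> carrier V"
  shows "B (\<Oplus>\<^bsub>V\<^esub>i\<in>A. f i) w = (\<Oplus>i\<in>A. B (f i) w)"
  using assms(1,2)
proof (induction A)
  case empty
  then show ?case using assms(3) form_zero by simp
next
  case (insert i A)
  then show ?case using assms(3) by (simp add: form_add Pi_iff)
qed

text \<open>The coordinate functions of a basis are linear by uniqueness of coordinates, and
  non-degeneracy represents them by vectors \<open>u i\<close>.\<close>

lemma dual_basis:
  obtains n e u where "\<And>i. i < (n::nat) \<Longrightarrow> e i \<in> carrier V" "\<And>i. i < n \<Longrightarrow> u i \<in> carrier V"
    "\<And>v. v \<in> carrier V \<Longrightarrow> v = (\<Oplus>\<^bsub>V\<^esub>i\<in>{..<n}. B v (u i) \<odot>\<^bsub>V\<^esub> e i)"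
proof -
  obtain n where "free_of_rank R V n" using orthogonal by (auto simp: orthogonal_module_def)
  then obtain e where e: "e \<in> {..<n} \<rightarrow> carrier V"
    and ex: "\<forall>v\<in>carrier V. \<exists>!c. c \<in> {..<n} \<rightarrow>\<^sub>E carrier R \<and> v = (\<Oplus>\<^bsub>V\<^esub>i\<in>{..<n}. c i \<odot>\<^bsub>V\<^esub> e i)"
    unfolding free_of_rank_def by blast
  define c where "c v = (THE c. c \<in> {..<n} \<rightarrow>\<^sub>E carrier R \<and> v = (\<Oplus>\<^bsub>V\<^esub>i\<in>{..<n}. c i \<odot>\<^bsub>V\<^esub> e i))" for v
  have c: "c v \<in> {..<n} \<rightarrow>\<^sub>E carrier R \<and> v = (\<Oplus>\<^bsub>V\<^esub>i\<in>{..<n}. c v i \<odot>\<^bsub>V\<^esub> e i)" if "v \<in> carrier V" for v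
    using theI'[OF ex[THEN bspec[OF _ that]]] by (simp only: c_def)
  have cR: "c v i \<in> carrier R" if "v \<in> carrier V" "i < n" for v i using c[OF that(1)] that(2) by auto
  have eV: "e i \<in> carrier V" if "i < n" for i using e that by auto
  have uniq: "c v = d" if "v \<in> carrier V" "d \<in> {..<n} \<rightarrow>\<^sub>E carrier R" "v = (\<Oplus>\<^bsub>V\<^esub>i\<in>{..<n}. d i \<odot>\<^bsub>V\<^esub> e i)" for v d
    unfolding c_def by (rule the1_equality[OF ex[THEN bspec[OF _ that(1)]]]) (use that in blast)
  have add: "c (v \<oplus>\<^bsub>V\<^esub> w) i = c v i \<oplus> c w i" if "v \<in> carrier V" "w \<in> carrier V" "i < n" for v w i
  proof -
    have "c (v \<oplus>\<^bsub>V\<^esub> w) = (\<lambda>i\<in>{..<n}. c v i \<oplus> c w i)"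
    proof (rule uniq)
      have "v \<oplus>\<^bsub>V\<^esub> w = (\<Oplus>\<^bsub>V\<^esub>i\<in>{..<n}. c v i \<odot>\<^bsub>V\<^esub> e i) \<oplus>\<^bsub>V\<^esub> (\<Oplus>\<^bsub>V\<^esub>i\<in>{..<n}. c w i \<odot>\<^bsub>V\<^esub> e i)"
        using c that by metis
      also have "\<dots> = (\<Oplus>\<^bsub>V\<^esub>i\<in>{..<n}. c v i \<odot>\<^bsub>V\<^esub> e i \<oplus>\<^bsub>V\<^esub> c w i \<odot>\<^bsub>V\<^esub> e i)"
        by (rule M.finsum_addf[symmetric]) (use cR eV that in auto)
      also have "\<dots> = (\<Oplus>\<^bsub>V\<^esub>i\<in>{..<n}. (\<lambda>i\<in>{..<n}. c v i \<oplus> c w i) i \<odot>\<^bsub>V\<^esub> e i)"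
        by (rule M.finsum_cong') (use cR eV that in \<open>auto simp: smult_l_distr\<close>)
      finally show "v \<oplus>\<^bsub>V\<^esub> w = \<dots>" .
    qed (use that cR in auto)
    then show ?thesis using that by simp
  qed
  have smult: "c (a \<odot>\<^bsub>V\<^esub> v) i = a \<otimes> c v i" if "a \<in> carrier R" "v \<in> carrier V" "i < n" for a v i
  proof -
    have "c (a \<odot>\<^bsub>V\<^esub> v) = (\<lambda>i\<in>{..<n}. a \<otimes> c v i)"
    proof (rule uniq)
      have "a \<odot>\<^bsub>V\<^esub> v = a \<odot>\<^bsub>V\<^esub> (\<Oplus>\<^bsub>V\<^esub>i\<in>{..<n}. c v i \<odot>\<^bsub>V\<^esub> e i)" using c that by metis
      also have "\<dots> = (\<Oplus>\<^bsub>V\<^esub>i\<in>{..<n}. a \<odot>\<^bsub>V\<^esub> (c v i \<odot>\<^bsub>V\<^esub> e i))"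
        by (rule finsum_smult_ldistr) (use cR eV that in auto)
      also have "\<dots> = (\<Oplus>\<^bsub>V\<^esub>i\<in>{..<n}. (\<lambda>i\<in>{..<n}. a \<otimes> c v i) i \<odot>\<^bsub>V\<^esub> e i)"
        by (rule M.finsum_cong') (use cR eV that in \<open>auto simp: smult_assoc1\<close>)
      finally show "a \<odot>\<^bsub>V\<^esub> v = \<dots>" .
    qed (use that cR in auto)
    then show ?thesis using that by simp
  qed
  have "\<exists>u\<in>carrier V. \<forall>v\<in>carrier V. B v u = c v i" if i: "i < n" for i
  proof -
    have "(\<lambda>v\<in>carrier V. c v i) \<in> linear_maps R V (regular_module R)"
      by (rule linear_mapsI) (use i cR add smult in \<open>auto simp: regular_module_simps\<close>)
    then have "(\<lambda>v\<in>carrier V. c v i) \<in> (\<lambda>v. \<lambda>w\<in>carrier V. B v w) ` carrier V"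
      using orthogonal by (simp add: orthogonal_module_def nondegenerate_def bij_betw_def)
    then obtain u where u: "u \<in> carrier V" "(\<lambda>v\<in>carrier V. c v i) = (\<lambda>w\<in>carrier V. B u w)" by blast
    have "B v u = c v i" if "v \<in> carrier V" for v
      using fun_cong[OF u(2), of v] that form_sym[OF that u(1)] by simp
    then show ?thesis using u(1) by blast
  qed
  then obtain u where u: "\<And>i. i < n \<Longrightarrow> u i \<in> carrier V" "\<And>i v. i < n \<Longrightarrow> v \<in> carrier V \<Longrightarrow> B v (u i) = c v i"
    by metis
  have "v = (\<Oplus>\<^bsub>V\<^esub>i\<in>{..<n}. B v (u i) \<odot>\<^bsub>V\<^esub> e i)" if v: "v \<in> carrier V" for v
  proof -
    have "(\<Oplus>\<^bsub>V\<^esub>i\<in>{..<n}. B v (u i) \<odot>\<^bsub>V\<^esub> e i) = (\<Oplus>\<^bsub>V\<^esub>i\<in>{..<n}. c v i \<odot>\<^bsub>V\<^esub> e i)"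
      by (rule M.finsum_cong') (use u v cR eV in auto)
    then show ?thesis using c[OF v] by simp
  qed
  with eV u(1) show thesis by (rule that)
qed

lemma finite_carrier:
  assumes "finite (carrier R)"
  shows "finite (carrier V)"
proof -
  obtain n e u where eu: "\<And>i. i < (n::nat) \<Longrightarrow> e i \<in> carrier V" "\<And>i. i < n \<Longrightarrow> u i \<in> carrier V"
    "\<And>v. v \<in> carrier V \<Longrightarrow> v = (\<Oplus>\<^bsub>V\<^esub>i\<in>{..<n}. B v (u i) \<odot>\<^bsub>V\<^esub> e i)"
    by (rule dual_basis) (rule that)
  have "carrier V \<subseteq> (\<lambda>c. \<Oplus>\<^bsub>V\<^esub>i\<in>{..<n}. c i \<odot>\<^bsub>V\<^esub> e i) ` ({..<n} \<rightarrow>\<^sub>E carrier R)"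
  proof
    fix v assume v: "v \<in> carrier V"
    have "(\<Oplus>\<^bsub>V\<^esub>i\<in>{..<n}. B v (u i) \<odot>\<^bsub>V\<^esub> e i) = (\<Oplus>\<^bsub>V\<^esub>i\<in>{..<n}. (\<lambda>i\<in>{..<n}. B v (u i)) i \<odot>\<^bsub>V\<^esub> e i)"
      by (rule M.finsum_cong') (use eu v in auto)
    then show "v \<in> (\<lambda>c. \<Oplus>\<^bsub>V\<^esub>i\<in>{..<n}. c i \<odot>\<^bsub>V\<^esub> e i) ` ({..<n} \<rightarrow>\<^sub>E carrier R)"
      using eu(3)[OF v] by (intro image_eqI[of _ _ "\<lambda>i\<in>{..<n}. B v (u i)"]) (use eu v in auto)
  qed
  then show ?thesis using assms by (meson finite_PiE finite_imageI finite_lessThan finite_subset)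
qed

text \<open>\<open>b i\<close> stands in for the inverse of \<open>B (v i) (v i)\<close>, which need
  not be a unit: their product only has to act as one on the values of the form at
  \<open>v i\<close>.\<close>

definition orth_frame :: "nat \<Rightarrow> (nat \<Rightarrow> 'v) \<Rightarrow> (nat \<Rightarrow> 'r) \<Rightarrow> bool"
  where "orth_frame n v b \<longleftrightarrow> (\<forall>i<n. v i \<in> carrier V \<and> b i \<in> carrier R) \<and>
    (\<forall>i<n. \<forall>j<n. i \<noteq> j \<longrightarrow> B (v i) (v j) = \<zero>) \<and>
    (\<forall>i<n. \<forall>w\<in>carrier V. b i \<otimes> B w (v i) \<otimes> B (v i) (v i) = B w (v i))"

definition frame_proj :: "nat \<Rightarrow> (nat \<Rightarrow> 'v) \<Rightarrow> (nat \<Rightarrow> 'r) \<Rightarrow> 'v \<Rightarrow> 'v"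
  where "frame_proj n v b w = (\<Oplus>\<^bsub>V\<^esub>i\<in>{..<n}. (b i \<otimes> B w (v i)) \<odot>\<^bsub>V\<^esub> v i)"

definition frame_compl :: "nat \<Rightarrow> (nat \<Rightarrow> 'v) \<Rightarrow> 'v set"
  where "frame_compl n v = {w \<in> carrier V. \<forall>i<n. B w (v i) = \<zero>}"

lemma orth_frameD:
  assumes "orth_frame n v b" "i < n"
  shows "v i \<in> carrier V" "b i \<in> carrier R"
    and "\<lbrakk>j < n; i \<noteq> j\<rbrakk> \<Longrightarrow> B (v i) (v j) = \<zero>"
    and "w \<in> carrier V \<Longrightarrow> b i \<otimes> B w (v i) \<otimes> B (v i) (v i) = B w (v i)"
  using assms by (auto simp: orth_frame_def)

lemma form_orth_combination:
  assumes F: "orth_frame n v b" and c: "\<And>i. i < n \<Longrightarrow> c i \<in> carrier R" and j: "j < n"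
  shows "B (\<Oplus>\<^bsub>V\<^esub>i\<in>{..<n}. c i \<odot>\<^bsub>V\<^esub> v i) (v j) = c j \<otimes> B (v j) (v j)"
proof -
  note D = orth_frameD[OF F]
  have "B (\<Oplus>\<^bsub>V\<^esub>i\<in>{..<n}. c i \<odot>\<^bsub>V\<^esub> v i) (v j) = (\<Oplus>i\<in>{..<n}. B (c i \<odot>\<^bsub>V\<^esub> v i) (v j))"
    by (rule form_finsum) (use D c j in auto)
  also have "\<dots> = (\<Oplus>i\<in>{..<n}. if j = i then c i \<otimes> B (v i) (v i) else \<zero>)"
    by (rule R.finsum_cong') (use D c j in \<open>auto simp: form_smult\<close>)
  also have "\<dots> = c j \<otimes> B (v j) (v j)"
    by (rule R.finsum_singleton) (use D c j in auto)
  finally show ?thesis .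
qed

lemma frame_proj_closed:
  assumes "orth_frame n v b" "w \<in> carrier V"
  shows "frame_proj n v b w \<in> carrier V"
  unfolding frame_proj_def using orth_frameD[OF assms(1)] assms(2) by (intro M.finsum_closed) auto

lemma form_frame_proj:
  assumes F: "orth_frame n v b" and w: "w \<in> carrier V" and j: "j < n"
  shows "B (frame_proj n v b w) (v j) = B w (v j)"
  unfolding frame_proj_def using orth_frameD[OF F] w j
  by (subst form_orth_combination[OF F]) auto

lemma form_minus:
  assumes "v \<in> carrier V" "v' \<in> carrier V" "w \<in> carrier V"
  shows "B (v \<ominus>\<^bsub>V\<^esub> v') w = B v w \<ominus> B v' w"
proof -
  have "B (\<ominus>\<^bsub>V\<^esub> v') w \<oplus> B v' w = \<zero>"
    using form_add[of "\<ominus>\<^bsub>V\<^esub> v'" v' w] assms by (simp add: M.l_neg form_zero)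
  then have "B (\<ominus>\<^bsub>V\<^esub> v') w = \<ominus> B v' w" using assms by (simp add: R.minus_equality)
  then show ?thesis using assms by (simp add: a_minus_def form_add)
qed

lemma minus_frame_proj:
  assumes F: "orth_frame n v b" and w: "w \<in> carrier V"
  shows "w \<ominus>\<^bsub>V\<^esub> frame_proj n v b w \<in> frame_compl n v"
  using frame_proj_closed[OF F w] w form_frame_proj[OF F w] orth_frameD(1)[OF F]
  by (auto simp: frame_compl_def form_minus R.r_neg a_minus_def[of R])

text \<open>The projection is a combination of frame vectors, to which \<open>c\<close> is
  orthogonal.\<close>

lemma form_compl:
  assumes F: "orth_frame n v b" and w: "w \<in> carrier V" and c: "c \<in> frame_compl n v"
  shows "B c (w \<ominus>\<^bsub>V\<^esub> frame_proj n v b w) = B c w"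
proof -
  note D = orth_frameD[OF F]
  have c': "c \<in> carrier V" "\<And>i. i < n \<Longrightarrow> B (v i) c = \<zero>"
    using c D form_sym by (auto simp: frame_compl_def)
  have "B (frame_proj n v b w) c = (\<Oplus>i\<in>{..<n}. B ((b i \<otimes> B w (v i)) \<odot>\<^bsub>V\<^esub> v i) c)"
    unfolding frame_proj_def by (rule form_finsum) (use D w c' in auto)
  also have "\<dots> = (\<Oplus>i\<in>{..<n}. \<zero>)"
    by (rule R.finsum_cong') (use D w c' in \<open>auto simp: form_smult\<close>)
  finally have "B (frame_proj n v b w) c = \<zero>" by simp
  then show ?thesis
    using w c' frame_proj_closed[OF F w] form_sym[OF c'(1)] by (simp add: form_minus a_minus_def[of R])
qed

text \<open>Let \<open>e\<close> be an idempotent power of \<open>a = B w w\<close>. The vector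
  \<open>e \<odot> w\<close> has square \<open>e \<otimes> a\<close>, which the power of
  \<open>a\<close> just below \<open>e\<close> inverts up to \<open>e\<close>. That square is a
  power of \<open>a\<close>, hence nonzero, so \<open>e \<odot> w\<close> leaves the
  complement.\<close>

lemma frame_extend:
  assumes fin: "finite (carrier R)" and F: "orth_frame n v b"
    and w: "w \<in> frame_compl n v" "\<not> nilpotent (B w w)"
  obtains v' b' where "orth_frame (Suc n) v' b'" "frame_compl (Suc n) v' \<subset> frame_compl n v"
proof -
  note D = orth_frameD[OF F]
  have w': "w \<in> carrier V" "\<And>i. i < n \<Longrightarrow> B w (v i) = \<zero>" "\<And>i. i < n \<Longrightarrow> B (v i) w = \<zero>"
    using w D form_sym by (auto simp: frame_compl_def)
  define a where "a = B w w"
  have a: "a \<in> carrier R" using w' by (simp add: a_def)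
  obtain k :: nat where k: "k > 0" "a [^] k \<otimes> a [^] k = a [^] k"
    using idempotent_power[OF fin a] by blast
  define e where "e = a [^] k"
  have e: "e \<in> carrier R" "e \<otimes> e = e" using k a by (simp_all add: e_def)
  have ea: "a [^] (k - 1) \<otimes> a = e"
    using k(1) a nat_pow_Suc[of a "k - 1"] by (simp add: e_def del: nat_pow_Suc)
  define u where "u = e \<odot>\<^bsub>V\<^esub> w"
  define s where "s = a [^] (k - 1)"
  have u: "u \<in> carrier V" using e w' by (simp add: u_def)
  have s: "s \<in> carrier R" using a by (simp add: s_def)
  have Bu: "B x u = e \<otimes> B x w" if "x \<in> carrier V" for x
    using that e w' form_sym[OF that] by (simp add: u_def form_smult)
  have uv: "B u (v i) = \<zero>" "B (v i) u = \<zero>" if "i < n" for i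
    using that w' e D Bu by (auto simp: u_def form_smult)
  have uu: "B u u = e \<otimes> a"
    using Bu[OF u] e w' a m_assoc[of e e a] by (simp add: u_def form_smult a_def)
  have key: "s \<otimes> B x u \<otimes> B u u = B x u" if x: "x \<in> carrier V" for x
  proof -
    have "s \<otimes> B x u \<otimes> B u u = (s \<otimes> a) \<otimes> (e \<otimes> e) \<otimes> B x w"
      unfolding uu Bu[OF x] using s a e(1) x w' by (simp add: m_ac)
    then show ?thesis using ea e Bu[OF x] by (simp add: s_def)
  qed
  show thesis
  proof (rule that)
    show "orth_frame (Suc n) (v(n := u)) (b(n := s))"
      unfolding orth_frame_def using D u s uv key by (auto simp: less_Suc_eq)
    have "frame_compl (Suc n) (v(n := u)) = {x \<in> frame_compl n v. B x u = \<zero>}"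
      by (auto simp: frame_compl_def less_Suc_eq)
    moreover have "u \<in> frame_compl n v" using u uv by (simp add: frame_compl_def)
    moreover have "B u u \<noteq> \<zero>"
    proof
      assume "B u u = \<zero>"
      then have "a [^] Suc k = \<zero>" using uu by (simp add: e_def)
      then show False using w(2) unfolding nilpotent_def a_def by blast
    qed
    ultimately show "frame_compl (Suc n) (v(n := u)) \<subset> frame_compl n v" by blast
  qed
qed

text \<open>A complement on which the quadratic form is nilpotent vanishes: a nonzero \<open>r \<otimes> B x y\<close> with
  \<open>x\<close> in the complement can be rewritten with a multiple of \<open>r\<close> by a nilpotent element in
  place of \<open>r\<close>, and the ideals generated by these coefficients descend.\<close>

lemma frame_compl_nilpotent:
  assumes fin: "finite (carrier R)" and two: "\<one> \<oplus> \<one> \<in> Units R"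
    and F: "orth_frame n v b" and nil: "\<And>w. w \<in> frame_compl n v \<Longrightarrow> nilpotent (B w w)"
  shows "frame_compl n v = {\<zero>\<^bsub>V\<^esub>}"
proof -
  let ?C = "frame_compl n v"
  obtain m e u where eu: "\<And>i. i < (m::nat) \<Longrightarrow> e i \<in> carrier V" "\<And>i. i < m \<Longrightarrow> u i \<in> carrier V"
    "\<And>v. v \<in> carrier V \<Longrightarrow> v = (\<Oplus>\<^bsub>V\<^esub>i\<in>{..<m}. B v (u i) \<odot>\<^bsub>V\<^esub> e i)"
    by (rule dual_basis) (rule that)
  have CV: "x \<in> carrier V" if "x \<in> ?C" for x using that by (simp add: frame_compl_def)
  \<comment> \<open>Polarization: twice \<open>B x y\<close> is a combination of nilpotent squares,
    and 2 is a unit.\<close>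
  have nilC: "nilpotent (B x y)" if x: "x \<in> ?C" and y: "y \<in> ?C" for x y
  proof -
    note xy = CV[OF x] CV[OF y]
    have "x \<oplus>\<^bsub>V\<^esub> y \<in> ?C"
      using x y orth_frameD(1)[OF F] by (auto simp: frame_compl_def form_add)
    then have 1: "nilpotent (B (x \<oplus>\<^bsub>V\<^esub> y) (x \<oplus>\<^bsub>V\<^esub> y))" by (rule nil)
    have 2: "nilpotent ((\<ominus> \<one>) \<otimes> B x x)" "nilpotent ((\<ominus> \<one>) \<otimes> B y y)"
      using nil x y xy by (auto intro: nilpotent_mult)
    have B': "B z (x \<oplus>\<^bsub>V\<^esub> y) = B z x \<oplus> B z y" if "z \<in> carrier V" for z
      using form_add[OF xy that] form_sym[OF that] xy by simp
    have "B (x \<oplus>\<^bsub>V\<^esub> y) (x \<oplus>\<^bsub>V\<^esub> y) \<oplus> ((\<ominus> \<one>) \<otimes> B x x \<oplus> (\<ominus> \<one>) \<otimes> B y y) =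
        (B x x \<oplus> \<ominus> B x x) \<oplus> (B y y \<oplus> \<ominus> B y y) \<oplus> (B x y \<oplus> B x y)"
      using xy form_sym[OF xy(2,1)] by (simp add: B' form_add l_minus R.a_ac)
    also have "\<dots> = B x y \<oplus> B x y" using xy by (simp add: R.r_neg)
    also have "\<dots> = (\<one> \<oplus> \<one>) \<otimes> B x y" using xy by (simp add: l_distr)
    finally have eq: "B (x \<oplus>\<^bsub>V\<^esub> y) (x \<oplus>\<^bsub>V\<^esub> y) \<oplus> ((\<ominus> \<one>) \<otimes> B x x \<oplus> (\<ominus> \<one>) \<otimes> B y y) = (\<one> \<oplus> \<one>) \<otimes> B x y" .
    have "nilpotent ((\<one> \<oplus> \<one>) \<otimes> B x y)"
      unfolding eq[symmetric] using 1 2 xy by (intro nilpotent_add) auto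
    then have "nilpotent (inv (\<one> \<oplus> \<one>) \<otimes> ((\<one> \<oplus> \<one>) \<otimes> B x y))"
      using xy two by (intro nilpotent_mult[of "(\<one> \<oplus> \<one>) \<otimes> B x y"]) auto
    moreover have "inv (\<one> \<oplus> \<one>) \<otimes> ((\<one> \<oplus> \<one>) \<otimes> B x y) = B x y"
      using xy two by (subst m_assoc[symmetric]) auto
    ultimately show ?thesis by simp
  qed
  have expand: "B x y = (\<Oplus>i\<in>{..<m}. B x (u i) \<otimes> B (e i) y)" if "x \<in> carrier V" "y \<in> carrier V" for x y
  proof -
    have "B x y = B (\<Oplus>\<^bsub>V\<^esub>i\<in>{..<m}. B x (u i) \<odot>\<^bsub>V\<^esub> e i) y" using eu(3)[OF that(1)] by simp
    also have "\<dots> = (\<Oplus>i\<in>{..<m}. B (B x (u i) \<odot>\<^bsub>V\<^esub> e i) y)"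
      by (rule form_finsum) (use eu that in auto)
    also have "\<dots> = (\<Oplus>i\<in>{..<m}. B x (u i) \<otimes> B (e i) y)"
      by (rule R.finsum_cong') (use eu that in \<open>auto simp: form_smult\<close>)
    finally show ?thesis .
  qed
  \<comment> \<open>Induction on the size of the ideal generated by \<open>r\<close>, for all
    \<open>x\<close> and \<open>y\<close> at once because their parts get exchanged.\<close>
  have descent: "r \<otimes> B x y = \<zero>" if "r \<in> carrier R" "x \<in> ?C" "y \<in> carrier V" for r x y
    using that
  proof (induction "card ((\<lambda>x. r \<otimes> x) ` carrier R)" arbitrary: r x y rule: less_induct)
    case less
    note x = CV[OF less.prems(2)]
    \<comment> \<open>Since \<open>x\<close> is orthogonal to the frame, \<open>y\<close> may be
      replaced by its component in the complement, which then takes over the part of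
      \<open>x\<close>.\<close>
    let ?y = "y \<ominus>\<^bsub>V\<^esub> frame_proj n v b y"
    have y: "?y \<in> ?C" by (rule minus_frame_proj[OF F less.prems(3)])
    note yV = CV[OF y]
    show ?case
    proof (rule ccontr)
      assume nz: "r \<otimes> B x y \<noteq> \<zero>"
      then have r: "r \<noteq> \<zero>" using x less.prems by auto
      have z: "r \<otimes> (B x (u i) \<otimes> B (e i) ?y) = \<zero>" if i: "i < m" for i
      proof -
        let ?c = "B x (u i)"
        have c: "?c \<in> carrier R" using x eu(2)[OF i] by simp
        \<comment> \<open>\<open>?c\<close> is also the form of \<open>x\<close> with the complement
          component of \<open>u i\<close>, hence a value of the form on the complement.\<close>
        have "nilpotent ?c"
          using nilC[OF less.prems(2) minus_frame_proj[OF F eu(2)[OF i]]]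
            form_compl[OF F eu(2)[OF i] less.prems(2)] by simp
        then have "r \<otimes> ?c \<otimes> B ?y (e i) = \<zero>"
          using nilpotent_mult_ideal_card[OF fin less.prems(1) r c] less.prems(1) c y eu(1)[OF i]
          by (intro less.hyps) auto
        then show ?thesis
          using less.prems(1) c form_sym[OF yV eu(1)[OF i]] yV eu(1)[OF i] by (simp add: m_assoc)
      qed
      have "r \<otimes> B x y = r \<otimes> B x ?y" using form_compl[OF F less.prems(3,2)] by simp
      also have "\<dots> = (\<Oplus>i\<in>{..<m}. r \<otimes> (B x (u i) \<otimes> B (e i) ?y))"
        unfolding expand[OF x yV] by (rule finsum_rdistr) (use less.prems x yV eu in auto)
      also have "\<dots> = (\<Oplus>i\<in>{..<m}. \<zero>)"
        by (rule R.finsum_cong') (use z in auto)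
      finally show False using nz by simp
    qed
  qed
  have "x = \<zero>\<^bsub>V\<^esub>" if x: "x \<in> ?C" for x
  proof -
    have "x = (\<Oplus>\<^bsub>V\<^esub>i\<in>{..<m}. B x (u i) \<odot>\<^bsub>V\<^esub> e i)" using eu(3) CV[OF x] .
    also have "\<dots> = (\<Oplus>\<^bsub>V\<^esub>i\<in>{..<m}. \<zero>\<^bsub>V\<^esub>)"
      by (rule M.finsum_cong') (use descent[OF R.one_closed x] CV[OF x] eu in \<open>auto simp: smult_l_null\<close>)
    finally show ?thesis by simp
  qed
  moreover have "\<zero>\<^bsub>V\<^esub> \<in> ?C" using orth_frameD(1)[OF F] by (simp add: frame_compl_def form_zero)
  ultimately show ?thesis by blast
qed

definition complete_frame :: "nat \<Rightarrow> (nat \<Rightarrow> 'v) \<Rightarrow> (nat \<Rightarrow> 'r) \<Rightarrow> bool"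
  where "complete_frame n v b \<longleftrightarrow> orth_frame n v b \<and> (\<forall>w\<in>carrier V. frame_proj n v b w = w)"

text \<open>Frame vectors are split off until every square in the complement is nilpotent; the
  finite complement strictly shrinks each time. By \<open>frame_compl_nilpotent\<close> it is then
  zero, so the projection is the identity.\<close>

theorem complete_frame_exists:
  assumes fin: "finite (carrier R)" and two: "\<one> \<oplus> \<one> \<in> Units R"
  shows "\<exists>n v b. complete_frame n v b"
proof -
  have finC: "finite (frame_compl n v)" for n v
    using finite_carrier[OF fin] by (simp add: frame_compl_def)
  have "\<exists>n v b. orth_frame n v b \<and> (\<forall>w\<in>frame_compl n v. nilpotent (B w w))"
    if "orth_frame n v b" for n v b
    using that
  proof (induction "card (frame_compl n v)" arbitrary: n v b rule: less_induct)
    case less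
    show ?case
    proof (cases "\<forall>w\<in>frame_compl n v. nilpotent (B w w)")
      case False
      then obtain w where w: "w \<in> frame_compl n v" "\<not> nilpotent (B w w)" by blast
      obtain v' b' where "orth_frame (Suc n) v' b'" "frame_compl (Suc n) v' \<subset> frame_compl n v"
        by (rule frame_extend[OF fin less.prems w]) (rule that)
      then show ?thesis using less.hyps psubset_card_mono[OF finC] by blast
    qed (use less.prems in blast)
  qed
  \<comment> \<open>The empty frame starts the process; with no indices its vectors and scalars may
    be arbitrary.\<close>
  moreover have "orth_frame 0 undefined undefined" by (simp add: orth_frame_def)
  ultimately obtain n v b where F: "orth_frame n v b"
    and nil: "\<And>w. w \<in> frame_compl n v \<Longrightarrow> nilpotent (B w w)" by metis
  have "frame_proj n v b w = w" if w: "w \<in> carrier V" for w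
  proof -
    have "w \<ominus>\<^bsub>V\<^esub> frame_proj n v b w = \<zero>\<^bsub>V\<^esub>"
      using minus_frame_proj[OF F w] frame_compl_nilpotent[OF fin two F nil] by blast
    moreover have "w = (w \<ominus>\<^bsub>V\<^esub> frame_proj n v b w) \<oplus>\<^bsub>V\<^esub> frame_proj n v b w"
      using w frame_proj_closed[OF F w] by (simp add: a_minus_def M.a_assoc M.l_neg)
    ultimately show ?thesis using frame_proj_closed[OF F w] by simp
  qed
  then show ?thesis using F unfolding complete_frame_def by blast
qed

text \<open>Expanding the first argument through the frame diagonalizes the form in the coordinates
  \<open>B w (v i)\<close>.\<close>

lemma complete_frame_form:
  assumes F: "complete_frame n v b" and w: "w \<in> carrier V" "w' \<in> carrier V"
  shows "B w w' = (\<Oplus>i\<in>{..<n}. b i \<otimes> B w (v i) \<otimes> B w' (v i))"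
proof -
  have F': "orth_frame n v b" "frame_proj n v b w = w" using F w by (auto simp: complete_frame_def)
  note D = orth_frameD[OF F'(1)]
  have "B (frame_proj n v b w) w' = (\<Oplus>i\<in>{..<n}. B ((b i \<otimes> B w (v i)) \<odot>\<^bsub>V\<^esub> v i) w')"
    unfolding frame_proj_def by (rule form_finsum) (use D w in auto)
  also have "\<dots> = (\<Oplus>i\<in>{..<n}. b i \<otimes> B w (v i) \<otimes> B w' (v i))"
    by (rule R.finsum_cong') (use D w form_sym[OF w(2)] in \<open>auto simp: form_smult\<close>)
  finally show ?thesis using F'(2) by simp
qed

lemma complete_frame_eqI:
  assumes F: "complete_frame n v b" and w: "w \<in> carrier V" "w' \<in> carrier V"
    and eq: "\<And>i. i < n \<Longrightarrow> B w (v i) = B w' (v i)"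
  shows "w = w'"
proof -
  have "frame_proj n v b w = frame_proj n v b w'"
    unfolding frame_proj_def
    by (rule M.finsum_cong') (use F w eq in \<open>auto simp: complete_frame_def orth_frame_def\<close>)
  then show ?thesis using F w by (simp add: complete_frame_def)
qed

end

section \<open>Isometries obtained by folding frames\<close>

definition frame_map ::
  "('r, 'p) ring_scheme \<Rightarrow> ('r, 'v) orth \<Rightarrow> ('r, 'w) orth \<Rightarrow> (nat \<Rightarrow> 'v) \<Rightarrow>
    nat \<Rightarrow> (nat \<Rightarrow> 'w) \<Rightarrow> (nat \<Rightarrow> 'r) \<Rightarrow> (nat \<Rightarrow> nat) \<Rightarrow> 'v \<Rightarrow> 'w"
  where "frame_map R E E' v n' v' b' \<sigma> = (\<lambda>w\<in>carrier (fst E).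
    \<Oplus>\<^bsub>fst E'\<^esub>k\<in>{..<n'}. (b' k \<otimes>\<^bsub>R\<^esub> snd E w (v (\<sigma> k))) \<odot>\<^bsub>fst E'\<^esub> v' k)"

text \<open>The coordinate of the image at \<open>j\<close> is that of \<open>w\<close> at
  \<open>\<sigma> j\<close>: the factor \<open>b' j\<close> cancels the square of
  \<open>v' j\<close> by the frame law at \<open>\<sigma> j\<close>. Linearity is then checked on
  coordinates, and the diagonal formula shows that the form is preserved.\<close>

lemma frame_map_isometry:
  fixes R :: "('r, 'p) ring_scheme" (structure) and V :: "('r, 'v) module" and V' :: "('r, 'w) module"
  assumes E: "orthogonal R V B" and E': "orthogonal R V' B'" and fin: "finite (carrier R)"
    and F: "orthogonal.complete_frame R V B n v b" and F': "orthogonal.complete_frame R V' B' n' v' b'"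
    and \<sigma>: "\<And>k. k < n' \<Longrightarrow> \<sigma> k < n \<and> b' k = b (\<sigma> k) \<and> B' (v' k) (v' k) = B (v (\<sigma> k)) (v (\<sigma> k))"
    and cnt: "\<And>p. p < n \<Longrightarrow> card {k. k < n' \<and> \<sigma> k = p} mod card (carrier R) = 1 mod card (carrier R)"
  shows "frame_map R (V, B) (V', B') v n' v' b' \<sigma> \<in> isometries R (V, B) (V', B')"
    and "\<And>w j. \<lbrakk>w \<in> carrier V; j < n'\<rbrakk> \<Longrightarrow>
      B' (frame_map R (V, B) (V', B') v n' v' b' \<sigma> w) (v' j) = B w (v (\<sigma> j))"
proof -
  interpret E: orthogonal R V B by fact
  interpret E': orthogonal R V' B' by fact
  let ?g = "frame_map R (V, B) (V', B') v n' v' b' \<sigma>"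
  have of: "E.orth_frame n v b" and of': "E'.orth_frame n' v' b'"
    using F F' by (auto simp: E.complete_frame_def E'.complete_frame_def)
  note D = E.orth_frameD[OF of] and D' = E'.orth_frameD[OF of']
  have g: "?g w = (\<Oplus>\<^bsub>V'\<^esub>k\<in>{..<n'}. (b' k \<otimes> B w (v (\<sigma> k))) \<odot>\<^bsub>V'\<^esub> v' k)" if "w \<in> carrier V" for w
    using that by (simp add: frame_map_def)
  have gV: "?g w \<in> carrier V'" if "w \<in> carrier V" for w
    unfolding g[OF that] by (rule E'.M.finsum_closed) (use D D' \<sigma> that in auto)
  show coord: "B' (?g w) (v' j) = B w (v (\<sigma> j))" if w: "w \<in> carrier V" and j: "j < n'" for w j
    unfolding g[OF w] using D D' \<sigma> w j
    by (subst E'.form_orth_combination[OF of']) auto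
  have lin: "?g \<in> linear_maps R V V'"
  proof (rule linear_mapsI)
    show "?g x \<in> carrier V'" if "x \<in> carrier V" for x using gV[OF that] .
    show "?g (x \<oplus>\<^bsub>V\<^esub> y) = ?g x \<oplus>\<^bsub>V'\<^esub> ?g y" if "x \<in> carrier V" "y \<in> carrier V" for x y
      by (rule E'.complete_frame_eqI[OF F'])
        (use that gV coord D D' \<sigma> in \<open>auto simp: E'.form_add E.form_add\<close>)
    show "?g (a \<odot>\<^bsub>V\<^esub> x) = a \<odot>\<^bsub>V'\<^esub> ?g x" if "a \<in> carrier R" "x \<in> carrier V" for a x
      by (rule E'.complete_frame_eqI[OF F'])
        (use that gV coord D D' \<sigma> in \<open>auto simp: E'.form_smult E.form_smult\<close>)
    show "?g \<in> extensional (carrier V)" by (simp add: frame_map_def)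
  qed
  have "B w u = B' (?g w) (?g u)" if w: "w \<in> carrier V" and u: "u \<in> carrier V" for w u
  proof -
    let ?h = "\<lambda>i. b i \<otimes> B w (v i) \<otimes> B u (v i)"
    have "B' (?g w) (?g u) = (\<Oplus>k\<in>{..<n'}. b' k \<otimes> B' (?g w) (v' k) \<otimes> B' (?g u) (v' k))"
      by (rule E'.complete_frame_form[OF F' gV[OF w] gV[OF u]])
    also have "\<dots> = (\<Oplus>k\<in>{..<n'}. ?h (\<sigma> k))"
      by (rule E.R.finsum_cong') (use coord w u \<sigma> D in auto)
    \<comment> \<open>The additive group of \<open>R\<close> has order
      \<open>card (carrier R)\<close>, so each fibre counts as one.\<close>
    also have "\<dots> = (\<Oplus>i\<in>{..<n}. ?h i)"
      by (rule E.R.add.finprod_eq_finprod_fibres) (use fin \<sigma> cnt D w u in auto)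
    also have "\<dots> = B w u" by (rule E.complete_frame_form[OF F w u, symmetric])
    finally show ?thesis ..
  qed
  then show "?g \<in> isometries R (V, B) (V', B')" using lin by (simp add: isometries_def)
qed


section \<open>Isometries as words\<close>

text \<open>Let \<open>p\<close> be the first difference. At the first position over
  \<open>p\<close> the new words differ in the same way, and all earlier positions lie over places
  before \<open>p\<close>, where the words agree.\<close>

lemma lexorder_reindex:
  fixes xs ys xs' ys' :: "'a :: linorder list"
  assumes len: "length xs = n" "length ys = n" "length xs' = n'" "length ys' = n'"
    and nth: "\<And>j. j < n' \<Longrightarrow> \<sigma> j < n \<and> xs' ! j = xs ! \<sigma> j \<and> ys' ! j = ys ! \<sigma> j"
    and onto: "\<And>p. p < n \<Longrightarrow> \<exists>k<n'. \<sigma> k = p \<and> (\<forall>k'<k. \<sigma> k' < p)"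
    and less: "xs < ys"
  shows "xs' < ys'"
proof -
  obtain p where p: "p < n" "take p xs = take p ys" "xs ! p < ys ! p"
    using less len by (auto simp: list_less_def lexord_take_index_conv)
  obtain k where k: "k < n'" "\<sigma> k = p" "\<And>k'. k' < k \<Longrightarrow> \<sigma> k' < p" using onto[OF p(1)] by blast
  have "take k xs' = take k ys'"
  proof (rule nth_equalityI)
    fix j assume "j < length (take k xs')"
    then have j: "j < k" "j < n'" using len by auto
    have "xs ! \<sigma> j = ys ! \<sigma> j" using p(2) k(3)[OF j(1)] by (metis nth_take)
    then show "take k xs' ! j = take k ys' ! j" using nth[OF j(2)] j by simp
  qed (use len in simp)
  moreover have "xs' ! k < ys' ! k" using nth[OF k(1)] k(2) p(3) by simp
  ultimately show ?thesis using k(1) len by (auto simp: list_less_def lexord_take_index_conv)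
qed

lemma isometriesD:
  assumes "f \<in> isometries R E F"
  shows "f \<in> linear_maps R (fst E) (fst F)"
    and "\<lbrakk>x \<in> carrier (fst E); y \<in> carrier (fst E)\<rbrakk> \<Longrightarrow> snd F (f x) (f y) = snd E x y"
  using assms by (auto simp: isometries_def split: prod.splits)

lemma orthogonalI:
  assumes "orthogonal_module R E"
  shows "orthogonal R (fst E) (snd E)"
  using assms by (simp add: orthogonal_def orthogonal_axioms_def orthogonal_module_def)

section \<open>Words of isometries into an orthogonal module\<close>

locale isometry_words =
  fixes R :: "('r, 'p) ring_scheme" and S :: "'s set" and E :: "'s \<Rightarrow> ('r, 'v) orth"
  assumes fin: "finite (carrier R)" and two: "\<one>\<^bsub>R\<^esub> \<oplus>\<^bsub>R\<^esub> \<one>\<^bsub>R\<^esub> \<in> Units R"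
    and finite_S: "finite S" and E: "s \<in> S \<Longrightarrow> orthogonal_module R (E s)"
begin

text \<open>Chosen once for each module, so that the words of all maps into it use the same
  coordinates.\<close>

definition frame :: "('r, 'v) orth \<Rightarrow> nat \<times> (nat \<Rightarrow> 'v) \<times> (nat \<Rightarrow> 'r)"
  where "frame W = (SOME (n, v, b). orthogonal.complete_frame R (fst W) (snd W) n v b)"

abbreviation "fn W \<equiv> fst (frame W)"
abbreviation "fv W \<equiv> fst (snd (frame W))"
abbreviation "fb W \<equiv> snd (snd (frame W))"

lemma frame:
  assumes "orthogonal_module R W"
  shows "orthogonal.complete_frame R (fst W) (snd W) (fn W) (fv W) (fb W)"
proof -
  interpret orthogonal R "fst W" "snd W" using assms by (rule orthogonalI)
  have "\<exists>x. case x of (n, v, b) \<Rightarrow> complete_frame n v b" using complete_frame_exists[OF fin two] by auto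
  from someI_ex[OF this] have "case frame W of (n, v, b) \<Rightarrow> complete_frame n v b"
    unfolding frame_def .
  then show ?thesis by (simp add: case_prod_beta)
qed

lemma frameD:
  assumes "orthogonal_module R W" "i < fn W"
  shows "fv W i \<in> carrier (fst W)" "fb W i \<in> carrier R"
proof -
  interpret orthogonal R "fst W" "snd W" using assms(1) by (rule orthogonalI)
  show "fv W i \<in> carrier (fst W)" "fb W i \<in> carrier R"
    using frame[OF assms(1)] assms(2) by (auto simp: complete_frame_def orth_frame_def)
qed

text \<open>Square and scalar enter the letter so that a map of positions preserving letters also
  matches the two frames.\<close>

definition letter :: "('r, 'v) orth \<Rightarrow> 's \<Rightarrow> ('v \<Rightarrow> 'v) \<Rightarrow> nat \<Rightarrow> 'r \<times> 'r \<times> ('v \<Rightarrow> 'r)"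
  where "letter W s f k = (snd W (fv W k) (fv W k), fb W k,
    \<lambda>x\<in>carrier (fst (E s)). snd W (f x) (fv W k))"

definition word :: "('r, 'v) orth \<Rightarrow> 's \<Rightarrow> ('v \<Rightarrow> 'v) \<Rightarrow> ('r \<times> 'r \<times> ('v \<Rightarrow> 'r)) list"
  where "word W s f = map (letter W s f) [0..<fn W]"

definition alphabet :: "('r \<times> 'r \<times> ('v \<Rightarrow> 'r)) set"
  where "alphabet = (\<Union>s\<in>S. carrier R \<times> carrier R \<times> (carrier (fst (E s)) \<rightarrow>\<^sub>E carrier R))"

definition shapes :: "('r, 'v) orth \<Rightarrow> ('s \<times> ('v \<Rightarrow> 'v)) set"
  where "shapes W = (SIGMA s:S. isometries R (E s) W)"

text \<open>Arbitrary injections into the naturals, here and for letters, provide the linear orders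
  behind \<open>key\<close>.\<close>

definition enc_gen :: "'s \<Rightarrow> nat"
  where "enc_gen = (SOME e. inj_on e S)"

definition enc_letter :: "'r \<times> 'r \<times> ('v \<Rightarrow> 'r) \<Rightarrow> nat"
  where "enc_letter = (SOME e. inj_on e alphabet)"

definition key :: "('r, 'v) orth \<Rightarrow> 's \<times> ('v \<Rightarrow> 'v) \<Rightarrow> nat list"
  where "key W = (\<lambda>(s, f). enc_gen s # map enc_letter (word W s f))"

definition fold_map :: "('r, 'v) orth \<Rightarrow> ('r, 'v) orth \<Rightarrow> (nat \<Rightarrow> nat) \<Rightarrow> 'v \<Rightarrow> 'v"
  where "fold_map W W' \<sigma> = frame_map R W W' (fv W) (fn W') (fv W') (fb W') \<sigma>"

text \<open>The conditions involve the two objects but no particular map, so one folding acts on all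
  shapes over \<open>W\<close> at once.\<close>

definition folding :: "('r, 'v) orth \<Rightarrow> ('r, 'v) orth \<Rightarrow> (nat \<Rightarrow> nat) \<Rightarrow> bool"
  where "folding W W' \<sigma> \<longleftrightarrow>
    (\<forall>k<fn W'. \<sigma> k < fn W \<and> fb W' k = fb W (\<sigma> k) \<and>
      snd W' (fv W' k) (fv W' k) = snd W (fv W (\<sigma> k)) (fv W (\<sigma> k))) \<and>
    (\<forall>p<fn W. card {k. k < fn W' \<and> \<sigma> k = p} mod card (carrier R) = 1 mod card (carrier R)) \<and>
    (\<forall>p<fn W. \<exists>k<fn W'. \<sigma> k = p \<and> (\<forall>k'<k. \<sigma> k' < p))"

definition postcomp :: "('v \<Rightarrow> 'v) \<Rightarrow> 's \<times> ('v \<Rightarrow> 'v) \<Rightarrow> 's \<times> ('v \<Rightarrow> 'v)"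
  where "postcomp g = (\<lambda>(s, f). (s, compose (carrier (fst (E s))) g f))"

definition foldings :: "('r, 'v) orth \<Rightarrow> ('r, 'v) orth \<Rightarrow> ('s \<times> ('v \<Rightarrow> 'v) \<Rightarrow> 's \<times> ('v \<Rightarrow> 'v)) set"
  where "foldings W W' = {postcomp (fold_map W W' \<sigma>) |\<sigma>. folding W W' \<sigma>}"

lemma fold_map:
  assumes W: "orthogonal_module R W" "orthogonal_module R W'" and \<sigma>: "folding W W' \<sigma>"
  shows "fold_map W W' \<sigma> \<in> isometries R W W'"
    and "\<lbrakk>w \<in> carrier (fst W); j < fn W'\<rbrakk> \<Longrightarrow>
      snd W' (fold_map W W' \<sigma> w) (fv W' j) = snd W w (fv W (\<sigma> j))"
  using frame_map_isometry[OF orthogonalI[OF W(1)] orthogonalI[OF W(2)] fin frame[OF W(1)] frame[OF W(2)], of \<sigma>] \<sigma>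
  by (auto simp: folding_def fold_map_def)

lemma finite_alphabet: "finite alphabet"
proof -
  have "finite (carrier (fst (E s)))" if "s \<in> S" for s
    using orthogonal.finite_carrier[OF orthogonalI[OF E[OF that]] fin] .
  then show ?thesis unfolding alphabet_def using fin finite_S
    by (intro finite_UN_I finite_cartesian_product finite_PiE) auto
qed

lemma inj_enc: "inj_on enc_gen S" "inj_on enc_letter alphabet"
  using finite_imp_inj_to_nat_seg[OF finite_S] finite_imp_inj_to_nat_seg[OF finite_alphabet]
  unfolding enc_gen_def enc_letter_def by (metis someI)+

lemma isometry_closed:
  assumes "f \<in> isometries R (E s) W" "x \<in> carrier (fst (E s))"
  shows "f x \<in> carrier (fst W)"
  using linear_mapsD(1)[OF isometriesD(1)[OF assms(1)] assms(2)] .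

lemma word_alphabet:
  assumes W: "orthogonal_module R W" and s: "s \<in> S" "f \<in> isometries R (E s) W"
  shows "word W s f \<in> lists alphabet"
proof -
  interpret orthogonal R "fst W" "snd W" using W by (rule orthogonalI)
  have "letter W s f k \<in> alphabet" if "k < fn W" for k
    unfolding alphabet_def letter_def
    using s(1) frameD[OF W that] isometry_closed[OF s(2)] by (intro UN_I[of s]) auto
  then show ?thesis by (auto simp: word_def in_lists_conv_set)
qed

lemma length_word [simp]: "length (word W s f) = fn W"
  by (simp add: word_def)

lemma nth_word: "k < fn W \<Longrightarrow> word W s f ! k = letter W s f k"
  by (simp add: word_def)

text \<open>Equal words give equal coordinates in a complete frame.\<close>

lemma word_inj:
  assumes W: "orthogonal_module R W" and f: "f \<in> isometries R (E s) W" "f' \<in> isometries R (E s) W"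
    and eq: "word W s f = word W s f'"
  shows "f = f'"
proof (rule linear_maps_ext[OF isometriesD(1)[OF f(1)] isometriesD(1)[OF f(2)]])
  interpret orthogonal R "fst W" "snd W" using W by (rule orthogonalI)
  fix x assume x: "x \<in> carrier (fst (E s))"
  show "f x = f' x"
  proof (rule complete_frame_eqI[OF frame[OF W] isometry_closed[OF f(1) x] isometry_closed[OF f(2) x]])
    fix i assume "i < fn W"
    then have "letter W s f i = letter W s f' i" using eq by (metis nth_word)
    then show "snd W (f x) (fv W i) = snd W (f' x) (fv W i)"
      using x by (auto simp: letter_def dest: fun_cong[of _ _ x])
  qed
qed

lemma postcomp_shapes:
  assumes W: "orthogonal_module R W" "orthogonal_module R W'" and g: "g \<in> isometries R W W'"
    and t: "t \<in> shapes W"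
  shows "postcomp g t \<in> shapes W'"
proof -
  obtain s f where t': "t = (s, f)" "s \<in> S" "f \<in> isometries R (E s) W"
    using t by (auto simp: shapes_def)
  have "compose (carrier (fst (E s))) g f \<in> isometries R (E s) W'"
    using categoryD(2)[OF OrI_category, of f R "E s" W g W'] g W t' E by (simp add: OrI_def)
  then show ?thesis using t' by (simp add: postcomp_def shapes_def)
qed

text \<open>Coordinates of an image under the fold map are read off at \<open>\<sigma> j\<close>,
  while square and scalar match by the folding conditions.\<close>

lemma word_fold_map:
  assumes W: "orthogonal_module R W" "orthogonal_module R W'" and \<sigma>: "folding W W' \<sigma>"
    and f: "f \<in> isometries R (E s) W" and j: "j < fn W'"
  shows "word W' s (compose (carrier (fst (E s))) (fold_map W W' \<sigma>) f) ! j = word W s f ! \<sigma> j"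
proof -
  have "\<sigma> j < fn W" "fb W' j = fb W (\<sigma> j)"
      "snd W' (fv W' j) (fv W' j) = snd W (fv W (\<sigma> j)) (fv W (\<sigma> j))"
    using \<sigma> j by (auto simp: folding_def)
  then show ?thesis
    using j isometry_closed[OF f] fold_map(2)[OF W \<sigma> _ j]
    by (auto simp: nth_word letter_def compose_def intro!: restrict_ext)
qed

text \<open>Composition keeps the generator, which heads the key; for a common generator the words
  are reindexed by \<open>\<sigma>\<close>, which preserves lexicographic order.\<close>

lemma key_fold_map_mono:
  assumes W: "orthogonal_module R W" "orthogonal_module R W'" and \<sigma>: "folding W W' \<sigma>"
    and t: "t \<in> shapes W" "u \<in> shapes W" and less: "key W t < key W u"
  shows "key W' (postcomp (fold_map W W' \<sigma>) t) < key W' (postcomp (fold_map W W' \<sigma>) u)"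
proof -
  obtain s f where t': "t = (s, f)" "s \<in> S" "f \<in> isometries R (E s) W"
    using t by (auto simp: shapes_def)
  obtain s' f' where u': "u = (s', f')" "s' \<in> S" "f' \<in> isometries R (E s') W"
    using t by (auto simp: shapes_def)
  show ?thesis
  proof (cases "s = s'")
    case False
    then have "enc_gen s \<noteq> enc_gen s'" using inj_enc(1) t' u' by (meson inj_onD)
    then show ?thesis using less t' u' by (simp add: key_def postcomp_def)
  next
    case True
    then have l: "map enc_letter (word W s f) < map enc_letter (word W s f')"
      using less t' u' by (simp add: key_def)
    have "map enc_letter (word W' s (compose (carrier (fst (E s))) (fold_map W W' \<sigma>) f)) <
        map enc_letter (word W' s (compose (carrier (fst (E s))) (fold_map W W' \<sigma>) f'))"
      by (rule lexorder_reindex[where n="fn W" and n'="fn W'" and \<sigma>=\<sigma>, OF _ _ _ _ _ _ l])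
        (use \<sigma> t' u' True word_fold_map[OF W \<sigma>] in \<open>auto simp: folding_def\<close>)
    then show ?thesis using t' u' True by (simp add: key_def postcomp_def)
  qed
qed

lemma key_inj:
  assumes W: "orthogonal_module R W"
  shows "inj_on (key W) (shapes W)"
proof (rule inj_onI)
  fix t u assume t: "t \<in> shapes W" "u \<in> shapes W" "key W t = key W u"
  obtain s f where t': "t = (s, f)" "s \<in> S" "f \<in> isometries R (E s) W"
    using t by (auto simp: shapes_def)
  obtain s' f' where u': "u = (s', f')" "s' \<in> S" "f' \<in> isometries R (E s') W"
    using t by (auto simp: shapes_def)
  have s: "s = s'" using t(3) t' u' inj_enc(1) by (auto simp: key_def dest: inj_onD)
  have "map enc_letter (word W s f) = map enc_letter (word W s f')"
    using t(3) t' u' s by (simp add: key_def)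
  moreover have "set (word W s f) \<subseteq> alphabet" "set (word W s f') \<subseteq> alphabet"
    using word_alphabet[OF W] t' u' s by (auto simp: in_lists_conv_set)
  ultimately have "word W s f = word W s f'"
    using inj_on_subset[OF inj_enc(2)] by (metis Un_least inj_on_map_eq_map)
  then show "t = u" using word_inj[OF W] t' u' s by simp
qed

lemma finite_shapes:
  assumes W: "orthogonal_module R W"
  shows "finite (shapes W)"
proof -
  have fc: "finite (carrier (fst W))" if "orthogonal_module R W" for W :: "('r, 'v) orth"
    using orthogonal.finite_carrier[OF orthogonalI[OF that] fin] .
  have sub: "isometries R (E s) W \<subseteq> carrier (fst (E s)) \<rightarrow>\<^sub>E carrier (fst W)" for s
    by (auto simp: isometries_def linear_maps_def split: prod.splits)
  show ?thesis unfolding shapes_def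
    by (intro finite_SigmaI finite_S finite_subset[OF sub] finite_PiE fc[OF E] fc[OF W])
qed

text \<open>Shapes are compared by generator and by folding of words. The letters turn such a
  folding into a folding of frames, and its map carries \<open>f\<close> to a map with the word of
  \<open>f'\<close>, hence to \<open>f'\<close> itself.\<close>

lemma almost_full_foldings:
  "almost_full (\<lambda>x y. \<exists>a\<in>foldings (fst x) (fst y). a (snd x) = snd y)
    (SIGMA W:Collect (orthogonal_module R). shapes W)"
proof (rule almost_full_map)
  let ?m = "card (carrier R)"
  let ?h = "\<lambda>(W, s, f). (s, word W s f)"
  have m: "?m > 0" using fin two by (auto simp: card_gt_0_iff Units_def)
  show "almost_full (\<lambda>x y. fst x = fst y \<and> (\<exists>\<sigma>. folds_onto ?m (snd x) (snd y) \<sigma>)) (S \<times> lists alphabet)"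
    by (intro almost_full_prod almost_full_finite_eq finite_S almost_full_folds_onto finite_alphabet m)
  have "?h x \<in> S \<times> lists alphabet" if x: "x \<in> (SIGMA W:Collect (orthogonal_module R). shapes W)" for x
  proof -
    obtain W s f where "x = (W, s, f)" "orthogonal_module R W" "s \<in> S" "f \<in> isometries R (E s) W"
      using x by (auto simp: shapes_def)
    then show ?thesis using word_alphabet[of W s f] by (simp del: in_lists_conv_set)
  qed
  then show "?h ` (SIGMA W:Collect (orthogonal_module R). shapes W) \<subseteq> S \<times> lists alphabet"
    by (rule image_subsetI)
  fix x y assume x: "x \<in> (SIGMA W:Collect (orthogonal_module R). shapes W)"
    and y: "y \<in> (SIGMA W:Collect (orthogonal_module R). shapes W)"
    and h: "fst (?h x) = fst (?h y) \<and> (\<exists>\<sigma>. folds_onto ?m (snd (?h x)) (snd (?h y)) \<sigma>)"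
  obtain W s f where x': "x = (W, s, f)" "orthogonal_module R W" "s \<in> S" "f \<in> isometries R (E s) W"
    using x by (auto simp: shapes_def)
  obtain W' f' where y': "y = (W', s, f')" "orthogonal_module R W'" "f' \<in> isometries R (E s) W'"
    using y h x'(1) by (auto simp: shapes_def)
  obtain \<sigma> where \<sigma>: "folds_onto ?m (word W s f) (word W' s f') \<sigma>" using h x' y' by auto
  have l: "\<sigma> k < fn W \<and> letter W' s f' k = letter W s f (\<sigma> k)" if "k < fn W'" for k
  proof -
    have "\<sigma> k < fn W" "word W' s f' ! k = word W s f ! \<sigma> k"
      using \<sigma> that by (simp_all add: folds_onto_def)
    then show ?thesis using that by (simp add: nth_word)
  qed
  have "folding W W' \<sigma>"
    unfolding folding_def
  proof (intro conjI)
    show "\<forall>k<fn W'. \<sigma> k < fn W \<and> fb W' k = fb W (\<sigma> k) \<and>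
        snd W' (fv W' k) (fv W' k) = snd W (fv W (\<sigma> k)) (fv W (\<sigma> k))"
      using l by (auto simp: letter_def)
  qed (use \<sigma> in \<open>simp_all add: folds_onto_def\<close>)
  moreover from this have "compose (carrier (fst (E s))) (fold_map W W' \<sigma>) f = f'"
  proof (intro word_inj[OF y'(2) _ y'(3)] nth_equalityI)
    assume F: "folding W W' \<sigma>"
    show "compose (carrier (fst (E s))) (fold_map W W' \<sigma>) f \<in> isometries R (E s) W'"
      using postcomp_shapes[OF x'(2) y'(2) fold_map(1)[OF x'(2) y'(2) F], of "(s, f)"] x'
      by (simp add: shapes_def postcomp_def)
    fix j assume "j < length (word W' s (compose (carrier (fst (E s))) (fold_map W W' \<sigma>) f))"
    then show "word W' s (compose (carrier (fst (E s))) (fold_map W W' \<sigma>) f) ! j = word W' s f' ! j"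
      using word_fold_map[OF x'(2) y'(2) F x'(4)] \<sigma> by (simp add: folds_onto_def)
  qed simp
  ultimately show "\<exists>a\<in>foldings (fst x) (fst y). a (snd x) = snd y"
    using x' y' by (auto simp: foldings_def postcomp_def intro!: exI[of _ \<sigma>])
qed

theorem ordered_shapes:
  assumes "left_noetherian_ring K"
  shows "ordered_shapes K (Collect (orthogonal_module R)) shapes key foldings"
proof -
  interpret left_noetherian_ring K by fact
  show ?thesis
  proof
    show "finite (shapes W)" "inj_on (key W) (shapes W)" if "W \<in> Collect (orthogonal_module R)" for W
      using that finite_shapes key_inj by auto
    fix W W' a t u
    assume "W \<in> Collect (orthogonal_module R)" "W' \<in> Collect (orthogonal_module R)" "a \<in> foldings W W'"
    then obtain \<sigma> where W: "orthogonal_module R W" "orthogonal_module R W'" "folding W W' \<sigma>"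
      and a: "a = postcomp (fold_map W W' \<sigma>)" by (auto simp: foldings_def)
    show "a t \<in> shapes W'" if "t \<in> shapes W"
      unfolding a by (rule postcomp_shapes[OF W(1,2) fold_map(1)[OF W] that])
    show "key W' (a t) < key W' (a u)" if "t \<in> shapes W" "u \<in> shapes W" "key W t < key W u"
      unfolding a by (rule key_fold_map_mono[OF W that])
  qed (rule almost_full_foldings)
qed

end


section \<open>From relations to the left Kan extension\<close>

lemma left_module_zero_smult:
  assumes "left_module K F" "x \<in> carrier F"
  shows "\<zero>\<^bsub>K\<^esub> \<odot>\<^bsub>F\<^esub> x = \<zero>\<^bsub>F\<^esub>"
proof -
  interpret left_module K F by fact
  have "\<zero>\<^bsub>K\<^esub> \<odot>\<^bsub>F\<^esub> x = \<zero>\<^bsub>K\<^esub> \<odot>\<^bsub>F\<^esub> x \<oplus>\<^bsub>F\<^esub> \<zero>\<^bsub>K\<^esub> \<odot>\<^bsub>F\<^esub> x"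
    using smult_l_distr[of "\<zero>\<^bsub>K\<^esub>" "\<zero>\<^bsub>K\<^esub>" x] assms(2) by simp
  then show ?thesis using assms(2) by (metis M.add.l_cancel_one R.zero_closed smult_closed)
qed

lemma left_module_minus_one_smult:
  assumes "left_module K F" "x \<in> carrier F"
  shows "(\<ominus>\<^bsub>K\<^esub> \<one>\<^bsub>K\<^esub>) \<odot>\<^bsub>F\<^esub> x = \<ominus>\<^bsub>F\<^esub> x"
proof -
  interpret left_module K F by fact
  have "(\<ominus>\<^bsub>K\<^esub> \<one>\<^bsub>K\<^esub>) \<odot>\<^bsub>F\<^esub> x \<oplus>\<^bsub>F\<^esub> x = (\<ominus>\<^bsub>K\<^esub> \<one>\<^bsub>K\<^esub> \<oplus>\<^bsub>K\<^esub> \<one>\<^bsub>K\<^esub>) \<odot>\<^bsub>F\<^esub> x"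
    using assms(2) by (subst smult_l_distr) auto
  then have "(\<ominus>\<^bsub>K\<^esub> \<one>\<^bsub>K\<^esub>) \<odot>\<^bsub>F\<^esub> x \<oplus>\<^bsub>F\<^esub> x = \<zero>\<^bsub>F\<^esub>"
    using assms by (simp add: R.l_neg left_module_zero_smult)
  then show ?thesis using assms(2) by (metis M.minus_equality R.a_inv_closed R.one_closed smult_closed)
qed

lemma left_module_submoduleI:
  assumes F: "left_module K F" and H: "H \<subseteq> carrier F" "\<zero>\<^bsub>F\<^esub> \<in> H"
    and add: "\<And>x y. \<lbrakk>x \<in> H; y \<in> H\<rbrakk> \<Longrightarrow> x \<oplus>\<^bsub>F\<^esub> y \<in> H"
    and smult: "\<And>a x. \<lbrakk>a \<in> carrier K; x \<in> H\<rbrakk> \<Longrightarrow> a \<odot>\<^bsub>F\<^esub> x \<in> H"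
  shows "submodule H K F"
proof -
  interpret left_module K F by fact
  have "\<ominus>\<^bsub>F\<^esub> x \<in> H" if "x \<in> H" for x
    using smult[of "\<ominus>\<^bsub>K\<^esub> \<one>\<^bsub>K\<^esub>" x] left_module_minus_one_smult[OF F, of x] H that by auto
  then have "subgroup H (add_monoid F)"
    using H add by (auto intro!: M.add.subgroupI simp flip: a_inv_def)
  then show ?thesis using smult by (auto intro!: submodule.intro submodule_axioms.intro)
qed

section \<open>Sums of representable functors mapping to a module\<close>

locale hom_generators =
  fixes C :: "('o, 'a) cat" and K :: "('k, 'p) ring_scheme" and S :: "'s set" and E :: "'s \<Rightarrow> 'o"
  assumes cat: "category C" and ring_K: "ring K"
    and E_Obj: "s \<in> S \<Longrightarrow> E s \<in> Obj C"
    and finite_arrows: "W \<in> Obj C \<Longrightarrow> finite (SIGMA s:S. Hom C (E s) W)"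
begin

text \<open>Basis at \<open>W\<close> of the sum of the representable functors of the objects
  \<open>E s\<close>; it is finite, so coefficient functions on it form the free module.\<close>

definition arrows :: "'o \<Rightarrow> ('s \<times> 'a) set"
  where "arrows W = (SIGMA s:S. Hom C (E s) W)"

definition postcompose :: "'o \<Rightarrow> 'o \<Rightarrow> 'a \<Rightarrow> 's \<times> 'a \<Rightarrow> 's \<times> 'a"
  where "postcompose U V g = (\<lambda>(s, f). (s, Cmp C (E s) U V g f))"

definition gen_image :: "('o, 'a, 'k, 'm) catmod \<Rightarrow> ('s \<Rightarrow> 'm) \<Rightarrow> 'o \<Rightarrow> 's \<times> 'a \<Rightarrow> 'm"
  where "gen_image M x W = (\<lambda>(s, f). far M (E s) W f (x s))"

text \<open>The Yoneda map from the free module on arrows to \<open>M\<close> at \<open>W\<close>,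
  determined by the elements \<open>x s\<close>.\<close>

definition comb :: "('o, 'a, 'k, 'm) catmod \<Rightarrow> ('s \<Rightarrow> 'm) \<Rightarrow> 'o \<Rightarrow> ('s \<times> 'a \<Rightarrow> 'k) \<Rightarrow> 'm"
  where "comb M x W c = (\<Oplus>\<^bsub>fob M W\<^esub>t\<in>arrows W. c t \<odot>\<^bsub>fob M W\<^esub> gen_image M x W t)"

definition gen_family :: "('o, 'a, 'k, 'm) catmod \<Rightarrow> ('s \<Rightarrow> 'm) \<Rightarrow> bool"
  where "gen_family M x \<longleftrightarrow> cat_module C K M \<and> (\<forall>s\<in>S. x s \<in> carrier (fob M (E s)))"

lemma fin_arrows: "W \<in> Obj C \<Longrightarrow> finite (arrows W)"
  using finite_arrows by (simp add: arrows_def)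

lemma postcompose_arrows:
  assumes "U \<in> Obj C" "V \<in> Obj C" "g \<in> Hom C U V" "t \<in> arrows U"
  shows "postcompose U V g t \<in> arrows V"
  using assms categoryD(2)[OF cat _ assms(3) E_Obj assms(1,2)] by (auto simp: arrows_def postcompose_def)

lemma gen_image_closed:
  assumes M: "gen_family M x" and W: "W \<in> Obj C" "t \<in> arrows W"
  shows "gen_image M x W t \<in> carrier (fob M W)"
proof -
  obtain s f where t: "t = (s, f)" "s \<in> S" "f \<in> Hom C (E s) W" using W(2) by (auto simp: arrows_def)
  have "far M (E s) W f \<in> linear_maps K (fob M (E s)) (fob M W)"
    by (rule cat_moduleD(2)[OF _ t(3) E_Obj[OF t(2)] W(1)]) (use M in \<open>simp add: gen_family_def\<close>)
  from linear_mapsD(1)[OF this] show ?thesis using M t by (simp add: gen_image_def gen_family_def)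
qed

lemma gen_image_postcompose:
  assumes M: "gen_family M x" and g: "U \<in> Obj C" "V \<in> Obj C" "g \<in> Hom C U V" and t: "t \<in> arrows U"
  shows "gen_image M x V (postcompose U V g t) = far M U V g (gen_image M x U t)"
proof -
  obtain s f where t': "t = (s, f)" "s \<in> S" "f \<in> Hom C (E s) U" using t by (auto simp: arrows_def)
  have "far M (E s) V (Cmp C (E s) U V g f) = compose (carrier (fob M (E s))) (far M U V g) (far M (E s) U f)"
    by (rule cat_moduleD(4)[where K=K, OF _ t'(3) g(3) E_Obj[OF t'(2)] g(1,2)]) (use M in \<open>simp add: gen_family_def\<close>)
  then show ?thesis
    using M t' by (simp add: gen_image_def postcompose_def gen_family_def compose_eq)
qed

lemma comb_closed:
  assumes M: "gen_family M x" and W: "W \<in> Obj C" and c: "\<And>t. t \<in> arrows W \<Longrightarrow> c t \<in> carrier K"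
  shows "comb M x W c \<in> carrier (fob M W)"
proof -
  interpret left_module K "fob M W" using M W by (auto simp: gen_family_def dest: cat_moduleD)
  show ?thesis unfolding comb_def using gen_image_closed[OF M W] c by (intro M.finsum_closed) auto
qed

lemma comb_linear:
  assumes M: "gen_family M x" and W: "W \<in> Obj C" and r: "r \<in> carrier K"
    and c: "\<And>t. t \<in> arrows W \<Longrightarrow> c t \<in> carrier K" and d: "\<And>t. t \<in> arrows W \<Longrightarrow> d t \<in> carrier K"
  shows "comb M x W (\<lambda>t\<in>arrows W. c t \<oplus>\<^bsub>K\<^esub> r \<otimes>\<^bsub>K\<^esub> d t) = comb M x W c \<oplus>\<^bsub>fob M W\<^esub> r \<odot>\<^bsub>fob M W\<^esub> comb M x W d"
proof -
  interpret left_module K "fob M W" using M W by (auto simp: gen_family_def dest: cat_moduleD)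
  note y = gen_image_closed[OF M W]
  let ?y = "gen_image M x W"
  have l: "(\<lambda>z\<in>carrier (fob M W). r \<odot>\<^bsub>fob M W\<^esub> z) (\<Oplus>\<^bsub>fob M W\<^esub>t\<in>T. h t) = (\<Oplus>\<^bsub>fob M W\<^esub>t\<in>T. r \<odot>\<^bsub>fob M W\<^esub> h t)"
    if "finite T" "h \<in> T \<rightarrow> carrier (fob M W)" for T h
    using that
  proof (induction T)
    case empty
    then show ?case using left_module_smult_zero[OF left_module_axioms r] by simp
  next
    case (insert t T)
    then show ?case using r by (simp add: Pi_iff smult_r_distr)
  qed
  have "r \<odot>\<^bsub>fob M W\<^esub> comb M x W d = (\<Oplus>\<^bsub>fob M W\<^esub>t\<in>arrows W. r \<odot>\<^bsub>fob M W\<^esub> (d t \<odot>\<^bsub>fob M W\<^esub> ?y t))"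
    using l[OF fin_arrows[OF W], of "\<lambda>t. d t \<odot>\<^bsub>fob M W\<^esub> ?y t"] comb_closed[OF M W d] y d
    by (auto simp: comb_def)
  then have "comb M x W c \<oplus>\<^bsub>fob M W\<^esub> r \<odot>\<^bsub>fob M W\<^esub> comb M x W d =
      (\<Oplus>\<^bsub>fob M W\<^esub>t\<in>arrows W. c t \<odot>\<^bsub>fob M W\<^esub> ?y t \<oplus>\<^bsub>fob M W\<^esub> r \<odot>\<^bsub>fob M W\<^esub> (d t \<odot>\<^bsub>fob M W\<^esub> ?y t))"
    using y c d r M.finsum_addf[of "\<lambda>t. c t \<odot>\<^bsub>fob M W\<^esub> ?y t" "arrows W"
      "\<lambda>t. r \<odot>\<^bsub>fob M W\<^esub> (d t \<odot>\<^bsub>fob M W\<^esub> ?y t)"] by (simp add: comb_def[of M x W c] Pi_iff)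
  also have "\<dots> = (\<Oplus>\<^bsub>fob M W\<^esub>t\<in>arrows W. (\<lambda>t\<in>arrows W. c t \<oplus>\<^bsub>K\<^esub> r \<otimes>\<^bsub>K\<^esub> d t) t \<odot>\<^bsub>fob M W\<^esub> ?y t)"
    using y c d r by (intro M.finsum_cong') (auto simp: smult_l_distr smult_assoc1)
  finally show ?thesis by (simp add: comb_def)
qed

lemma comb_zero:
  assumes M: "gen_family M x" and W: "W \<in> Obj C"
  shows "comb M x W (\<lambda>t\<in>arrows W. \<zero>\<^bsub>K\<^esub>) = \<zero>\<^bsub>fob M W\<^esub>"
proof -
  interpret left_module K "fob M W" using M W by (auto simp: gen_family_def dest: cat_moduleD)
  show ?thesis unfolding comb_def
    using gen_image_closed[OF M W] left_module_zero_smult[OF left_module_axioms]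
    by (intro M.add.finprod_one_eqI) auto
qed

lemma comb_delta:
  assumes M: "gen_family M x" and W: "W \<in> Obj C" and t: "t \<in> arrows W"
  shows "comb M x W (\<lambda>u\<in>arrows W. if t = u then \<one>\<^bsub>K\<^esub> else \<zero>\<^bsub>K\<^esub>) = gen_image M x W t"
proof -
  interpret left_module K "fob M W" using M W by (auto simp: gen_family_def dest: cat_moduleD)
  note y = gen_image_closed[OF M W]
  have "comb M x W (\<lambda>u\<in>arrows W. if t = u then \<one>\<^bsub>K\<^esub> else \<zero>\<^bsub>K\<^esub>) =
      (\<Oplus>\<^bsub>fob M W\<^esub>u\<in>arrows W. if t = u then gen_image M x W u else \<zero>\<^bsub>fob M W\<^esub>)"
    unfolding comb_def
    using y left_module_zero_smult[OF left_module_axioms] by (intro M.finsum_cong') auto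
  also have "\<dots> = gen_image M x W t"
    using y t fin_arrows[OF W] by (intro M.finsum_singleton) auto
  finally show ?thesis .
qed

definition comb_range :: "('o, 'a, 'k, 'm) catmod \<Rightarrow> ('s \<Rightarrow> 'm) \<Rightarrow> 'o \<Rightarrow> 'm set"
  where "comb_range M x W = comb M x W ` (arrows W \<rightarrow>\<^sub>E carrier K)"

lemma comb_range_linear:
  assumes M: "gen_family M x" and W: "W \<in> Obj C" and r: "r \<in> carrier K"
    and y: "y \<in> comb_range M x W" "z \<in> comb_range M x W"
  shows "y \<oplus>\<^bsub>fob M W\<^esub> r \<odot>\<^bsub>fob M W\<^esub> z \<in> comb_range M x W"
proof -
  interpret K: ring K by (rule ring_K)
  obtain c d where cd: "c \<in> arrows W \<rightarrow>\<^sub>E carrier K" "d \<in> arrows W \<rightarrow>\<^sub>E carrier K"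
    "y = comb M x W c" "z = comb M x W d" using y by (auto simp: comb_range_def)
  have cdK: "c t \<in> carrier K" "d t \<in> carrier K" if "t \<in> arrows W" for t using cd(1,2) that by auto
  have "y \<oplus>\<^bsub>fob M W\<^esub> r \<odot>\<^bsub>fob M W\<^esub> z = comb M x W (\<lambda>t\<in>arrows W. c t \<oplus>\<^bsub>K\<^esub> r \<otimes>\<^bsub>K\<^esub> d t)"
    unfolding cd(3,4) by (rule comb_linear[OF M W r cdK, symmetric])
  moreover have "(\<lambda>t\<in>arrows W. c t \<oplus>\<^bsub>K\<^esub> r \<otimes>\<^bsub>K\<^esub> d t) \<in> arrows W \<rightarrow>\<^sub>E carrier K"
    using cdK r by auto
  ultimately show ?thesis unfolding comb_range_def by blast
qed

lemma comb_range_submodule: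
  assumes M: "gen_family M x" and W: "W \<in> Obj C"
  shows "submodule (comb_range M x W) K (fob M W)"
proof -
  interpret left_module K "fob M W" using M W by (auto simp: gen_family_def dest: cat_moduleD)
  have sub: "comb_range M x W \<subseteq> carrier (fob M W)"
    using comb_closed[OF M W] by (auto simp: comb_range_def)
  have zero: "\<zero>\<^bsub>fob M W\<^esub> \<in> comb_range M x W"
    using comb_zero[OF M W]
    by (auto simp: comb_range_def intro!: image_eqI[of _ _ "\<lambda>t\<in>arrows W. \<zero>\<^bsub>K\<^esub>"])
  note lin = comb_range_linear[OF M W]
  show ?thesis
  proof (rule left_module_submoduleI[OF left_module_axioms sub zero])
    fix y z assume yz: "y \<in> comb_range M x W" "z \<in> comb_range M x W"
    then show "y \<oplus>\<^bsub>fob M W\<^esub> z \<in> comb_range M x W"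
      using lin[OF R.one_closed yz] sub by (auto simp: subset_iff)
  next
    fix r z assume rz: "r \<in> carrier K" "z \<in> comb_range M x W"
    then show "r \<odot>\<^bsub>fob M W\<^esub> z \<in> comb_range M x W"
      using lin[OF rz(1) zero rz(2)] sub by (auto simp: subset_iff)
  qed
qed

lemma gen_image_comb_range:
  assumes M: "gen_family M x" and W: "W \<in> Obj C" and t: "t \<in> arrows W"
  shows "gen_image M x W t \<in> comb_range M x W"
proof -
  interpret K: ring K by (rule ring_K)
  have "(\<lambda>u\<in>arrows W. if t = u then \<one>\<^bsub>K\<^esub> else \<zero>\<^bsub>K\<^esub>) \<in> arrows W \<rightarrow>\<^sub>E carrier K" by auto
  from imageI[OF this, of "comb M x W"] show ?thesis unfolding comb_range_def comb_delta[OF assms] .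
qed

lemma far_comb:
  assumes M: "gen_family M x" and g: "U \<in> Obj C" "V \<in> Obj C" "g \<in> Hom C U V"
    and c: "\<And>t. t \<in> arrows U \<Longrightarrow> c t \<in> carrier K"
  shows "far M U V g (comb M x U c) =
    (\<Oplus>\<^bsub>fob M V\<^esub>t\<in>arrows U. c t \<odot>\<^bsub>fob M V\<^esub> gen_image M x V (postcompose U V g t))"
proof -
  have CM: "cat_module C K M" using M by (simp add: gen_family_def)
  interpret U: left_module K "fob M U" by (rule cat_moduleD(1)[OF CM g(1)])
  interpret V: left_module K "fob M V" by (rule cat_moduleD(1)[OF CM g(2)])
  note l = cat_moduleD(2)[OF CM g(3,1,2)]
  note y = gen_image_closed[OF M]
  have "far M U V g (comb M x U c) = (\<Oplus>\<^bsub>fob M V\<^esub>t\<in>arrows U. far M U V g (c t \<odot>\<^bsub>fob M U\<^esub> gen_image M x U t))"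
    unfolding comb_def
    by (rule linear_maps_finsum[OF l U.left_module_axioms V.left_module_axioms fin_arrows[OF g(1)]])
      (use c y g in auto)
  also have "\<dots> = (\<Oplus>\<^bsub>fob M V\<^esub>t\<in>arrows U. c t \<odot>\<^bsub>fob M V\<^esub> gen_image M x V (postcompose U V g t))"
    by (rule V.M.finsum_cong')
      (use c y g postcompose_arrows[OF g] gen_image_postcompose[OF M g] linear_mapsD[OF l] in auto)
  finally show ?thesis .
qed

text \<open>Turns generation by the \<open>x s\<close> into surjectivity of \<open>comb\<close>: a
  submodule containing the generators is everything.\<close>

lemma comb_range_cat_submodule:
  fixes M :: "('o, 'a, 'k, 'm) catmod"
  assumes M: "gen_family M x"
  shows "cat_submodule C K M (comb_range M x)"
  unfolding cat_submodule_def
proof (intro conjI ballI)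
  show "submodule (comb_range M x U) K (fob M U)" if "U \<in> Obj C" for U
    by (rule comb_range_submodule[OF M that])
  fix U V g assume g: "U \<in> Obj C" "V \<in> Obj C" "g \<in> Hom C U V"
  interpret V: left_module K "fob M V" using M g by (auto simp: gen_family_def dest: cat_moduleD)
  note sub = comb_range_submodule[OF M g(2)]
  have sg: "subgroup (comb_range M x V) (add_monoid (fob M V))" using sub by (simp add: submodule_def)
  have sum: "(\<Oplus>\<^bsub>fob M V\<^esub>t\<in>T. h t) \<in> comb_range M x V" if "finite T" "\<And>t. t \<in> T \<Longrightarrow> h t \<in> comb_range M x V" for T and h :: "'s \<times> 'a \<Rightarrow> 'm"
    using that
  proof (induction T)
    case empty
    then show ?case using subgroup.one_closed[OF sg] by simp
  next
    case (insert t T)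
    have "h u \<in> carrier (fob M V)" if "u \<in> insert t T" for u
      using insert.prems[OF that] subgroup.subset[OF sg] by auto
    then show ?case using insert subgroup.m_closed[OF sg] by (simp add: Pi_iff)
  qed
  show "far M U V g ` comb_range M x U \<subseteq> comb_range M x V"
  proof (rule image_subsetI)
    fix y assume "y \<in> comb_range M x U"
    then obtain c where c: "c \<in> arrows U \<rightarrow>\<^sub>E carrier K" "y = comb M x U c" by (auto simp: comb_range_def)
    have cK: "c t \<in> carrier K" if "t \<in> arrows U" for t using c(1) that by auto
    show "far M U V g y \<in> comb_range M x V"
      unfolding c(2)
    proof (subst far_comb[OF M g cK])
      show "(\<Oplus>\<^bsub>fob M V\<^esub>t\<in>arrows U. c t \<odot>\<^bsub>fob M V\<^esub> gen_image M x V (postcompose U V g t)) \<in> comb_range M x V"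
        using cK postcompose_arrows[OF g] gen_image_comb_range[OF M g(2)]
        by (intro sum[OF fin_arrows[OF g(1)]] submodule.smult_closed[OF sub]) blast+
    qed
  qed
qed

text \<open>Naturality at each arrow sends generator images to generator images; linearity extends
  this to combinations.\<close>

lemma comb_nat_trans:
  assumes M: "gen_family M x" and M': "gen_family M' x'" and \<tau>: "nat_trans C K M M' \<tau>"
    and x: "\<And>s. s \<in> S \<Longrightarrow> \<tau> (E s) (x s) = x' s"
    and W: "W \<in> Obj C" and c: "\<And>t. t \<in> arrows W \<Longrightarrow> c t \<in> carrier K"
  shows "\<tau> W (comb M x W c) = comb M' x' W c"
proof -
  interpret W: left_module K "fob M W" using M W by (auto simp: gen_family_def dest: cat_moduleD)
  interpret W': left_module K "fob M' W" using M' W by (auto simp: gen_family_def dest: cat_moduleD)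
  note l = nat_transD(1)[OF \<tau> W]
  note y = gen_image_closed[OF M W] and y' = gen_image_closed[OF M' W]
  have img: "\<tau> W (gen_image M x W t) = gen_image M' x' W t" if "t \<in> arrows W" for t
  proof -
    obtain s f where t: "t = (s, f)" "s \<in> S" "f \<in> Hom C (E s) W" using \<open>t \<in> arrows W\<close> by (auto simp: arrows_def)
    have "x s \<in> carrier (fob M (E s))" using M t by (simp add: gen_family_def)
    from nat_transD(2)[OF \<tau> t(3) E_Obj[OF t(2)] W this]
    show ?thesis using t x[OF t(2)] by (simp add: gen_image_def)
  qed
  have "\<tau> W (comb M x W c) = (\<Oplus>\<^bsub>fob M' W\<^esub>t\<in>arrows W. \<tau> W (c t \<odot>\<^bsub>fob M W\<^esub> gen_image M x W t))"
    unfolding comb_def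
    by (rule linear_maps_finsum[OF l W.left_module_axioms W'.left_module_axioms fin_arrows[OF W]])
      (use c y in auto)
  also have "\<dots> = comb M' x' W c" unfolding comb_def
    by (rule W'.M.finsum_cong') (use c y y' img linear_mapsD[OF l] in auto)
  finally show ?thesis .
qed

definition kernel :: "('o, 'a, 'k, 'm) catmod \<Rightarrow> ('s \<Rightarrow> 'm) \<Rightarrow> 'o \<Rightarrow> ('s \<times> 'a \<Rightarrow> 'k) set"
  where "kernel M x W = {c \<in> arrows W \<rightarrow>\<^sub>E carrier K. comb M x W c = \<zero>\<^bsub>fob M W\<^esub>}"

text \<open>Applying \<open>far M\<close> after \<open>comb\<close> is \<open>comb\<close> after
  \<open>push\<close>; injectivity of the morphism on arrows reindexes the sum.\<close>

lemma kernel_coeff_family: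
  assumes os: "ordered_shapes K (Obj C) arrows key Mor"
    and Mor: "\<And>U V a. \<lbrakk>U \<in> Obj C; V \<in> Obj C; a \<in> Mor U V\<rbrakk> \<Longrightarrow> \<exists>g\<in>Hom C U V. a = postcompose U V g"
    and M: "gen_family M x"
  shows "ordered_shapes.coeff_family K (Obj C) arrows Mor (kernel M x)"
proof -
  interpret ordered_shapes K "Obj C" arrows key Mor by (rule os)
  have lm: "left_module K (fob M W)" if "W \<in> Obj C" for W
    using M that by (auto simp: gen_family_def dest: cat_moduleD)
  have kD: "c t \<in> carrier K" if "c \<in> kernel M x W" "t \<in> arrows W" for c t W
    using that by (auto simp: kernel_def)
  show ?thesis unfolding coeff_family_def
  proof (intro conjI ballI)
    fix W assume W: "W \<in> Obj C"
    interpret W: left_module K "fob M W" by (rule lm[OF W])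
    show "kernel M x W \<subseteq> arrows W \<rightarrow>\<^sub>E carrier K" by (auto simp: kernel_def)
    show "(\<lambda>t\<in>arrows W. \<zero>\<^bsub>K\<^esub>) \<in> kernel M x W"
      using comb_zero[OF M W] by (simp add: kernel_def)
    fix c d r assume c: "c \<in> kernel M x W" and d: "d \<in> kernel M x W" and r: "r \<in> carrier K"
    have "comb M x W (\<lambda>t\<in>arrows W. c t \<oplus>\<^bsub>K\<^esub> r \<otimes>\<^bsub>K\<^esub> d t) = comb M x W c \<oplus>\<^bsub>fob M W\<^esub> r \<odot>\<^bsub>fob M W\<^esub> comb M x W d"
      by (rule comb_linear[OF M W r]) (use kD c d in auto)
    also have "\<dots> = \<zero>\<^bsub>fob M W\<^esub>"
      using c d left_module_smult_zero[OF lm[OF W] r] by (simp add: kernel_def)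
    finally have "comb M x W (\<lambda>t\<in>arrows W. c t \<oplus>\<^bsub>K\<^esub> r \<otimes>\<^bsub>K\<^esub> d t) = \<zero>\<^bsub>fob M W\<^esub>" .
    then show "(\<lambda>t\<in>arrows W. c t \<oplus>\<^bsub>K\<^esub> r \<otimes>\<^bsub>K\<^esub> d t) \<in> kernel M x W"
      using kD[OF c] kD[OF d] r by (auto simp: kernel_def)
  next
    fix U V a c assume U: "U \<in> Obj C" and V: "V \<in> Obj C" and a: "a \<in> Mor U V" and c: "c \<in> kernel M x U"
    interpret V: left_module K "fob M V" by (rule lm[OF V])
    obtain g where g: "g \<in> Hom C U V" "a = postcompose U V g" using Mor[OF U V a] by blast
    note cK = kD[OF c]
    note inj = Mor_inj[OF U V a] and img = push_image[OF U V a]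
    have aV: "a t \<in> arrows V" if "t \<in> arrows U" for t using Mor_closed[OF U V a that] .
    have pK: "push U V a c t \<in> carrier K" if "t \<in> arrows V" for t
    proof (cases "t \<in> a ` arrows U")
      case True
      then obtain u where "u \<in> arrows U" "t = a u" by blast
      then show ?thesis using img[of u c] cK[of u] by simp
    qed (use that in \<open>simp add: push_def\<close>)
    \<comment> \<open>Coefficients outside the image vanish, so the sum shrinks to the image before
      being reindexed.\<close>
    have "comb M x V (push U V a c) =
        (\<Oplus>\<^bsub>fob M V\<^esub>t\<in>a ` arrows U. push U V a c t \<odot>\<^bsub>fob M V\<^esub> gen_image M x V t)"
      unfolding comb_def
    proof (rule V.M.add.finprod_mono_neutral_cong_right)
      fix t assume "t \<in> arrows V - a ` arrows U"
      then show "push U V a c t \<odot>\<^bsub>fob M V\<^esub> gen_image M x V t = \<zero>\<^bsub>fob M V\<^esub>"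
        using left_module_zero_smult[OF lm[OF V] gen_image_closed[OF M V]] by (simp add: push_def)
    qed (use fin_arrows[OF V] aV pK gen_image_closed[OF M V] in auto)
    also have "\<dots> = (\<Oplus>\<^bsub>fob M V\<^esub>t\<in>arrows U. push U V a c (a t) \<odot>\<^bsub>fob M V\<^esub> gen_image M x V (a t))"
    proof (rule V.M.finsum_reindex[OF _ inj], rule Pi_I)
      fix t assume "t \<in> a ` arrows U"
      then have "t \<in> arrows V" using aV by blast
      then show "push U V a c t \<odot>\<^bsub>fob M V\<^esub> gen_image M x V t \<in> carrier (fob M V)"
        using pK gen_image_closed[OF M V] by (intro V.smult_closed)
    qed
    also have "\<dots> = (\<Oplus>\<^bsub>fob M V\<^esub>t\<in>arrows U. c t \<odot>\<^bsub>fob M V\<^esub> gen_image M x V (postcompose U V g t))"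
      by (rule V.M.finsum_cong') (use img aV cK gen_image_closed[OF M V] in \<open>auto simp: g(2)[symmetric]\<close>)
    also have "\<dots> = far M U V g (comb M x U c)" by (rule far_comb[OF M U V g(1) cK, symmetric])
    also have "\<dots> = far M U V g \<zero>\<^bsub>fob M U\<^esub>" using c by (simp add: kernel_def)
    also have "\<dots> = \<zero>\<^bsub>fob M V\<^esub>"
      using M g(1) U V lm by (intro linear_maps_zero[OF cat_moduleD(2)]) (auto simp: gen_family_def)
    finally have "comb M x V (push U V a c) = \<zero>\<^bsub>fob M V\<^esub>" .
    moreover have "push U V a c \<in> arrows V \<rightarrow>\<^sub>E carrier K" using pK by (auto simp: push_def)
    ultimately show "push U V a c \<in> kernel M x V" by (simp add: kernel_def)
  qed
qed

end

section \<open>Kan extension along the inclusion of a full subcategory\<close>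

lemma full_subcat_simps [simp]:
  "Obj (full_subcat C P) = {U \<in> Obj C. P U}" "Hom (full_subcat C P) = Hom C"
  "Idn (full_subcat C P) = Idn C" "Cmp (full_subcat C P) = Cmp C"
  by (simp_all add: full_subcat_def)

lemma full_subcat_inclusion:
  assumes "category C"
  shows "category (full_subcat C P)" "is_functor (full_subcat C P) C inclusion_functor"
  using assms by (simp_all add: category_def is_functor_def inclusion_functor_def)

text \<open>The projection onto the quotient by \<open>H\<close> and the zero map agree on all
  classes, hence are equal by \<open>lan_hom_ext\<close>.\<close>

lemma lan_class_generate:
  assumes D: "category D" and C: "category C" and p: "is_functor D C p" and K: "ring K"
    and P: "cat_module D K P" and V: "V \<in> Obj C"
    and H: "submodule H K (lan_ob K D C p P V)"
    and cl: "\<And>U \<phi> x. \<lbrakk>U \<in> Obj D; \<phi> \<in> Hom C (fob p U) V; x \<in> carrier (fob P U)\<rbrakk> \<Longrightarrow>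
      lan_class K D C p P V (U, \<phi>) x \<in> H"
  shows "H = carrier (lan_ob K D C p P V)"
proof -
  let ?L = "lan_ob K D C p P V"
  interpret L: left_module K ?L by (rule lan_ob_left_module[OF D C p K P V])
  interpret H: abelian_subgroup H ?L by (rule N_abelian_subgroup[OF L.left_module_axioms H])
  let ?Q = "quotient_module ?L H"
  interpret Q: left_module K ?Q by (rule quotient_left_module[OF L.left_module_axioms H])
  let ?p = "\<lambda>z\<in>carrier ?L. H +>\<^bsub>?L\<^esub> z" and ?o = "\<lambda>z\<in>carrier ?L. \<zero>\<^bsub>?Q\<^esub>"
  have "?p = ?o"
  proof (rule lan_hom_ext[OF D C p K P V Q.left_module_axioms quotient_proj_linear[OF L.left_module_axioms H]])
    show "?o \<in> linear_maps K ?L ?Q"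
      by (rule linear_mapsI) (auto simp: left_module_smult_zero[OF Q.left_module_axioms])
    fix U \<phi> x assume u: "U \<in> Obj D" "\<phi> \<in> Hom C (fob p U) V" "x \<in> carrier (fob P U)"
    show "?p (lan_class K D C p P V (U, \<phi>) x) = ?o (lan_class K D C p P V (U, \<phi>) x)"
      using cl[OF u] H.a_rcos_const[OF cl[OF u]] H.a_Hcarr by (simp add: quotient_module_simps)
  qed
  note po = this
  have coset: "H +>\<^bsub>?L\<^esub> z = H" if "z \<in> carrier ?L" for z
    using fun_cong[OF po, of z] that by (simp add: quotient_module_simps)
  then show ?thesis using H.a_rcos_self H.a_subset by blast
qed

context hom_generators
begin

text \<open>Over the subcategory the canonical map and the unit are mutually inverse. Hence the
  extension is generated by the images of the \<open>x s\<close> and has the same relations as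
  \<open>M\<close> on \<open>F\<close>, so everywhere; this makes the canonical map
  bijective.\<close>

theorem lan_of_restriction:
  fixes M :: "('o, 'a, 'k, 'm) catmod"
  assumes os: "ordered_shapes K (Obj C) arrows key Mor"
    and Mor: "\<And>U V a. \<lbrakk>U \<in> Obj C; V \<in> Obj C; a \<in> Mor U V\<rbrakk> \<Longrightarrow> \<exists>g\<in>Hom C U V. a = postcompose U V g"
    and M: "gen_family M x"
    and gen: "\<And>L U. \<lbrakk>cat_submodule C K M L; \<And>s. s \<in> S \<Longrightarrow> x s \<in> L (E s); U \<in> Obj C\<rbrakk> \<Longrightarrow> L U = carrier (fob M U)"
  obtains F where "finite F" "F \<subseteq> Obj C"
    "\<And>P. \<lbrakk>\<And>W. W \<in> F \<Longrightarrow> P W; \<And>s. s \<in> S \<Longrightarrow> P (E s)\<rbrakk> \<Longrightarrow>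
      is_lan_of_restriction K (full_subcat C P) C inclusion_functor M"
proof -
  interpret ordered_shapes K "Obj C" arrows key Mor by (rule os)
  obtain F where F: "finite F" "F \<subseteq> Obj C"
    and det: "\<And>L U. \<lbrakk>coeff_family L; \<And>V. V \<in> Obj C \<Longrightarrow> L V \<subseteq> kernel M x V;
      \<And>V. V \<in> F \<Longrightarrow> L V = kernel M x V; U \<in> Obj C\<rbrakk> \<Longrightarrow> L U = kernel M x U"
    by (rule coeff_family_determined[OF kernel_coeff_family[of key Mor M x, OF os Mor M]]) blast+
  show thesis
  proof (rule that[OF F])
    fix P assume PF: "\<And>W. W \<in> F \<Longrightarrow> P W" and PE: "\<And>s. s \<in> S \<Longrightarrow> P (E s)"
    let ?D = "full_subcat C P" and ?p = "inclusion_functor :: ('o, 'a, 'o, 'a) funct"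
    let ?Q = "pullback ?p M"
    let ?L = "lan K ?D C ?p ?Q" and ?\<kappa> = "lan_canonical K ?D C ?p M" and ?\<eta> = "lan_unit K ?D C ?p ?Q"
    have CM: "cat_module C K M" using M by (simp add: gen_family_def)
    note ctx = full_subcat_inclusion(1)[OF cat, of P] cat full_subcat_inclusion(2)[OF cat, of P] ring_K
    note Q = pullback_cat_module[OF ctx(3) CM]
    note ctxQ = ctx Q
    have pU [simp]: "fob ?p U = U" "far ?p U V f = f" for U V f by (simp_all add: inclusion_functor_def)
    have LM: "cat_module C K ?L" by (rule lan_cat_module[OF ctxQ])
    have Lob: "fob ?L W = lan_ob K ?D C ?p ?Q W" for W by (simp add: lan_def)
    have \<kappa>: "nat_trans C K ?L M ?\<kappa>" by (rule lan_canonical_unit(1)[OF ctx CM])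
    have \<kappa>l: "?\<kappa> W \<in> linear_maps K (fob ?L W) (fob M W)" if "W \<in> Obj C" for W
      by (rule nat_transD(1)[OF \<kappa> that])
    have \<eta>: "nat_trans ?D K ?Q (pullback ?p ?L) ?\<eta>" by (rule lan_unit_nat_trans[OF ctxQ])
    have \<eta>l: "?\<eta> W \<in> linear_maps K (fob M W) (fob ?L W)" if "W \<in> Obj C" "P W" for W
      using nat_transD(1)[OF \<eta>, of W] that by simp
    have \<kappa>\<eta>: "?\<kappa> W (?\<eta> W m) = m" if "W \<in> Obj C" "P W" "m \<in> carrier (fob M W)" for W m
      using fun_cong[OF lan_canonical_unit(2)[OF ctx CM, of W], of m] that by (simp add: compose_eq)
    \<comment> \<open>For \<open>W\<close> in the subcategory, \<open>W\<close> with its identity is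
      terminal in the comma category, so every class is a value of the unit.\<close>
    have \<eta>class: "lan_class K ?D C ?p ?Q W (U, \<phi>) m = ?\<eta> W (far M U W \<phi> m)"
      if "W \<in> Obj C" "P W" "U \<in> Obj C" "P U" "\<phi> \<in> Hom C U W" "m \<in> carrier (fob M U)" for W U \<phi> m
      using lan_class_rel[OF ctxQ that(1), of U W \<phi> "Idn C W" m] that categoryD(1,3)[OF cat]
      by (simp add: lan_unit_def)
    have \<eta>\<kappa>: "?\<eta> W (?\<kappa> W z) = z" if W: "W \<in> Obj C" "P W" and z: "z \<in> carrier (fob ?L W)" for W z
    proof -
      interpret LW: left_module K "fob ?L W" by (rule cat_moduleD(1)[OF LM W(1)])
      have "compose (carrier (fob ?L W)) (?\<eta> W) (?\<kappa> W) = (\<lambda>z\<in>carrier (fob ?L W). z)"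
        unfolding Lob
      proof (rule lan_hom_ext[OF ctxQ W(1) LW.left_module_axioms[unfolded Lob]])
        show "compose (carrier (lan_ob K ?D C ?p ?Q W)) (?\<eta> W) (?\<kappa> W) \<in>
            linear_maps K (lan_ob K ?D C ?p ?Q W) (lan_ob K ?D C ?p ?Q W)"
          using linear_maps_compose[OF \<kappa>l[OF W(1)] \<eta>l[OF W] LW.left_module_axioms] by (simp only: Lob)
        show "(\<lambda>z\<in>carrier (lan_ob K ?D C ?p ?Q W). z) \<in> linear_maps K (lan_ob K ?D C ?p ?Q W) (lan_ob K ?D C ?p ?Q W)"
          using LW.left_module_axioms[unfolded Lob] by (intro linear_mapsI) (auto intro: left_module.smult_closed simp: left_module_def abelian_group_def abelian_monoid.a_closed)
        fix U \<phi> m assume "U \<in> Obj ?D" "\<phi> \<in> Hom C (fob ?p U) W" "m \<in> carrier (fob ?Q U)"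
        then have u: "U \<in> Obj C" "P U" "\<phi> \<in> Hom C U W" "m \<in> carrier (fob M U)" by simp_all
        have c: "lan_class K ?D C ?p ?Q W (U, \<phi>) m \<in> carrier (lan_ob K ?D C ?p ?Q W)"
          by (rule lan_class_closed[OF ctxQ W(1)]) (use u in simp_all)
        have f: "far M U W \<phi> m \<in> carrier (fob M W)"
          by (rule linear_mapsD(1)[OF cat_moduleD(2)[OF CM u(3,1) W(1)] u(4)])
        show "compose (carrier (lan_ob K ?D C ?p ?Q W)) (?\<eta> W) (?\<kappa> W) (lan_class K ?D C ?p ?Q W (U, \<phi>) m) =
            (\<lambda>z\<in>carrier (lan_ob K ?D C ?p ?Q W). z) (lan_class K ?D C ?p ?Q W (U, \<phi>) m)"
          using c \<kappa>\<eta>[OF W f] by (simp add: compose_eq \<eta>class[OF W u])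
      qed
      from fun_cong[OF this, of z] show ?thesis using z by (simp add: compose_eq)
    qed
    \<comment> \<open>The generators of \<open>M\<close>, transported to the extension by the unit;
      the subcategory contains their objects.\<close>
    define y where "y s = ?\<eta> (E s) (x s)" for s
    have xc: "x s \<in> carrier (fob M (E s))" if "s \<in> S" for s using M that by (simp add: gen_family_def)
    have L: "gen_family ?L y"
      unfolding gen_family_def y_def using LM linear_mapsD(1)[OF \<eta>l[OF E_Obj PE] xc] by blast
    have yx: "?\<kappa> (E s) (y s) = x s" if "s \<in> S" for s
      unfolding y_def by (rule \<kappa>\<eta>[OF E_Obj[OF that] PE[OF that] xc[OF that]])
    have \<kappa>comb: "?\<kappa> W (comb ?L y W c) = comb M x W c"
      if "W \<in> Obj C" "c \<in> arrows W \<rightarrow>\<^sub>E carrier K" for W c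
      by (rule comb_nat_trans[OF L M \<kappa> yx that(1)]) (use that(2) in auto)
    have Lcomb: "comb ?L y W c \<in> carrier (fob ?L W)"
      if "W \<in> Obj C" "c \<in> arrows W \<rightarrow>\<^sub>E carrier K" for W c
      by (rule comb_closed[OF L that(1)]) (use that(2) in auto)
    have Mrange: "comb_range M x W = carrier (fob M W)" if W: "W \<in> Obj C" for W
    proof (rule gen[OF comb_range_cat_submodule[OF M] _ W])
      fix s assume s: "s \<in> S"
      have t: "(s, Idn C (E s)) \<in> arrows (E s)"
        using s categoryD(1)[OF cat E_Obj[OF s]] by (simp add: arrows_def)
      have "gen_image M x (E s) (s, Idn C (E s)) = x s"
        using cat_moduleD(3)[OF CM E_Obj[OF s]] xc[OF s] by (simp add: gen_image_def)
      then show "x s \<in> comb_range M x (E s)" using gen_image_comb_range[OF M E_Obj[OF s] t] by simp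
    qed
    \<comment> \<open>Over the subcategory \<open>?\<kappa>\<close> is injective, so surjectivity of
      \<open>comb\<close> lifts from \<open>M\<close> to the extension.\<close>
    have LrangeD: "z \<in> comb_range ?L y U" if U: "U \<in> Obj C" "P U" and z: "z \<in> carrier (fob ?L U)" for U z
    proof -
      have "?\<kappa> U z \<in> comb_range M x U" using Mrange[OF U(1)] linear_mapsD(1)[OF \<kappa>l[OF U(1)] z] by simp
      then obtain c where c: "c \<in> arrows U \<rightarrow>\<^sub>E carrier K" "?\<kappa> U z = comb M x U c"
        by (auto simp: comb_range_def)
      have "?\<eta> U (?\<kappa> U z) = ?\<eta> U (?\<kappa> U (comb ?L y U c))"
        unfolding c(2) \<kappa>comb[OF U(1) c(1)] by (rule refl)
      then have "z = comb ?L y U c"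
        unfolding \<eta>\<kappa>[OF U z] \<eta>\<kappa>[OF U Lcomb[OF U(1) c(1)]] .
      then show ?thesis using c(1) by (auto simp: comb_range_def)
    qed
    have Lsub: "far ?L U W \<phi> z \<in> comb_range ?L y W"
      if "U \<in> Obj C" "W \<in> Obj C" "\<phi> \<in> Hom C U W" "z \<in> comb_range ?L y U" for U W \<phi> z
      using comb_range_cat_submodule[OF L] that unfolding cat_submodule_def by blast
    \<comment> \<open>Any class is the image, under an arrow of the category, of a unit value over
      the subcategory, where \<open>LrangeD\<close> applies.\<close>
    have Lrange: "comb_range ?L y W = carrier (fob ?L W)" if W: "W \<in> Obj C" for W
      unfolding Lob
    proof (rule lan_class_generate[OF ctxQ W])
      show "submodule (comb_range ?L y W) K (lan_ob K ?D C ?p ?Q W)"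
        using comb_range_submodule[OF L W] by (simp only: Lob)
      fix U \<phi> m assume "U \<in> Obj ?D" "\<phi> \<in> Hom C (fob ?p U) W" "m \<in> carrier (fob ?Q U)"
      then have u: "U \<in> Obj C" "P U" "\<phi> \<in> Hom C U W" "m \<in> carrier (fob M U)" by simp_all
      note i = categoryD(1)[OF cat u(1)]
      have "far ?L U W \<phi> (lan_class K ?D C ?p ?Q U (U, Idn C U) m) =
          lan_class K ?D C ?p ?Q W (U, Cmp C (fob ?p U) U W \<phi> (Idn C U)) m"
        by (rule lan_far_class[OF ctxQ u(1) W u(3)]) (use u i in simp_all)
      then have "lan_class K ?D C ?p ?Q W (U, \<phi>) m = far ?L U W \<phi> (?\<eta> U m)"
        using categoryD(4)[OF cat u(3,1) W] by (simp add: lan_unit_def)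
      moreover have "?\<eta> U m \<in> comb_range ?L y U"
        by (rule LrangeD[OF u(1,2) linear_mapsD(1)[OF \<eta>l[OF u(1,2)] u(4)]])
      ultimately show "lan_class K ?D C ?p ?Q W (U, \<phi>) m \<in> comb_range ?L y W"
        using Lsub[OF u(1) W u(3)] by simp
    qed
    have sub: "kernel ?L y W \<subseteq> kernel M x W" if W: "W \<in> Obj C" for W
    proof
      fix c assume "c \<in> kernel ?L y W"
      then have c: "c \<in> arrows W \<rightarrow>\<^sub>E carrier K" "comb ?L y W c = \<zero>\<^bsub>fob ?L W\<^esub>" by (auto simp: kernel_def)
      have "comb M x W c = ?\<kappa> W \<zero>\<^bsub>fob ?L W\<^esub>" unfolding c(2)[symmetric] by (rule \<kappa>comb[OF W c(1), symmetric])
      also have "\<dots> = \<zero>\<^bsub>fob M W\<^esub>"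
        by (rule linear_maps_zero[OF \<kappa>l[OF W] cat_moduleD(1)[OF LM W] cat_moduleD(1)[OF CM W]])
      finally show "c \<in> kernel M x W" using c(1) by (simp add: kernel_def)
    qed
    \<comment> \<open>On \<open>F\<close> the unit carries relations of \<open>M\<close> back to
      relations of the extension.\<close>
    have eqF: "kernel ?L y W = kernel M x W" if "W \<in> F" for W
    proof (rule antisym)
      have W: "W \<in> Obj C" "P W" using that F(2) PF by auto
      show "kernel ?L y W \<subseteq> kernel M x W" by (rule sub[OF W(1)])
      show "kernel M x W \<subseteq> kernel ?L y W"
      proof
        fix c assume "c \<in> kernel M x W"
        then have c: "c \<in> arrows W \<rightarrow>\<^sub>E carrier K" "comb M x W c = \<zero>\<^bsub>fob M W\<^esub>" by (auto simp: kernel_def)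
        have "comb ?L y W c = ?\<eta> W (comb M x W c)"
          using \<eta>\<kappa>[OF W Lcomb[OF W(1) c(1)]] \<kappa>comb[OF W(1) c(1)] by simp
        also have "\<dots> = \<zero>\<^bsub>fob ?L W\<^esub>" unfolding c(2)
          by (rule linear_maps_zero[OF \<eta>l[OF W] cat_moduleD(1)[OF CM W(1)] cat_moduleD(1)[OF LM W(1)]])
        finally show "c \<in> kernel ?L y W" using c(1) by (simp add: kernel_def)
      qed
    qed
    \<comment> \<open>Finite determination of \<open>kernel M x\<close> extends the equality from
      \<open>F\<close> to all objects.\<close>
    have ker: "kernel ?L y W = kernel M x W" if "W \<in> Obj C" for W
      by (rule det[OF kernel_coeff_family[OF os Mor L] sub eqF that])
    have "bij_betw (?\<kappa> W) (carrier (fob ?L W)) (carrier (fob M W))" if W: "W \<in> Obj C" for W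
    proof -
      interpret LW: left_module K "fob ?L W" by (rule cat_moduleD(1)[OF LM W])
      interpret MW: left_module K "fob M W" by (rule cat_moduleD(1)[OF CM W])
      \<comment> \<open>The coefficients of \<open>z\<close> in the generators form a relation in
        \<open>M\<close>, hence a relation in the extension.\<close>
      have z0: "z = \<zero>\<^bsub>fob ?L W\<^esub>" if z: "z \<in> carrier (fob ?L W)" "?\<kappa> W z = \<zero>\<^bsub>fob M W\<^esub>" for z
      proof -
        obtain c where c: "c \<in> arrows W \<rightarrow>\<^sub>E carrier K" "z = comb ?L y W c"
          using z(1) unfolding Lrange[OF W, symmetric] by (auto simp: comb_range_def)
        then have "c \<in> kernel M x W" using z(2) \<kappa>comb[OF W c(1)] by (simp add: kernel_def)
        then show ?thesis using ker[OF W] c(2) by (auto simp: kernel_def)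
      qed
      have "inj_on (?\<kappa> W) (carrier (fob ?L W))"
      proof (rule inj_onI)
        fix z z' assume z: "z \<in> carrier (fob ?L W)" "z' \<in> carrier (fob ?L W)" "?\<kappa> W z = ?\<kappa> W z'"
        have "?\<kappa> W (z \<ominus>\<^bsub>fob ?L W\<^esub> z') = ?\<kappa> W z \<ominus>\<^bsub>fob M W\<^esub> ?\<kappa> W z'"
          by (rule linear_maps_minus[OF \<kappa>l[OF W] LW.left_module_axioms MW.left_module_axioms z(1,2)])
        also have "\<dots> = \<zero>\<^bsub>fob M W\<^esub>"
          using z(3) linear_mapsD(1)[OF \<kappa>l[OF W] z(2)] by (simp add: a_minus_def MW.M.r_neg)
        finally have "z \<ominus>\<^bsub>fob ?L W\<^esub> z' = \<zero>\<^bsub>fob ?L W\<^esub>" by (rule z0[OF LW.M.minus_closed[OF z(1,2)]])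
        moreover have "z = (z \<ominus>\<^bsub>fob ?L W\<^esub> z') \<oplus>\<^bsub>fob ?L W\<^esub> z'"
          using z by (simp add: a_minus_def LW.M.a_assoc LW.M.l_neg)
        ultimately show "z = z'" using z(2) by simp
      qed
      moreover have "?\<kappa> W ` carrier (fob ?L W) = carrier (fob M W)"
      proof
        show "?\<kappa> W ` carrier (fob ?L W) \<subseteq> carrier (fob M W)"
          using linear_mapsD(1)[OF \<kappa>l[OF W]] by blast
        show "carrier (fob M W) \<subseteq> ?\<kappa> W ` carrier (fob ?L W)"
        proof
          fix m assume "m \<in> carrier (fob M W)"
          then obtain c where c: "c \<in> arrows W \<rightarrow>\<^sub>E carrier K" "m = comb M x W c"
            unfolding Mrange[OF W, symmetric] by (auto simp: comb_range_def)
          show "m \<in> ?\<kappa> W ` carrier (fob ?L W)"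
            using \<kappa>comb[OF W c(1)] c(2) Lcomb[OF W c(1)] by (metis imageI)
        qed
      qed
      ultimately show ?thesis by (simp add: bij_betw_def)
    qed
    then show "is_lan_of_restriction K ?D C ?p M"
      using \<kappa> by (simp add: is_lan_of_restriction_def nat_iso_def)
  qed
qed

end


section \<open>Orthogonal modules over a finite ring\<close>

theorem theorem4p13:
  fixes R :: "'r ring"
    and K :: "'k ring"
    and M :: "(('r, 'v) orth, 'v \<Rightarrow> 'v, 'k, 'm) catmod"
  assumes "infinite (UNIV :: 'v set)"
    and "cring R"
    and "finite (carrier R)"
    and "\<one>\<^bsub>R\<^esub> \<oplus>\<^bsub>R\<^esub> \<one>\<^bsub>R\<^esub> \<in> Units R"
    and "left_noetherian_ring K"
    and "cat_module (OrI R) K M"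
    and "cat_module_fin_gen (OrI R) K M"
  shows "\<forall>\<^sub>F N in sequentially.
    is_lan_of_restriction K (OrI_le R N) (OrI R) inclusion_functor M"
proof -
  let ?C = "OrI R :: (('r, 'v) orth, 'v \<Rightarrow> 'v) cat"
  have C: "Obj ?C = Collect (orthogonal_module R)" "Hom ?C = isometries R"
    "\<And>U V W g f. Cmp ?C U V W g f = compose (carrier (fst U)) g f"
    by (simp_all add: OrI_def)
  obtain S where S: "finite S" "S \<subseteq> (SIGMA U:Obj ?C. carrier (fob M U))"
    and gen': "\<forall>L. cat_submodule ?C K M L \<and> (\<forall>(U, x)\<in>S. x \<in> L U) \<longrightarrow>
      (\<forall>U\<in>Obj ?C. L U = carrier (fob M U))"
    using assms(7) unfolding cat_module_fin_gen_def by (elim exE conjE)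
  have gen: "L U = carrier (fob M U)"
    if "cat_submodule ?C K M L" "\<forall>(U, x)\<in>S. x \<in> L U" "U \<in> Obj ?C" for L U
    using gen'[THEN spec, THEN mp, OF conjI, OF that(1,2)] that(3) by (rule bspec)
  have SE: "orthogonal_module R (fst s)" "snd s \<in> carrier (fob M (fst s))" if "s \<in> S" for s
    using S(2) that by (auto simp: C)
  \<comment> \<open>Elements of \<open>S\<close> are pairs of an object and a generator there, so
    \<open>fst\<close> and \<open>snd\<close> play the parts of \<open>E\<close> and
    \<open>x\<close>.\<close>
  interpret W: isometry_words R S fst
    by unfold_locales (use assms(3,4) S(1) SE in auto)
  interpret G: hom_generators ?C K S fst
  proof (rule hom_generators.intro)
    show "category ?C" by (rule OrI_category)
    show "ring K" using assms(5) by (simp add: left_noetherian_ring_def)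
    show "fst s \<in> Obj ?C" if "s \<in> S" for s using SE(1)[OF that] by (simp add: C)
    show "finite (SIGMA s:S. Hom ?C (fst s) U)" if "U \<in> Obj ?C" for U
      using W.finite_shapes[of U] that by (simp add: C W.shapes_def)
  qed
  have arrows: "G.arrows = W.shapes"
    by (simp add: fun_eq_iff G.arrows_def W.shapes_def C)
  have post: "G.postcompose U V g = W.postcomp g" for U V g
    by (simp add: G.postcompose_def W.postcomp_def C)
  obtain F where F: "finite F" "F \<subseteq> Obj ?C"
    and lan: "\<And>P. \<lbrakk>\<And>U. U \<in> F \<Longrightarrow> P U; \<And>s. s \<in> S \<Longrightarrow> P (fst s)\<rbrakk> \<Longrightarrow>
      is_lan_of_restriction K (full_subcat ?C P) ?C inclusion_functor M"
  proof (rule G.lan_of_restriction)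
    show "ordered_shapes K (Obj ?C) G.arrows W.key W.foldings"
      unfolding arrows C(1) by (rule W.ordered_shapes[OF assms(5)])
    show "\<exists>g\<in>Hom ?C U V. a = G.postcompose U V g"
      if UVa: "U \<in> Obj ?C" "V \<in> Obj ?C" "a \<in> W.foldings U V" for U V a
    proof -
      have U: "orthogonal_module R U" "orthogonal_module R V" using UVa(1,2) by (simp_all add: C)
      obtain \<sigma> where \<sigma>: "W.folding U V \<sigma>" "a = W.postcomp (W.fold_map U V \<sigma>)"
        using UVa(3) unfolding W.foldings_def by (elim CollectE exE conjE)
      show ?thesis
        unfolding post C \<sigma>(2)
        by (intro bexI[of _ "W.fold_map U V \<sigma>"] refl W.fold_map(1)[OF U \<sigma>(1)])
    qed
    show "G.gen_family M snd" using assms(6) SE(2) by (simp add: G.gen_family_def)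
    show "L U = carrier (fob M U)"
      if "cat_submodule ?C K M L" "\<And>s. s \<in> S \<Longrightarrow> snd s \<in> L (fst s)" "U \<in> Obj ?C" for L U
      by (rule gen[OF that(1) _ that(3)]) (use that(2) in force)
  qed (rule that; blast)
  have "\<exists>n. free_of_rank R (fst U) n" if "U \<in> F \<union> fst ` S" for U
    using that F(2) SE(1) by (auto simp: C orthogonal_module_def)
  then obtain rk where rk: "\<And>U. U \<in> F \<union> fst ` S \<Longrightarrow> free_of_rank R (fst U) (rk U)" by metis
  \<comment> \<open>The objects of \<open>F\<close> and the generator objects have rank at most the
    maximum, hence below \<open>N\<close> because of \<open>Suc\<close>. If there are none,
    \<open>Max\<close> is unspecified but nothing has to be bounded.\<close>
  have "is_lan_of_restriction K (OrI_le R N) ?C inclusion_functor M"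
    if N: "Suc (Max (rk ` (F \<union> fst ` S))) \<le> N" for N
  proof -
    have "\<exists>n<N. free_of_rank R (fst U) n" if U: "U \<in> F \<union> fst ` S" for U
    proof -
      have "rk U \<le> Max (rk ` (F \<union> fst ` S))" using U F(1) S(1) by (intro Max_ge) auto
      then show ?thesis using N rk[OF U] by (intro exI[of _ "rk U"]) simp
    qed
    then show ?thesis unfolding OrI_le_def by (intro lan) auto
  qed
  then show ?thesis by (rule eventually_sequentiallyI)
qed

end
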